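(* Let $\tau\in\mathbf C$ with $\tau\neq 2$ and let $\rho:\Gamma\to \mathrm{SL}(2,\mathbf C)$ be a $\tau$-representation satisfying the BQ-conditions. Set $\nu=\cosh^{-1}(-\tau/2)$. Then $$\sum_{[g]\in\hat\Omega}\mathfrak h_\tau\big(\mathrm{tr}\,\rho(g)\big)=\nu \mod 2\pi i,$$ where the sum converges absolutely.
   Context: $\Gamma=\langle a,b\rangle$ is the free group of rank two, regarded as the fundamental group of a once-punctured torus $\mathbb T$. On $\Gamma$ let $g\sim h$ iff $g$ is conjugate to $h$ or $h^{-1}$. $\hat\Omega\subset\Gamma/\!\sim$ is the set of classes corresponding to free homotopy classes of non-trivial, non-peripheral (unoriented) simple closed curves on $\mathbb T$ (equivalently, classes of elements of $\Gamma$ belonging to a free basis). A $\tau$-representation is a homomorphism $\rho:\Gamma\to\mathrm{SL}(2,\mathbf C)$ with $\mathrm{tr}\,\rho(aba^{-1}b^{-1})=\tau$ for some (hence every) pair of free generators $a,b$. It satisfies the BQ-conditions if (BQ1) $\mathrm{tr}\,\rho(g)\notin[-2,2]$ for all $[g]\in\hat\Omega$, and (BQ2) $|\mathrm{tr}\,\rho(g)|\le 2$ for only finitely many (possibly no) $[g]\in\hat\Omega$. Conventions: $\cosh^{-1}$ takes values with nonnegative real part and imaginary part in $(-\pi,\pi]$ (and, when the real part is $0$, nonnegative imaginary part); $\log$ takes values with imaginary part in $(-\pi,\pi]$. For $x\in\mathbf C$, $l(x)=2\cosh^{-1}(x/2)$, so $e^{l(x)}$ is well defined. With $\nu=\cosh^{-1}(-\tau/2)$,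 the function $\mathfrak h_\tau:\mathbf C\setminus\{\pm\sqrt{\tau+2}\}\to\mathbf C$ is $$\mathfrak h_\tau(x)=\log\frac{e^{\nu}+e^{l(x)}}{e^{-\nu}+e^{l(x)}}.$$ *)

theory Defs
  imports "HOL-Analysis.Analysis" "HOL-Algebra.Generated_Groups"
begin

text \<open>A word over a set of generators is a list of letters \<open>(s, e)\<close>, standing for \<open>s\<close> if
  \<open>e\<close> holds and for the inverse of \<open>s\<close> otherwise.\<close>

definition letter_val :: "('g, 'm) monoid_scheme \<Rightarrow> 'g \<times> bool \<Rightarrow> 'g" where
  "letter_val G l = (if snd l then fst l else inv\<^bsub>G\<^esub> (fst l))"

definition word_val :: "('g, 'm) monoid_scheme \<Rightarrow> ('g \<times> bool) list \<Rightarrow> 'g" where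
  "word_val G w = foldr (\<lambda>l x. letter_val G l \<otimes>\<^bsub>G\<^esub> x) w \<one>\<^bsub>G\<^esub>"

definition reduced :: "('g \<times> bool) list \<Rightarrow> bool" where
  "reduced w \<longleftrightarrow> successively (\<lambda>l k. \<not> (fst l = fst k \<and> snd l \<noteq> snd k)) w"

definition free_basis :: "('g, 'm) monoid_scheme \<Rightarrow> 'g set \<Rightarrow> bool" where
  "free_basis G B \<longleftrightarrow>
     B \<subseteq> carrier G \<and> generate G B = carrier G \<and>
     (\<forall>w. w \<noteq> [] \<longrightarrow> fst ` set w \<subseteq> B \<longrightarrow> reduced w \<longrightarrow> word_val G w \<noteq> \<one>\<^bsub>G\<^esub>)"

definition free_generators :: "('g, 'm) monoid_scheme \<Rightarrow> 'g \<Rightarrow> 'g \<Rightarrow> bool" where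
  "free_generators G a b \<longleftrightarrow> a \<noteq> b \<and> free_basis G {a, b}"

definition free_group_rank_two :: "('g, 'm) monoid_scheme \<Rightarrow> bool" where
  "free_group_rank_two G \<longleftrightarrow> group G \<and> (\<exists>a b. free_generators G a b)"

definition conj_inv_rel :: "('g, 'm) monoid_scheme \<Rightarrow> ('g \<times> 'g) set" where
  "conj_inv_rel G = {(g, h). g \<in> carrier G \<and> h \<in> carrier G \<and>
     (\<exists>x\<in>carrier G. g = x \<otimes>\<^bsub>G\<^esub> h \<otimes>\<^bsub>G\<^esub> inv\<^bsub>G\<^esub> x \<or>
                    g = x \<otimes>\<^bsub>G\<^esub> inv\<^bsub>G\<^esub> h \<otimes>\<^bsub>G\<^esub> inv\<^bsub>G\<^esub> x)}"

text \<open>The non-trivial, non-peripheral unoriented simple closed curves on the once-punctured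
  torus correspond to the classes of those elements of its fundamental group that belong to
  a free basis; every free basis of a free group of rank two is a pair.\<close>

definition curve_classes :: "('g, 'm) monoid_scheme \<Rightarrow> 'g set set" where
  "curve_classes G =
     {C \<in> carrier G // conj_inv_rel G. \<exists>g\<in>C. \<exists>h. free_generators G g h}"

definition SL2C :: "(complex^2^2) monoid" where
  "SL2C = \<lparr>carrier = {A. det A = 1}, mult = (**), one = mat 1\<rparr>"

definition tau_representation ::
    "('g, 'm) monoid_scheme \<Rightarrow> complex \<Rightarrow> ('g \<Rightarrow> complex^2^2) \<Rightarrow> bool" where
  "tau_representation G \<tau> \<rho> \<longleftrightarrow> \<rho> \<in> hom G SL2C \<and>
     (\<exists>a b. free_generators G a b \<and>
        trace (\<rho> (a \<otimes>\<^bsub>G\<^esub> b \<otimes>\<^bsub>G\<^esub> inv\<^bsub>G\<^esub> a \<otimes>\<^bsub>G\<^esub> inv\<^bsub>G\<^esub> b)) = \<tau>)"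

text \<open>The trace of a class is the common value of the traces of its members; see
  \<open>class_trace_eq\<close> below.\<close>

definition class_trace :: "('g \<Rightarrow> complex^2^2) \<Rightarrow> 'g set \<Rightarrow> complex" where
  "class_trace \<rho> C = the_elem ((\<lambda>g. trace (\<rho> g)) ` C)"

definition BQ_conditions ::
    "('g, 'm) monoid_scheme \<Rightarrow> ('g \<Rightarrow> complex^2^2) \<Rightarrow> bool" where
  "BQ_conditions G \<rho> \<longleftrightarrow>
     (\<forall>C\<in>curve_classes G. class_trace \<rho> C \<notin> complex_of_real ` {-2..2}) \<and>
     finite {C \<in> curve_classes G. cmod (class_trace \<rho> C) \<le> 2}"

text \<open>The library function \<^const>\<open>arcosh\<close> uses another branch on the complex numbers: its
  value can have negative real part.\<close>

definition acosh :: "complex \<Rightarrow> complex" where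
  "acosh x = (THE z. cosh z = x \<and> Re z \<ge> 0 \<and> -pi < Im z \<and> Im z \<le> pi \<and>
                     (Re z = 0 \<longrightarrow> Im z \<ge> 0))"

definition l_fun :: "complex \<Rightarrow> complex" where
  "l_fun x = 2 * acosh (x / 2)"

definition nu :: "complex \<Rightarrow> complex" where
  "nu \<tau> = acosh (- \<tau> / 2)"

text \<open>Meant for \<open>x\<^sup>2 \<noteq> \<tau> + 2\<close>, where both numerator and denominator are nonzero.\<close>

definition h_fun :: "complex \<Rightarrow> complex \<Rightarrow> complex" where
  "h_fun \<tau> x = Ln ((exp (nu \<tau>) + exp (l_fun x)) / (exp (- nu \<tau>) + exp (l_fun x)))"

lemma cosh_eq_complex_iff:
  fixes w z :: complex
  shows "cosh w = cosh z \<longleftrightarrow>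
    (\<exists>n::int. w = z + 2 * pi * n * \<i> \<or> w = - z + 2 * pi * n * \<i>)"
proof -
  have ints: "(\<exists>m\<in>\<int>. P m) \<longleftrightarrow> (\<exists>n::int. P (of_int (- n)))" for P :: "real \<Rightarrow> bool"
    by (metis Ints_cases Ints_of_int minus_minus)
  have eq1: "\<i> * w = \<i> * z + complex_of_real (2 * real_of_int (- n) * pi) \<longleftrightarrow>
      w = z + 2 * pi * n * \<i>" for n :: int
    by (auto simp: complex_eq_iff algebra_simps)
  have eq2: "\<i> * w = - (\<i> * z) + complex_of_real (2 * real_of_int (- n) * pi) \<longleftrightarrow>
      w = - z + 2 * pi * n * \<i>" for n :: int
    by (auto simp: complex_eq_iff algebra_simps)
  show ?thesis
    unfolding cosh_conv_cos complex_cos_eq ints eq1 eq2 ..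
qed

lemma acosh_ex1:
  "\<exists>!z. cosh z = x \<and> Re z \<ge> 0 \<and> -pi < Im z \<and> Im z \<le> pi \<and> (Re z = 0 \<longrightarrow> Im z \<ge> 0)"
proof (rule ex_ex1I)
  define u where "u = x + csqrt (x\<^sup>2 - 1)"
  have u1: "u * (x - csqrt (x\<^sup>2 - 1)) = 1"
    by (simp add: u_def algebra_simps flip: power2_eq_square)
  then have u0: "u \<noteq> 0" by auto
  have "inverse u = x - csqrt (x\<^sup>2 - 1)"
    using u1 inverse_unique by blast
  then have c: "cosh (Ln u) = x"
    using u0 by (simp add: cosh_ln_complex) (simp add: u_def)
  define w where "w = Ln u"
  have w: "cosh w = x" "-pi < Im w" "Im w \<le> pi"
    using c u0 mpi_less_Im_Ln Im_Ln_le_pi by (auto simp: w_def)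
  have c2: "cosh (- w + 2 * pi * \<i>) = x"
    using w(1) by (metis (no_types, lifting) cosh_eq_complex_iff mult.right_neutral of_int_1 of_real_1)
  show "\<exists>z. cosh z = x \<and> Re z \<ge> 0 \<and> -pi < Im z \<and> Im z \<le> pi \<and> (Re z = 0 \<longrightarrow> Im z \<ge> 0)"
  proof (cases "Re w > 0 \<or> (Re w = 0 \<and> Im w \<ge> 0)")
    case True
    then show ?thesis using w by (intro exI[of _ w]) auto
  next
    case False
    show ?thesis
    proof (cases "Im w = pi")
      case True
      then show ?thesis using False c2 pi_gt_zero
        by (intro exI[of _ "- w + 2 * pi * \<i>"]) auto
    next
      case neq: False
      then show ?thesis using False w by (intro exI[of _ "- w"]) auto
    qed
  qed
next
  fix z z'
  assume z: "cosh z = x \<and> Re z \<ge> 0 \<and> -pi < Im z \<and> Im z \<le> pi \<and> (Re z = 0 \<longrightarrow> Im z \<ge> 0)"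
    and z': "cosh z' = x \<and> Re z' \<ge> 0 \<and> -pi < Im z' \<and> Im z' \<le> pi \<and> (Re z' = 0 \<longrightarrow> Im z' \<ge> 0)"
  have small: "n = 0" if "\<bar>2 * pi * real_of_int n\<bar> < 2 * pi" for n :: int
  proof -
    have "\<bar>real_of_int n\<bar> < 1" using that pi_gt_zero by (simp add: abs_mult)
    then show ?thesis by linarith
  qed
  from z z' obtain n :: int where
    n: "z = z' + 2 * pi * n * \<i> \<or> z = - z' + 2 * pi * n * \<i>"
    using cosh_eq_complex_iff by metis
  then show "z = z'"
  proof
    assume a: "z = z' + 2 * pi * n * \<i>"
    then have "Im z - Im z' = 2 * pi * n" by simp
    then have "n = 0" using z z' by (intro small) linarith
    then show ?thesis using a by simp
  next
    assume a: "z = - z' + 2 * pi * n * \<i>"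
    then have r: "Re z = 0" "Re z' = 0" using z z' by simp_all
    have i: "Im z + Im z' = 2 * pi * n" using a by simp
    show ?thesis
    proof (cases "Im z = pi \<and> Im z' = pi")
      case True
      then show ?thesis using r by (simp add: complex_eq_iff)
    next
      case False
      then have "n = 0" using z z' r i by (intro small) linarith
      then show ?thesis using i r z z' by (simp add: complex_eq_iff)
    qed
  qed
qed

lemma group_SL2C: "group SL2C"
proof (rule groupI)
  fix A assume "A \<in> carrier SL2C"
  then have d: "det A = 1" by (simp add: SL2C_def)
  then obtain B where B: "B ** A = mat 1"
    by (metis invertible_det_nz invertible_left_inverse zero_neq_one)
  then have "det B = 1" using d by (metis det_I det_mul mult.right_neutral)
  then show "\<exists>B\<in>carrier SL2C. B \<otimes>\<^bsub>SL2C\<^esub> A = \<one>\<^bsub>SL2C\<^esub>"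
    using B by (auto simp: SL2C_def)
qed (auto simp: SL2C_def det_mul matrix_mul_assoc)

lemma equiv_conj_inv_rel:
  fixes G (structure)
  assumes "group G"
  shows "equiv (carrier G) (conj_inv_rel G)"
proof -
  interpret group G by fact
  have conj: "x \<otimes> (y \<otimes> g \<otimes> inv y) \<otimes> inv x = (x \<otimes> y) \<otimes> g \<otimes> inv (x \<otimes> y)"
    if "x \<in> carrier G" "y \<in> carrier G" "g \<in> carrier G" for x y g
    using that by (simp add: m_assoc inv_mult_group)
  have invc: "inv (x \<otimes> g \<otimes> inv x) = x \<otimes> inv g \<otimes> inv x"
    if "x \<in> carrier G" "g \<in> carrier G" for x g
    using that by (simp add: m_assoc inv_mult_group)
  have unconj: "inv x \<otimes> (x \<otimes> g \<otimes> inv x) \<otimes> x = g"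
    if "x \<in> carrier G" "g \<in> carrier G" for x g
    using that by (metis conj inv_closed inv_inv l_inv l_one r_one inv_one)
  show ?thesis
  proof (rule equivI)
    show "conj_inv_rel G \<subseteq> carrier G \<times> carrier G" by (auto simp: conj_inv_rel_def)
    show "refl_on (carrier G) (conj_inv_rel G)"
      by (auto simp: refl_on_def conj_inv_rel_def intro!: bexI[of _ "\<one>"])
    show "sym (conj_inv_rel G)"
    proof (rule symI)
      fix g h assume "(g, h) \<in> conj_inv_rel G"
      then obtain x where x: "x \<in> carrier G" "g \<in> carrier G" "h \<in> carrier G"
        and gx: "g = x \<otimes> h \<otimes> inv x \<or> g = x \<otimes> inv h \<otimes> inv x"
        by (auto simp: conj_inv_rel_def)
      have "h = inv x \<otimes> g \<otimes> inv (inv x) \<or> h = inv x \<otimes> inv g \<otimes> inv (inv x)"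
        using gx x unconj[of x h] invc[of x "inv h"] by auto
      then show "(h, g) \<in> conj_inv_rel G"
        using x unfolding conj_inv_rel_def by blast
    qed
    show "trans (conj_inv_rel G)"
    proof (rule transI)
      fix g h k assume "(g, h) \<in> conj_inv_rel G" "(h, k) \<in> conj_inv_rel G"
      then obtain x y where x: "x \<in> carrier G" "y \<in> carrier G"
          "g \<in> carrier G" "h \<in> carrier G" "k \<in> carrier G"
        and gx: "g = x \<otimes> h \<otimes> inv x \<or> g = x \<otimes> inv h \<otimes> inv x"
        and hy: "h = y \<otimes> k \<otimes> inv y \<or> h = y \<otimes> inv k \<otimes> inv y"
        by (auto simp: conj_inv_rel_def)
      have "inv h = y \<otimes> inv k \<otimes> inv y \<or> inv h = y \<otimes> k \<otimes> inv y"
        using hy x invc[of y k] invc[of y "inv k"] by auto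
      then have "g = (x \<otimes> y) \<otimes> k \<otimes> inv (x \<otimes> y) \<or> g = (x \<otimes> y) \<otimes> inv k \<otimes> inv (x \<otimes> y)"
        using gx hy x conj[of x y k] conj[of x y "inv k"] by auto
      then show "(g, k) \<in> conj_inv_rel G"
        using x unfolding conj_inv_rel_def by blast
    qed
  qed
qed

lemma trace_left_inverse_SL2:
  fixes A B :: "complex^2^2"
  assumes "det A = 1" "B ** A = mat 1"
  shows "trace B = trace A"
proof -
  define C :: "complex^2^2" where
    "C = (\<chi> i j. if i = j then trace A - A$i$j else - A$i$j)"
  have "A ** C = mat 1"
    using assms(1)
    by (simp add: C_def matrix_matrix_mult_def mat_def vec_eq_iff forall_2 sum_2 trace_def
        det_2 algebra_simps)
  then have "B = C"
    using assms(2) by (metis matrix_mul_assoc matrix_mul_lid matrix_mul_rid)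
  then show ?thesis by (simp add: C_def trace_def sum_2)
qed

lemma class_trace_eq:
  fixes G (structure)
  assumes "group G" "\<rho> \<in> hom G SL2C" "C \<in> carrier G // conj_inv_rel G" "g \<in> C"
  shows "class_trace \<rho> C = trace (\<rho> g)"
proof -
  interpret group G by fact
  interpret \<rho>: group_hom G SL2C \<rho>
    using assms(1,2) group_SL2C by (simp add: group_hom_def group_hom_axioms_def)
  have m: "\<rho> (x \<otimes> y) = \<rho> x ** \<rho> y" if "x \<in> carrier G" "y \<in> carrier G" for x y
    using that by (simp add: SL2C_def)
  have one: "\<rho> \<one> = mat 1" using \<rho>.hom_one by (simp add: SL2C_def)
  have det1: "det (\<rho> x) = 1" if "x \<in> carrier G" for x
    using \<rho>.hom_closed[OF that] by (simp add: SL2C_def)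
  have tinv: "trace (\<rho> (inv x)) = trace (\<rho> x)" if "x \<in> carrier G" for x
    using that det1 m one by (metis inv_closed l_inv trace_left_inverse_SL2)
  have tconj: "trace (\<rho> (x \<otimes> h \<otimes> inv x)) = trace (\<rho> h)"
    if "x \<in> carrier G" "h \<in> carrier G" for x h
  proof -
    have "\<rho> (x \<otimes> h \<otimes> inv x) = (\<rho> x ** \<rho> h) ** \<rho> (inv x)"
      using that by (simp only: m m_closed inv_closed)
    moreover have "\<rho> (inv x \<otimes> (x \<otimes> h)) = \<rho> (inv x) ** (\<rho> x ** \<rho> h)"
      using that by (simp only: m m_closed inv_closed)
    moreover have "inv x \<otimes> (x \<otimes> h) = h"
      using that by (simp flip: m_assoc)
    ultimately show ?thesis
      by (simp only: trace_mul_sym[of "\<rho> x ** \<rho> h"])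
  qed
  have "trace (\<rho> h) = trace (\<rho> g)" if "h \<in> C" for h
  proof -
    have "(h, g) \<in> conj_inv_rel G"
      using quotient_eq_iff[OF equiv_conj_inv_rel[OF assms(1)] assms(3,3) that assms(4)] by simp
    then obtain x where "x \<in> carrier G" "g \<in> carrier G"
        "h = x \<otimes> g \<otimes> inv x \<or> h = x \<otimes> inv g \<otimes> inv x"
      by (auto simp: conj_inv_rel_def)
    then show ?thesis
      by (elim disjE) (simp_all only: tconj tinv inv_closed)
  qed
  then have "(\<lambda>h. trace (\<rho> h)) ` C = (\<lambda>h. trace (\<rho> g)) ` C"
    by (rule image_cong[OF refl])
  then have "(\<lambda>h. trace (\<rho> h)) ` C = {trace (\<rho> g)}"
    using assms(4) by (simp only: image_constant)
  then show ?thesis by (simp add: class_trace_def)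
qed

end

(* The curve classes are the regions complementary to a trivalent tree, and around an edge with
   traces x, y on its sides and z, w at its ends one has z + w = x y and
   x^2 + y^2 + z^2 - x y z = tau + 2 =: mu.  With kappa = e^nu - 1, where kappa^2 = -(1 + kappa) mu,
   these relations make the product of x y + kappa z over the edges entering a finite subtree equal
   to e^nu times the product of v^2 - mu over the regions v meeting the subtree.  On the other hand
   exp (h v) = a(v)^2 / (v^2 - mu) with a(v) = l + e^nu / l, v = l + 1/l, and every region meeting
   the subtree borders two of these edges.  So exp of a partial sum of the series is e^nu divided
   by the product of (x y + kappa z) / (a(x) a(y)) over the boundary edges, and it remains to see
   that this product tends to 1.

   The BQ-conditions imply that |z| <= |w| on all but finitely many edges directed away from a
   root: an infinite ray along which the modulus decreases would force mu = 4, that is, tau = 2.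
   Hence log (|v| / 2) is eventually superadditive and grows like the word length of the curve, the
   sum of |v|^-2 converges, and each boundary factor differs from 1 by at most a constant times
   |v|^-2 for the region v that was added last.

   That the regions of the tree are all the curve classes is Nielsen's theorem in rank two, and
   different regions have different images in the abelianization. *)

theory Submission
  imports Defs
begin

text \<open>The obstacle is that regions of modulus at most 2 survive the BQ-conditions, and beside
  such a region the superadditivity of ln (|v| / 2) gives no growth. It is controlled through its
  neighbours in cyclic order, which obey a linear recurrence with characteristic roots l and 1/l,
  where |l| > 1 because the trace lies off [-2,2]. If the growing mode were absent, the neighbours
  would tend to 0, against the finiteness condition; so they grow geometrically. The same argument
  excludes v^2 = \<mu> for every region, since then the Markoff equation would make one mode vanish;
  thus all logarithms have nonzero arguments. The tree is cut at a root edge into two binary trees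
  indexed by bool lists, and an absolutely convergent sum over curves is a limit over balls. Only
  products are evaluated exactly, so the sum is known through its exponential, whence the ambiguity
  of 2 pi i. Nielsen's theorem is proved by shortening generating pairs. Where cancellation from
  both sides swallows a whole letter, the usual tie-breaking order on half-words is replaced by a
  conjugation, which does not change curves.\<close>

section \<open>Edges of the trace tree\<close>

text \<open>If the two regions beside an edge have homology classes \<open>u\<close> and \<open>v\<close>, then the region ahead
  of its descendant along \<open>p\<close> has the class \<open>m u + n v\<close> with \<open>(m, n) = coef p\<close>.\<close>

fun coef :: "bool list \<Rightarrow> nat \<times> nat" where
  "coef [] = (1, 1)"
| "coef (b # p) = (case coef p of (m, n) \<Rightarrow> if b then (m, m + n) else (m + n, n))"

lemma coef_pos: "0 < fst (coef p)" "0 < snd (coef p)"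
  by (induction p) (auto split: prod.splits)

text \<open>The first letter of a path is read off from which coordinate is larger (they agree only
  for the empty path), and one subtraction recovers the rest: Euclid's algorithm run backwards, as
  in the Stern-Brocot tree.\<close>

lemma inj_coef: "inj coef"
proof (rule injI)
  fix p q show "coef p = coef q \<Longrightarrow> p = q"
  proof (induction p arbitrary: q)
    case Nil
    show ?case
    proof (cases q)
      case (Cons b q')
      then show ?thesis using Nil coef_pos[of q'] by (auto split: prod.splits if_splits)
    qed simp
  next
    case (Cons b p)
    show ?case
    proof (cases q)
      case Nil
      then show ?thesis using Cons coef_pos[of p] by (auto split: prod.splits if_splits)
    next
      case (Cons b' q')
      obtain m n m' n' where c: "coef p = (m, n)" "coef q' = (m', n')"
        by (metis surj_pair)
      then have "b = b' \<and> m = m' \<and> n = n'"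
        using Cons.prems coef_pos[of p] coef_pos[of q'] unfolding Cons
        by (auto split: if_splits)
      then show ?thesis using Cons.IH[of q'] c Cons by auto
    qed
  qed
qed

text \<open>A directed edge of the tree is recorded by the traces of the regions to its left, to its right
  and behind it; \<open>edge_step False\<close> keeps the left region and \<open>edge_step True\<close> the right one.\<close>

type_synonym edge = "complex \<times> complex \<times> complex"

abbreviation lf :: "edge \<Rightarrow> complex" where "lf s \<equiv> fst s"
abbreviation rt :: "edge \<Rightarrow> complex" where "rt s \<equiv> fst (snd s)"
abbreviation bk :: "edge \<Rightarrow> complex" where "bk s \<equiv> snd (snd s)"

definition ahead :: "edge \<Rightarrow> complex" where
  "ahead s = lf s * rt s - bk s"

definition edge_step :: "bool \<Rightarrow> edge \<Rightarrow> edge" where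
  "edge_step b s = (if b then (ahead s, rt s, lf s) else (lf s, ahead s, rt s))"

abbreviation descend :: "bool list \<Rightarrow> edge \<Rightarrow> edge" where
  "descend p s \<equiv> fold edge_step p s"

definition markoff :: "complex \<Rightarrow> edge \<Rightarrow> bool" where
  "markoff \<mu> s \<longleftrightarrow> (lf s)\<^sup>2 + (rt s)\<^sup>2 + (bk s)\<^sup>2 - lf s * rt s * bk s = \<mu>"

lemma markoff_step: "markoff \<mu> s \<Longrightarrow> markoff \<mu> (edge_step b s)"
  by (auto simp: markoff_def edge_step_def ahead_def algebra_simps power2_eq_square)

lemma markoff_descend: "markoff \<mu> s \<Longrightarrow> markoff \<mu> (descend p s)"
  by (induction p arbitrary: s) (auto simp: markoff_step)

section \<open>Products over the levels and balls of the binary tree\<close>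

lemma finite_bool_lists: "finite {p :: bool list. length p = n}" "finite {p :: bool list. length p < n}"
proof -
  show "finite {p :: bool list. length p = n}"
    using finite_lists_length_eq[of "UNIV :: bool set" n] by simp
  show "finite {p :: bool list. length p < n}"
    by (rule finite_subset[OF _ finite_lists_length_le[of "UNIV :: bool set" n]]) auto
qed

lemma bool_lists_Suc:
  "{p :: bool list. length p = Suc n} = Cons False ` {p. length p = n} \<union> Cons True ` {p. length p = n}"
  by (auto simp: length_Suc_conv image_iff)

lemma bool_lists_less_Suc:
  "{p :: bool list. length p < Suc n} =
     insert [] (Cons False ` {p. length p < n} \<union> Cons True ` {p. length p < n})"
proof -
  have "p \<in> insert [] (Cons False ` {p. length p < n} \<union> Cons True ` {p. length p < n})"
    if "length p < Suc n" for p :: "bool list"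
    using that by (cases p) (auto simp: image_iff)
  then show ?thesis by auto
qed

context comm_monoid_mult begin

lemma prod_lists_Suc:
  "(\<Prod>p | length p = Suc n. f p) =
    (\<Prod>p | length p = n. f (False # p)) * (\<Prod>p | length p = n. f (True # p))"
  unfolding bool_lists_Suc
  by (subst prod.union_disjoint) (auto simp: finite_bool_lists prod.reindex)

lemma prod_lists_less_Suc:
  "(\<Prod>p | length p < Suc n. f p) =
    f [] * ((\<Prod>p | length p < n. f (False # p)) * (\<Prod>p | length p < n. f (True # p)))"
  unfolding bool_lists_less_Suc
  by (subst prod.insert, simp add: finite_bool_lists, force,
      subst prod.union_disjoint) (auto simp: finite_bool_lists prod.reindex)

end

section \<open>Telescoping of the edge numerators\<close>

definition edge_num :: "complex \<Rightarrow> edge \<Rightarrow> complex" where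
  "edge_num \<kappa> s = lf s * rt s + \<kappa> * bk s"

text \<open>A polynomial identity modulo the two assumed relations. It is the local form of the
  telescoping: at a vertex two outgoing factors replace one, at the price of a factor for the new
  region.\<close>

lemma edge_num_step:
  assumes "\<kappa>\<^sup>2 = - ((1 + \<kappa>) * \<mu>)" "markoff \<mu> s"
  shows "edge_num \<kappa> (edge_step False s) * edge_num \<kappa> (edge_step True s) =
    edge_num \<kappa> s * ((ahead s)\<^sup>2 - \<mu>)"
proof -
  obtain x y z where s: "s = (x, y, z)" by (metis prod_cases3)
  show ?thesis using assms unfolding s markoff_def edge_num_def edge_step_def ahead_def
    by simp algebra
qed

text \<open>This supplies the constant \<open>1 + \<kappa>\<close> (later \<open>e\<close>) and the
  factors of the two root sides, which neither half-tree sees.\<close>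

lemma edge_num_flip:
  assumes "\<kappa>\<^sup>2 = - ((1 + \<kappa>) * \<mu>)" "markoff \<mu> (x, y, z)"
  shows "edge_num \<kappa> (x, y, z) * edge_num \<kappa> (x, y, x * y - z) =
    (1 + \<kappa>) * ((x\<^sup>2 - \<mu>) * (y\<^sup>2 - \<mu>))"
  using assms unfolding markoff_def edge_num_def by simp algebra

lemma prod_edge_num:
  assumes "\<kappa>\<^sup>2 = - ((1 + \<kappa>) * \<mu>)" "markoff \<mu> s"
  shows "(\<Prod>p | length p = n. edge_num \<kappa> (descend p s)) =
    edge_num \<kappa> s * (\<Prod>p | length p < n. (ahead (descend p s))\<^sup>2 - \<mu>)"
  using assms(2)
proof (induction n arbitrary: s)
  case 0
  then show ?case by simp
next
  case (Suc n)
  have "(\<Prod>p | length p = Suc n. edge_num \<kappa> (descend p s)) =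
      (edge_num \<kappa> (edge_step False s) * edge_num \<kappa> (edge_step True s)) *
      ((\<Prod>p | length p < n. (ahead (descend p (edge_step False s)))\<^sup>2 - \<mu>) *
       (\<Prod>p | length p < n. (ahead (descend p (edge_step True s)))\<^sup>2 - \<mu>))"
    using Suc.IH[OF markoff_step[OF Suc.prems]] by (simp add: prod_lists_Suc mult_ac)
  then show ?case
    unfolding edge_num_step[OF assms(1) Suc.prems] by (simp add: prod_lists_less_Suc mult_ac)
qed

text \<open>Crossing a vertex makes the region ahead a side of both new edges, hence the square. The
  root sides occur only once; their second copy comes from the other half-tree.\<close>

lemma prod_edge_sides:
  "(\<Prod>p | length p = n. f (lf (descend p s)) * f (rt (descend p s))) =
    f (lf s) * f (rt s) * (\<Prod>p | length p < n. (f (ahead (descend p s)) :: complex)\<^sup>2)"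
proof (induction n arbitrary: s)
  case 0
  then show ?case by simp
next
  case (Suc n)
  show ?case
    using Suc.IH[of "edge_step False s"] Suc.IH[of "edge_step True s"]
    by (simp add: prod_lists_Suc prod_lists_less_Suc edge_step_def algebra_simps power2_eq_square)
qed

text \<open>This is e^(l(x)/2), an eigenvalue of largest modulus of a matrix in SL(2,C) with trace
  \<open>x\<close>.\<close>

definition multiplier :: "complex \<Rightarrow> complex" where
  "multiplier x = exp (acosh (x / 2))"

lemma acosh_prop:
  "cosh (acosh x) = x" "Re (acosh x) \<ge> 0"
  using theI'[OF acosh_ex1[of x]] unfolding acosh_def by auto

lemma multiplier_nonzero [simp]: "multiplier x \<noteq> 0" by (simp add: multiplier_def)

lemma multiplier_sum: "multiplier x + inverse (multiplier x) = x"
proof -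
  have "cosh (acosh (x / 2)) = x / 2" by (rule acosh_prop)
  then have "(exp (acosh (x / 2)) + inverse (exp (acosh (x / 2)))) / 2 = x / 2"
    by (simp add: cosh_def exp_minus scaleR_conv_of_real)
  then show ?thesis unfolding multiplier_def divide_cancel_right by simp
qed

lemma norm_multiplier_ge_1: "1 \<le> norm (multiplier x)"
  using acosh_prop(2)[of "x / 2"] by (simp add: multiplier_def)

text \<open>On the unit circle the inverse is the complex conjugate, so \<open>x\<close> would be
  twice a real part and lie in [-2,2]. Through this lemma (BQ1) enters the growth estimates.\<close>

lemma norm_multiplier_gt_1:
  assumes "x \<notin> complex_of_real ` {-2..2}"
  shows "1 < norm (multiplier x)"
proof (rule ccontr)
  assume "\<not> ?thesis"
  then have "norm (multiplier x) = 1" using norm_multiplier_ge_1[of x] by simp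
  then have c: "inverse (multiplier x) = cnj (multiplier x)"
    by (metis complex_norm_square inverse_unique of_real_1 one_power2)
  have "x = of_real (2 * Re (multiplier x))"
    using multiplier_sum[of x] unfolding c by (simp add: complex_add_cnj)
  moreover have "2 * Re (multiplier x) \<in> {-2..2}"
    using \<open>norm (multiplier x) = 1\<close> abs_Re_le_cmod[of "multiplier x"] by auto
  ultimately have "x \<in> complex_of_real ` {-2..2}" by (rule image_eqI)
  then show False using assms by contradiction
qed

lemma norm_le_multiplier: "norm x \<le> 2 * norm (multiplier x)"
proof -
  have "norm x \<le> norm (multiplier x) + norm (inverse (multiplier x))"
    by (metis multiplier_sum norm_triangle_ineq)
  also have "norm (inverse (multiplier x)) \<le> 1" using norm_multiplier_ge_1[of x]
    by (simp add: norm_inverse inverse_le_1_iff)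
  finally show ?thesis using norm_multiplier_ge_1[of x] by linarith
qed

section \<open>Linear recurrences and descending rays\<close>

text \<open>The characteristic roots are \<open>l\<close> and \<open>inverse l\<close>; each
  combination kills one mode and is geometric in the other.\<close>

lemma recurrence_solution:
  fixes y :: "nat \<Rightarrow> complex"
  assumes "\<And>n. y (Suc (Suc n)) = (l + inverse l) * y (Suc n) - y n" "l \<noteq> 0"
  shows "y (Suc n) - inverse l * y n = l ^ n * (y 1 - inverse l * y 0)"
    and "y (Suc n) - l * y n = inverse l ^ n * (y 1 - l * y 0)"
proof (induction n)
  case (Suc n)
  { case 1
    have "y (Suc (Suc n)) - inverse l * y (Suc n) = l * (y (Suc n) - inverse l * y n)"
      using assms(2) by (simp add: assms(1) field_simps)
    then show ?case using Suc(1) by simp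
  next
    case 2
    have "y (Suc (Suc n)) - l * y (Suc n) = inverse l * (y (Suc n) - l * y n)"
      using assms(2) by (simp add: assms(1) field_simps)
    then show ?case using Suc(2) by simp }
qed simp_all

lemma multiplier_diff_nonzero:
  assumes "1 < norm l"
  shows "l - inverse l \<noteq> (0::complex)"
proof
  assume "l - inverse l = 0"
  then have "norm l = inverse (norm l)" by (metis eq_iff_diff_eq_0 norm_inverse)
  then show False using assms by (metis inverse_less_1_iff less_asym' not_less_iff_gr_or_eq)
qed

lemma recurrence_limit:
  fixes y :: "nat \<Rightarrow> complex"
  assumes rec: "\<And>n. y (Suc (Suc n)) = (l + inverse l) * y (Suc n) - y n" and l: "1 < norm l"
  shows "(\<lambda>n. y n / l ^ n) \<longlonglongrightarrow> (y 1 - inverse l * y 0) / (l - inverse l)"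
proof -
  have l0: "l \<noteq> 0" using l by auto
  note d = multiplier_diff_nonzero[OF l]
  define u v where "u = y 1 - inverse l * y 0" and "v = y 1 - l * y 0"
  have eq: "y n / l ^ n = (u - (inverse l ^ 2) ^ n * v) / (l - inverse l)" for n
  proof -
    have "(l - inverse l) * y n = l ^ n * u - inverse l ^ n * v"
      using arg_cong2[OF recurrence_solution[of y l, OF rec l0, of n, folded u_def v_def], of "\<lambda>a b. a - b"]
      by (simp add: algebra_simps)
    then have "(l - inverse l) * (y n / l ^ n) = (l ^ n * u - inverse l ^ n * v) / l ^ n"
      by simp
    also have "\<dots> = u - (inverse l ^ 2) ^ n * v"
    proof -
      have "l ^ n * inverse l ^ n = 1" using l0 by (simp flip: power_mult_distrib)
      moreover have "a * u - b * v = (u - b\<^sup>2 * v) * a" if "a * b = 1" for a b :: complex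
        using that by algebra
      ultimately have "l ^ n * u - inverse l ^ n * v = (u - (inverse l ^ n)\<^sup>2 * v) * l ^ n" by blast
      moreover have "(inverse l ^ n)\<^sup>2 = (inverse l ^ 2) ^ n" by (simp flip: power_mult add: mult.commute)
      ultimately show ?thesis using l0 by (simp add: divide_eq_eq)
    qed
    finally show ?thesis using d by (simp add: eq_divide_eq mult.commute)
  qed
  have "norm (inverse l) < 1" using l by (simp add: norm_inverse inverse_less_1_iff)
  then have "norm (inverse l ^ 2) < 1"
    unfolding norm_power by (simp only: abs_square_less_1 abs_norm_cancel)
  then have "(\<lambda>n. (inverse l ^ 2) ^ n) \<longlonglongrightarrow> 0" by (rule LIMSEQ_power_zero)
  then have "(\<lambda>n. (u - (inverse l ^ 2) ^ n * v) / (l - inverse l)) \<longlonglongrightarrow> (u - 0 * v) / (l - inverse l)"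
    using d by (intro tendsto_divide tendsto_diff tendsto_mult tendsto_const)
  then show ?thesis unfolding eq u_def by simp
qed

text \<open>Without the growing mode, \<open>y\<close> would be geometric with ratio
  \<open>inverse l\<close> and tend to 0.\<close>

lemma recurrence_leading_coeff:
  fixes y :: "nat \<Rightarrow> complex"
  assumes rec: "\<And>n. y (Suc (Suc n)) = (l + inverse l) * y (Suc n) - y n" and l: "1 < norm l"
    and big: "eventually (\<lambda>n. 2 < norm (y n)) sequentially"
  shows "y 1 \<noteq> inverse l * y 0"
proof
  assume eq: "y 1 = inverse l * y 0"
  have l0: "l \<noteq> 0" using l by auto
  have "y (Suc n) = inverse l * y n" for n
    using recurrence_solution(1)[of y l, OF rec l0, of n] eq by simp
  then have yn: "y n = inverse l ^ n * y 0" for n by (induction n) (auto simp: algebra_simps)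
  have "norm (inverse l) < 1" using l by (simp add: norm_inverse inverse_less_1_iff)
  then have "(\<lambda>n. inverse l ^ n * y 0) \<longlonglongrightarrow> 0 * y 0"
    by (intro tendsto_intros LIMSEQ_power_zero)
  then have "(\<lambda>n. norm (inverse l ^ n * y 0)) \<longlonglongrightarrow> 0" by (simp add: tendsto_norm_zero)
  then have "(\<lambda>n. norm (y n)) \<longlonglongrightarrow> 0" by (simp add: yn[symmetric])
  then have "eventually (\<lambda>n. norm (y n) < 2) sequentially" by (rule order_tendstoD) simp
  with big have "eventually (\<lambda>n. False) sequentially" by eventually_elim simp
  then show False by simp
qed

text \<open>The quotient of the normalised terms tends to 1, hence eventually exceeds
  \<open>1 / (norm l)\<^sup>2\<close>. Terms two apart are compared because the regions behind and
  ahead of an edge are two apart among the neighbours of a side.\<close>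

lemma recurrence_eventually_increasing:
  fixes y :: "nat \<Rightarrow> complex"
  assumes rec: "\<And>n. y (Suc (Suc n)) = (l + inverse l) * y (Suc n) - y n" and l: "1 < norm l"
    and big: "eventually (\<lambda>n. 2 < norm (y n)) sequentially"
  shows "eventually (\<lambda>n. norm (y n) \<le> norm (y (Suc (Suc n)))) sequentially"
proof -
  have l0: "l \<noteq> 0" using l by auto
  define A where "A = (y 1 - inverse l * y 0) / (l - inverse l)"
  have A: "(\<lambda>n. y n / l ^ n) \<longlonglongrightarrow> A" "A \<noteq> 0"
    using recurrence_limit[of y l, OF rec l] recurrence_leading_coeff[of y l, OF rec l big] multiplier_diff_nonzero[OF l]
    by (auto simp: A_def)
  have "(\<lambda>n. norm ((y (Suc (Suc n)) / l ^ Suc (Suc n)) / (y n / l ^ n))) \<longlonglongrightarrow> norm (A / A)"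
    using A LIMSEQ_ignore_initial_segment[OF A(1), of 2] by (intro tendsto_intros) auto
  then have "(\<lambda>n. norm ((y (Suc (Suc n)) / l ^ Suc (Suc n)) / (y n / l ^ n))) \<longlonglongrightarrow> 1"
    using A(2) by simp
  moreover have "1 / (norm l)\<^sup>2 < 1" using l by (simp add: divide_less_eq)
  ultimately have "eventually (\<lambda>n. 1 / (norm l)\<^sup>2 <
      norm ((y (Suc (Suc n)) / l ^ Suc (Suc n)) / (y n / l ^ n))) sequentially"
    by (rule order_tendstoD)
  with big show ?thesis
  proof eventually_elim
    case (elim n)
    have "norm ((y (Suc (Suc n)) / l ^ Suc (Suc n)) / (y n / l ^ n)) =
        norm (y (Suc (Suc n))) / norm (y n) * (1 / (norm l)\<^sup>2)"
      using l0 by (simp add: norm_divide norm_mult norm_power field_simps power2_eq_square)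
    then have "1 * (1 / (norm l)\<^sup>2) < norm (y (Suc (Suc n))) / norm (y n) * (1 / (norm l)\<^sup>2)"
      using elim by simp
    then have "1 < norm (y (Suc (Suc n))) / norm (y n)"
      by (rule mult_right_less_imp_less) simp
    then show ?case using elim by (simp add: less_divide_eq split: if_splits)
  qed
qed

text \<open>The averages \<open>L n / real (Suc n)\<close> tend to \<open>ln (norm l)\<close>, and
  each is positive since every term exceeds 2. So \<delta> can be the minimum of half the limit and
  of the finitely many averages before the half is passed.\<close>

lemma recurrence_exponential_growth:
  fixes y :: "nat \<Rightarrow> complex"
  assumes rec: "\<And>n. y (Suc (Suc n)) = (l + inverse l) * y (Suc n) - y n" and l: "1 < norm l"
    and big: "\<And>n. 2 < norm (y n)"
  shows "\<exists>\<delta>>0. \<forall>n. 2 * exp (\<delta> * real (Suc n)) \<le> norm (y n)"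
proof -
  have l0: "l \<noteq> 0" using l by auto
  have big': "eventually (\<lambda>n. 2 < norm (y n)) sequentially" using big by simp
  define A where "A = (y 1 - inverse l * y 0) / (l - inverse l)"
  have A: "(\<lambda>n. y n / l ^ n) \<longlonglongrightarrow> A" "A \<noteq> 0"
    using recurrence_limit[of y l, OF rec l] recurrence_leading_coeff[of y l, OF rec l big'] multiplier_diff_nonzero[OF l]
    by (auto simp: A_def)
  define L where "L n = ln (norm (y n) / 2)" for n
  have Lpos: "L n > 0" for n unfolding L_def using big[of n] by (intro ln_gt_zero) simp
  have "(\<lambda>n. ln (norm (y n / l ^ n) / 2)) \<longlonglongrightarrow> ln (norm A / 2)"
    using A by (intro tendsto_intros) auto
  then have "(\<lambda>n. ln (norm (y n / l ^ n) / 2) * inverse (real (Suc n))) \<longlonglongrightarrow> ln (norm A / 2) * 0"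
    by (intro tendsto_mult LIMSEQ_inverse_real_of_nat)
  moreover have "(\<lambda>n. ln (norm l) * (real n / real (Suc n))) \<longlonglongrightarrow> ln (norm l) * 1"
    by (intro tendsto_intros LIMSEQ_n_over_Suc_n)
  ultimately have "(\<lambda>n. ln (norm (y n / l ^ n) / 2) * inverse (real (Suc n)) +
      ln (norm l) * (real n / real (Suc n))) \<longlonglongrightarrow> ln (norm A / 2) * 0 + ln (norm l) * 1"
    by (rule tendsto_add)
  moreover have "ln (norm (y n / l ^ n) / 2) * inverse (real (Suc n)) +
      ln (norm l) * (real n / real (Suc n)) = L n / real (Suc n)" for n
  proof -
    have "norm (y n) > 0" "norm l > 0" using big[of n] l0 by auto
    then have "ln (norm (y n / l ^ n) / 2) = L n - n * ln (norm l)"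
      unfolding L_def by (simp add: norm_divide norm_power ln_div ln_mult ln_realpow)
    then show ?thesis by (simp only: divide_inverse left_diff_distrib mult_ac) (simp add: algebra_simps)
  qed
  ultimately have lim: "(\<lambda>n. L n / real (Suc n)) \<longlonglongrightarrow> ln (norm l)" by simp
  have "ln (norm l) / 2 < ln (norm l)" using ln_gt_zero[OF l] by simp
  from order_tendstoD(1)[OF lim this] obtain N where
    N: "\<And>n. n \<ge> N \<Longrightarrow> ln (norm l) / 2 < L n / real (Suc n)"
    unfolding eventually_sequentially by blast
  define \<delta> where "\<delta> = Min (insert (ln (norm l) / 2) ((\<lambda>n. L n / real (Suc n)) ` {..<N}))"
  have "ln (norm l) > 0" using l by (rule ln_gt_zero)
  then have "\<delta> > 0" unfolding \<delta>_def using Lpos by (subst Min_gr_iff) auto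
  moreover have "2 * exp (\<delta> * real (Suc n)) \<le> norm (y n)" for n
  proof -
    have "\<delta> \<le> L n / real (Suc n)"
    proof (cases "n < N")
      case True
      then show ?thesis unfolding \<delta>_def by (intro Min_le) auto
    next
      case False
      have "\<delta> \<le> ln (norm l) / 2" unfolding \<delta>_def by (intro Min_le) auto
      also have "\<dots> \<le> L n / real (Suc n)" using N[of n] False by (intro less_imp_le) simp
      finally show ?thesis .
    qed
    then have "\<delta> * real (Suc n) \<le> L n" by (simp add: le_divide_eq)
    then have "exp (\<delta> * real (Suc n)) \<le> exp (L n)" by simp
    also have "exp (L n) = norm (y n) / 2" unfolding L_def by (intro exp_ln) (use big[of n] in linarith)
    finally show ?thesis by simp
  qed
  ultimately show ?thesis by blast
qed

lemma Bseq_add_fun: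
  fixes f g :: "nat \<Rightarrow> complex"
  assumes "Bseq f" "Bseq g"
  shows "Bseq (\<lambda>n. f n + g n)"
proof -
  obtain K L where "\<And>n. norm (f n) \<le> K" "\<And>n. norm (g n) \<le> L"
    using assms by (auto simp: Bseq_def)
  then have "norm (f n + g n) \<le> K + L" for n
    using norm_triangle_ineq[of "f n" "g n"] by (meson add_mono order_trans)
  then show ?thesis by (rule BseqI')
qed

text \<open>With \<open>L v = ln (|v| / 2)\<close>, each step has \<open>L z > L x + L y\<close> for the sides \<open>x\<close>, \<open>y\<close> and the
  region \<open>z\<close> behind, which forces all moduli to tend to 2. In the limit \<open>z\<close> and the region ahead
  agree, and the Markoff equation leaves only \<open>\<mu> = 4\<close>.\<close>

lemma no_descending_ray:
  fixes s :: "nat \<Rightarrow> edge"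
  assumes step: "\<And>n. s (Suc n) = edge_step (b n) (s n)"
    and mk: "\<And>n. markoff \<mu> (s n)"
    and desc: "\<And>n. norm (ahead (s n)) < norm (bk (s n))"
    and big: "\<And>n. 2 < norm (lf (s n))" "\<And>n. 2 < norm (rt (s n))"
  shows "\<mu> = 4"
proof -
  define L :: "complex \<Rightarrow> real" where "L v = ln (norm v / 2)" for v
  \<comment> \<open>\<open>k\<close> is the side kept by the next step and \<open>d\<close> the side
    dropped, which becomes the next region behind. This removes the left-right distinction from what
    follows.\<close>
  define k where "k n = (if b n then rt (s n) else lf (s n))" for n
  define d where "d n = (if b n then lf (s n) else rt (s n))" for n
  define w where "w n = ahead (s n)" for n
  define z where "z n = bk (s n)" for n
  have z_Suc: "z (Suc n) = d n" for n by (simp add: z_def d_def step edge_step_def)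
  have kd_Suc: "(k (Suc n) = k n \<and> d (Suc n) = w n) \<or> (k (Suc n) = w n \<and> d (Suc n) = k n)" for n
    unfolding k_def d_def w_def step edge_step_def by auto
  have zw: "z n + w n = k n * d n" for n
    by (simp add: z_def w_def k_def d_def ahead_def)
  have eq: "(k n)\<^sup>2 + (d n)\<^sup>2 - z n * w n = \<mu>" for n
    using mk[of n] by (auto simp: z_def w_def k_def d_def ahead_def markoff_def algebra_simps power2_eq_square)
  have wz: "norm (w n) < norm (z n)" for n using desc by (simp add: w_def z_def)
  have kbig: "2 < norm (k n)" and dbig: "2 < norm (d n)" for n using big by (auto simp: k_def d_def)
  have wbig: "2 < norm (w n)" for n using kd_Suc[of n] kbig[of "Suc n"] dbig[of "Suc n"] by auto
  have zbig: "2 < norm (z n)" for n using wbig[of n] wz[of n] by linarith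
  have Lpos: "2 < norm v \<Longrightarrow> 0 < L v" for v
    unfolding L_def by (rule ln_gt_zero) simp
  have Lmono: "2 < norm u \<Longrightarrow> norm u < norm v \<Longrightarrow> L u < L v" for u v
    unfolding L_def by (subst ln_less_cancel_iff) auto
  have Lsum: "L (k n) + L (d n) < L (z n)" for n
  proof -
    have "norm (k n) * norm (d n) < 2 * norm (z n)"
      using norm_triangle_ineq[of "z n" "w n"] wz[of n] unfolding zw by (simp add: norm_mult)
    then have "(norm (k n) / 2) * (norm (d n) / 2) < norm (z n) / 2" by (simp add: mult.commute)
    then have "ln ((norm (k n) / 2) * (norm (d n) / 2)) < L (z n)"
      unfolding L_def using kbig[of n] dbig[of n] zbig[of n]
      by (subst ln_less_cancel_iff) (auto intro!: mult_pos_pos)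
    then show ?thesis using kbig[of n] dbig[of n] unfolding L_def by (subst (asm) ln_mult_pos) auto
  qed
  define m where "m n = L (z n)" for n
  have m_Suc: "m (Suc n) < m n - L (k n)" for n using Lsum[of n] by (simp add: m_def z_Suc)
  have "m (Suc n) \<le> m n" for n using m_Suc[of n] Lpos[OF kbig[of n]] by linarith
  then have "decseq m" by (rule decseq_SucI)
  have m_nonneg: "0 \<le> m n" for n using Lpos[OF zbig[of n]] by (simp add: m_def)
  obtain m0 where m0: "m \<longlonglongrightarrow> m0" "\<And>n. m0 \<le> m n"
    using decseq_convergent[OF \<open>decseq m\<close>, of 0] m_nonneg by auto
  have m0_nonneg: "m0 \<ge> 0" by (rule LIMSEQ_le_const[OF m0(1)]) (simp add: m_nonneg)
  have "(\<lambda>n. m n - m (Suc n)) \<longlonglongrightarrow> m0 - m0"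
    by (intro tendsto_diff m0(1) LIMSEQ_Suc[OF m0(1)])
  then have diff: "(\<lambda>n. m n - m (Suc n)) \<longlonglongrightarrow> 0" by simp
  have Lk: "(\<lambda>n. L (k n)) \<longlonglongrightarrow> 0"
  proof (rule tendsto_sandwich[OF _ _ tendsto_const diff])
    show "\<forall>\<^sub>F n in sequentially. 0 \<le> L (k n)" using Lpos[OF kbig] by (simp add: less_imp_le)
    have "L (k n) \<le> m n - m (Suc n)" for n using m_Suc[of n] by linarith
    then show "\<forall>\<^sub>F n in sequentially. L (k n) \<le> m n - m (Suc n)" by simp
  qed
  have "m0 = 0"
  proof (rule ccontr)
    assume "m0 \<noteq> 0"
    then have "m0 > 0" using m0_nonneg by simp
    from order_tendstoD(2)[OF Lk this] obtain N where N: "\<And>n. n \<ge> N \<Longrightarrow> L (k n) < m0"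
      unfolding eventually_sequentially by blast
    \<comment> \<open>If the kept side changed, the old \<open>k n\<close> would be dropped next, so
      \<open>m (n + 2) = L (k n)\<close> would lie below the limit \<open>m0\<close>. Hence from
      \<open>N\<close> on a single region is kept, and its positive constant \<open>L\<close> cannot
      tend to 0.\<close>
    have same: "k (Suc n) = k n" if "n \<ge> N" for n
    proof (rule ccontr)
      assume "k (Suc n) \<noteq> k n"
      then have "m (Suc (Suc n)) = L (k n)" using kd_Suc[of n] by (auto simp: m_def z_Suc)
      then show False using m0(2)[of "Suc (Suc n)"] N[OF that] by simp
    qed
    have const: "k (N + n) = k N" for n by (induction n) (auto simp: same)
    have "(\<lambda>n. L (k (n + N))) \<longlonglongrightarrow> 0" using Lk by (rule LIMSEQ_ignore_initial_segment)
    then have "(\<lambda>n. L (k N)) \<longlonglongrightarrow> 0" using const by (simp add: add.commute)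
    then show False using Lpos[OF kbig[of N]] by (simp add: LIMSEQ_const_iff)
  qed
  have squeeze: "(\<lambda>n. norm (f n)) \<longlonglongrightarrow> 2" if "\<And>n. 2 < norm (f n)" "\<And>n. L (f n) \<le> m n" for f
  proof -
    have "(\<lambda>n. L (f n)) \<longlonglongrightarrow> 0"
      by (rule tendsto_sandwich[where f="\<lambda>_. 0" and h=m])
        (use that(2) less_imp_le[OF Lpos[OF that(1)]] m0(1) \<open>m0 = 0\<close> in simp_all)
    then have "(\<lambda>n. 2 * exp (L (f n))) \<longlonglongrightarrow> 2 * exp 0" by (intro tendsto_intros)
    moreover have "2 * exp (L (f n)) = norm (f n)" for n
    proof -
      have "0 < norm (f n) / 2" using that(1)[of n] by linarith
      then show ?thesis unfolding L_def by (subst exp_ln) auto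
    qed
    ultimately show ?thesis by simp
  qed
  have nk: "(\<lambda>n. norm (k n)) \<longlonglongrightarrow> 2" and nd: "(\<lambda>n. norm (d n)) \<longlonglongrightarrow> 2"
    and nz: "(\<lambda>n. norm (z n)) \<longlonglongrightarrow> 2" and nw: "(\<lambda>n. norm (w n)) \<longlonglongrightarrow> 2"
  proof -
    have "L (k n) \<le> m n" "L (d n) \<le> m n" "L (w n) \<le> m n" for n
      using Lsum[of n] Lpos[OF kbig[of n]] Lpos[OF dbig[of n]] Lmono[OF wbig[of n] wz[of n]]
      unfolding m_def by linarith+
    then show "(\<lambda>n. norm (k n)) \<longlonglongrightarrow> 2" "(\<lambda>n. norm (d n)) \<longlonglongrightarrow> 2"
      "(\<lambda>n. norm (z n)) \<longlonglongrightarrow> 2" "(\<lambda>n. norm (w n)) \<longlonglongrightarrow> 2"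
      using kbig dbig zbig wbig by (auto intro!: squeeze simp: m_def)
  qed
  have diff0: "(\<lambda>n. z n - w n) \<longlonglongrightarrow> 0"
  proof -
    \<comment> \<open>Parallelogram law, with \<open>z n + w n = k n * d n\<close>. All moduli tend
      to 2, so the right side tends to 8 + 8 - 16 = 0.\<close>
    have "(norm (z n - w n))\<^sup>2 = 2 * (norm (z n))\<^sup>2 + 2 * (norm (w n))\<^sup>2 - (norm (k n) * norm (d n))\<^sup>2" for n
      unfolding norm_mult[symmetric] zw[symmetric] cmod_power2
      by (simp add: power2_eq_square algebra_simps)
    moreover have "(\<lambda>n. 2 * (norm (z n))\<^sup>2 + 2 * (norm (w n))\<^sup>2 - (norm (k n) * norm (d n))\<^sup>2) \<longlonglongrightarrow>
        2 * 2\<^sup>2 + 2 * 2\<^sup>2 - (2 * 2)\<^sup>2"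
      by (intro tendsto_intros nk nd nz nw)
    ultimately have "(\<lambda>n. sqrt ((norm (z n - w n))\<^sup>2)) \<longlonglongrightarrow> sqrt 0" by (intro tendsto_intros) simp
    then show ?thesis by (simp add: tendsto_norm_zero_iff)
  qed
  have zero: "(\<lambda>n. f n * g n) \<longlonglongrightarrow> 0"
    if f: "f \<longlonglongrightarrow> 0" and g: "Bseq g" for f g :: "nat \<Rightarrow> complex"
  proof -
    from g obtain K where K: "\<And>n. norm (g n) \<le> K" by (auto simp: Bseq_def)
    show ?thesis
      by (rule tendsto_0_le[OF f, where K=K]) (simp add: norm_mult mult_left_mono K)
  qed
  have Bnorm: "Bseq f" if "(\<lambda>n. norm (f n)) \<longlonglongrightarrow> 2" for f :: "nat \<Rightarrow> complex"
    using convergent_imp_Bseq[OF convergentI[OF that]] by (simp add: Bseq_def)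
  note B = Bnorm[OF nk] Bnorm[OF nd] Bnorm[OF nz] Bnorm[OF nw]
  \<comment> \<open>The Markoff equation reads \<open>(k\<^sup>2 - 4) * (d\<^sup>2 - 4) = (z -
    w)\<^sup>2 + \<delta>\<close>, so \<delta> is what survives in the limit; the remaining steps
    show that it vanishes.\<close>
  define \<delta> where "\<delta> = 16 - 4 * \<mu>"
  have lim: "(\<lambda>n. ((k n)\<^sup>2 - 4) * ((d n)\<^sup>2 - 4)) \<longlonglongrightarrow> \<delta>"
  proof -
    have "((k n)\<^sup>2 - 4) * ((d n)\<^sup>2 - 4) = (z n - w n)\<^sup>2 + \<delta>" for n
    proof -
      have "(z n - w n)\<^sup>2 = (k n * d n)\<^sup>2 - 4 * (z n * w n)"
        unfolding zw[of n, symmetric] by (simp add: power2_eq_square algebra_simps)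
      also have "z n * w n = (k n)\<^sup>2 + (d n)\<^sup>2 - \<mu>" using eq[of n] by (simp add: algebra_simps)
      finally show ?thesis unfolding \<delta>_def by (simp add: power_mult_distrib algebra_simps)
    qed
    moreover have "(\<lambda>n. (z n - w n)\<^sup>2 + \<delta>) \<longlonglongrightarrow> 0\<^sup>2 + \<delta>"
      by (intro tendsto_intros diff0)
    ultimately show ?thesis by simp
  qed
  have limw: "(\<lambda>n. ((k n)\<^sup>2 - 4) * ((w n)\<^sup>2 - 4)) \<longlonglongrightarrow> \<delta>"
  proof -
    have "((k n)\<^sup>2 - 4) * ((w n)\<^sup>2 - 4) = ((k (Suc n))\<^sup>2 - 4) * ((d (Suc n))\<^sup>2 - 4)" for n
      using kd_Suc[of n] by auto
    then show ?thesis using LIMSEQ_Suc[OF lim] by simp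
  qed
  define P where "P n = (k n)\<^sup>2 - 4" for n
  have BP: "Bseq P" unfolding P_def diff_conv_add_uminus power2_eq_square
    by (intro Bseq_add Bseq_mult B)
  \<comment> \<open>Since \<open>(z - w) * (z + 3 * w) = (z + w)\<^sup>2 - 4 * w\<^sup>2\<close>,
    and trading \<open>w\<^sup>2\<close> for \<open>d\<^sup>2\<close> costs a difference of two
    sequences with the same limit \<delta>, this expression is
    \<open>P * ((z + w)\<^sup>2 - 4 * d\<^sup>2)\<close>. By \<open>z + w = k * d\<close> it
    collapses to \<open>P\<^sup>2 * d\<^sup>2\<close>. The factor \<open>z + 3 * w\<close> is
    spelled as a sum to suit \<open>Bseq_add_fun\<close>.\<close>
  have "(\<lambda>n. (z n - w n) * (P n * (z n + (w n + (w n + w n)))) -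
      4 * (P n * ((d n)\<^sup>2 - 4) - P n * ((w n)\<^sup>2 - 4))) \<longlonglongrightarrow> 0 - 4 * (\<delta> - \<delta>)"
    unfolding P_def
    by (intro tendsto_diff tendsto_mult tendsto_const zero[OF diff0] lim limw
        Bseq_mult B BP[unfolded P_def] Bseq_add_fun)
  moreover have "(z n - w n) * (P n * (z n + (w n + (w n + w n)))) -
      4 * (P n * ((d n)\<^sup>2 - 4) - P n * ((w n)\<^sup>2 - 4)) = (P n)\<^sup>2 * (d n)\<^sup>2" for n
  proof -
    have "(z n - w n) * (P n * (z n + (w n + (w n + w n)))) -
        4 * (P n * ((d n)\<^sup>2 - 4) - P n * ((w n)\<^sup>2 - 4)) = P n * ((z n + w n)\<^sup>2 - 4 * (d n)\<^sup>2)"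
      by (simp add: power2_eq_square algebra_simps)
    then show ?thesis unfolding zw by (simp add: P_def power2_eq_square algebra_simps)
  qed
  ultimately have Pd: "(\<lambda>n. (P n)\<^sup>2 * (d n)\<^sup>2) \<longlonglongrightarrow> 0" by simp
  have "(\<lambda>n. (P n)\<^sup>2) \<longlonglongrightarrow> 0"
  proof (rule tendsto_0_le[OF Pd, where K=1], rule always_eventually, rule allI)
    fix n
    have "1 \<le> (norm (d n))\<^sup>2" using dbig[of n] by (intro one_le_power) simp
    then have "norm ((P n)\<^sup>2) * 1 \<le> norm ((P n)\<^sup>2) * (norm (d n))\<^sup>2" by (intro mult_left_mono) auto
    then show "norm ((P n)\<^sup>2) \<le> norm ((P n)\<^sup>2 * (d n)\<^sup>2) * 1" by (simp add: norm_mult norm_power)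
  qed
  moreover have "Bseq (\<lambda>n. ((d n)\<^sup>2 - 4)\<^sup>2)" unfolding diff_conv_add_uminus power2_eq_square
    by (intro Bseq_add Bseq_mult B)
  ultimately have sq0: "(\<lambda>n. (P n)\<^sup>2 * ((d n)\<^sup>2 - 4)\<^sup>2) \<longlonglongrightarrow> 0" by (rule zero)
  have "(\<lambda>n. (P n * ((d n)\<^sup>2 - 4))\<^sup>2) \<longlonglongrightarrow> \<delta>\<^sup>2"
    unfolding P_def by (intro tendsto_intros lim)
  then have "\<delta>\<^sup>2 = 0" unfolding power_mult_distrib by (rule LIMSEQ_unique[OF _ sq0])
  then show ?thesis by (simp add: \<delta>_def)
qed

section \<open>Eventual monotonicity\<close>

definition increasing :: "edge \<Rightarrow> bool" where
  "increasing s \<longleftrightarrow> norm (bk s) \<le> norm (ahead s)"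

text \<open>Reflection of the tree. Growth is proved beside left regions only and carried over to
  right regions by this map.\<close>

definition mirror :: "edge \<Rightarrow> edge" where
  "mirror s = (rt s, lf s, bk s)"

lemma mirror_step: "edge_step (\<not> b) (mirror s) = mirror (edge_step b s)"
  by (simp add: mirror_def edge_step_def ahead_def mult.commute)

lemma mirror_descend: "descend (map Not p) (mirror s) = mirror (descend p s)"
  by (induction p arbitrary: s) (simp_all add: mirror_step)

lemma ahead_mirror [simp]: "ahead (mirror s) = ahead s"
  by (simp add: mirror_def ahead_def mult.commute)

lemma increasing_mirror [simp]: "increasing (mirror s) = increasing s"
  by (simp add: increasing_def) (simp add: mirror_def)

lemma mirror_sel [simp]: "lf (mirror s) = rt s" "rt (mirror s) = lf s" "bk (mirror s) = bk s"
  by (simp_all add: mirror_def)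

lemma increasing_imp_norm_ahead:
  assumes "increasing s"
  shows "norm (lf s) * norm (rt s) \<le> 2 * norm (ahead s)"
proof -
  have "norm (lf s * rt s) \<le> norm (ahead s) + norm (bk s)"
    using norm_triangle_ineq[of "ahead s" "bk s"] by (simp add: ahead_def)
  then show ?thesis using assms by (simp add: increasing_def norm_mult)
qed

lemma edge_step_sel [simp]:
  "lf (edge_step True s) = ahead s" "rt (edge_step True s) = rt s" "bk (edge_step True s) = lf s"
  "lf (edge_step False s) = lf s" "rt (edge_step False s) = ahead s" "bk (edge_step False s) = rt s"
  by (simp_all add: edge_step_def)

text \<open>One of the two half-trees at the root edge. Finiteness is asked of paths rather than of
  trace values, since different regions may share a trace.\<close>

locale bq_tree =
  fixes \<mu> :: complex and s0 :: edge
  assumes markoff0: "markoff \<mu> s0"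
    and mu: "\<mu> \<noteq> 4"
    and ahead_nonreal: "\<And>p. ahead (descend p s0) \<notin> complex_of_real ` {-2..2}"
    and sides_nonreal: "lf s0 \<notin> complex_of_real ` {-2..2}" "rt s0 \<notin> complex_of_real ` {-2..2}"
    and finite_small: "finite {p. norm (ahead (descend p s0)) \<le> 2}"
begin

lemma bq_tree_mirror: "bq_tree \<mu> (mirror s0)"
proof
  have d: "descend p (mirror s0) = mirror (descend (map Not p) s0)" for p
    using mirror_descend[of "map Not p" s0] by (simp add: comp_def)
  show "markoff \<mu> (mirror s0)" using markoff0 by (simp add: markoff_def mult.commute add.commute)
  show "\<mu> \<noteq> 4" by (rule mu)
  show "ahead (descend p (mirror s0)) \<notin> complex_of_real ` {-2..2}" for p
    using ahead_nonreal by (simp add: d)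
  show "lf (mirror s0) \<notin> complex_of_real ` {-2..2}" "rt (mirror s0) \<notin> complex_of_real ` {-2..2}"
    using sides_nonreal by simp_all
  have "{p. norm (ahead (descend p (mirror s0))) \<le> 2} = map Not ` {p. norm (ahead (descend p s0)) \<le> 2}"
  proof (intro equalityI subsetI)
    fix p assume "p \<in> {p. norm (ahead (descend p (mirror s0))) \<le> 2}"
    then have "map Not p \<in> {p. norm (ahead (descend p s0)) \<le> 2}" by (simp add: d)
    moreover have "p = map Not (map Not p)" by (simp add: comp_def)
    ultimately show "p \<in> map Not ` {p. norm (ahead (descend p s0)) \<le> 2}" by (metis imageI)
  qed (auto simp: d comp_def)
  then show "finite {p. norm (ahead (descend p (mirror s0))) \<le> 2}" using finite_small by simp
qed

abbreviation D :: "bool list \<Rightarrow> edge" where "D p \<equiv> descend p s0"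

lemma D_snoc: "D (p @ [b]) = edge_step b (D p)" by simp

lemma D_sides:
  "lf (D p) \<in> {lf s0, rt s0} \<union> range (\<lambda>p. ahead (D p))"
  "rt (D p) \<in> {lf s0, rt s0} \<union> range (\<lambda>p. ahead (D p))"
  by (induction p rule: rev_induct) (auto simp: edge_step_def)

lemma D_sides_nonreal:
  "lf (D p) \<notin> complex_of_real ` {-2..2}" "rt (D p) \<notin> complex_of_real ` {-2..2}"
proof -
  have "v \<notin> complex_of_real ` {-2..2}" if "v \<in> {lf s0, rt s0} \<union> range (\<lambda>p. ahead (D p))" for v
    using that
  proof (elim UnE rangeE insertE emptyE)
  qed (use sides_nonreal ahead_nonreal in \<open>simp_all only: not_False_eq_True\<close>)
  then show "lf (D p) \<notin> complex_of_real ` {-2..2}" "rt (D p) \<notin> complex_of_real ` {-2..2}"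
    using D_sides[of p] by blast+
qed

definition depth :: nat where
  "depth = (SOME N. \<forall>p. N \<le> length p \<longrightarrow> 2 < norm (ahead (D p)))"

lemma depth: "depth \<le> length p \<Longrightarrow> 2 < norm (ahead (D p))"
proof -
  have "\<exists>N. \<forall>p. N \<le> length p \<longrightarrow> 2 < norm (ahead (D p))"
  proof (intro exI allI impI)
    fix p :: "bool list"
    assume len: "Suc (Max (insert 0 (length ` {p. norm (ahead (D p)) \<le> 2}))) \<le> length p"
    show "2 < norm (ahead (D p))"
    proof (rule ccontr)
      assume "\<not> 2 < norm (ahead (D p))"
      then have "length p \<le> Max (insert 0 (length ` {p. norm (ahead (D p)) \<le> 2}))"
        using finite_small by (intro Max_ge) auto
      then show False using len by simp
    qed
  qed
  from someI_ex[OF this] show "depth \<le> length p \<Longrightarrow> 2 < norm (ahead (D p))"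
    unfolding depth_def by blast
qed

lemma left_chain_side: "lf (D (p @ replicate n False)) = lf (D p)"
proof (induction n arbitrary: p)
  case (Suc n)
  show ?case using Suc[of "p @ [False]"] by (simp add: edge_step_def)
qed simp

lemma left_chain_step:
  "D (p @ replicate (Suc n) False) =
     (lf (D p), ahead (D (p @ replicate n False)), rt (D (p @ replicate n False)))"
proof -
  have "p @ replicate (Suc n) False = (p @ replicate n False) @ [False]"
    by (simp add: replicate_append_same)
  then have "D (p @ replicate (Suc n) False) = edge_step False (D (p @ replicate n False))"
    by (simp only: D_snoc)
  then show ?thesis by (simp only: edge_step_def left_chain_side if_False)
qed

text \<open>The neighbours, in cyclic order, of the region to the left of \<open>D p\<close>.
  Behind, right and ahead of an edge along this path stand three consecutive terms.\<close>

definition left_chain :: "bool list \<Rightarrow> nat \<Rightarrow> complex" where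
  "left_chain p n = bk (D (p @ replicate n False))"

lemma left_chain_sel:
  "bk (D (p @ replicate n False)) = left_chain p n"
  "rt (D (p @ replicate n False)) = left_chain p (Suc n)"
  "ahead (D (p @ replicate n False)) = left_chain p (Suc (Suc n))"
  unfolding left_chain_def by (simp_all only: left_chain_step fst_conv snd_conv)

lemma left_chain_rec:
  "left_chain p (Suc (Suc n)) =
    (multiplier (lf (D p)) + inverse (multiplier (lf (D p)))) * left_chain p (Suc n) - left_chain p n"
  using left_chain_sel[of p n] left_chain_side[of p n]
  unfolding multiplier_sum by (simp only: ahead_def)

text \<open>The index is shifted by two because term \<open>n + 2\<close> is the region ahead after
  \<open>n\<close> further steps.\<close>

lemma left_chain_big: "depth \<le> length p + n \<Longrightarrow> 2 < norm (left_chain p (Suc (Suc n)))"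
  by (metis left_chain_sel(3) depth length_append length_replicate)

lemma left_chain_eventually_big: "eventually (\<lambda>n. 2 < norm (left_chain p n)) sequentially"
  unfolding eventually_sequentially
proof (intro exI allI impI)
  fix n assume "Suc (Suc depth) \<le> n"
  then obtain m where "n = Suc (Suc m)" "depth \<le> m" by (metis Suc_le_D Suc_le_mono)
  then show "2 < norm (left_chain p n)" using left_chain_big[of p m] by simp
qed

text \<open>Equality would say that the neighbours of the left region have no growing mode. Combined
  with \<open>multiplier_root\<close> this later excludes \<open>v\<^sup>2 = \<mu>\<close>.\<close>

lemma rt_neq_bk: "rt (D p) \<noteq> inverse (multiplier (lf (D p))) * bk (D p)"
  using recurrence_leading_coeff[of "left_chain p", OF left_chain_rec
      norm_multiplier_gt_1[OF D_sides_nonreal(1)] left_chain_eventually_big] left_chain_sel[of p 0]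
  by simp

lemma left_chain_eventually_inc: "eventually (\<lambda>n. increasing (D (p @ replicate n False))) sequentially"
  using recurrence_eventually_increasing[of "left_chain p", OF left_chain_rec
      norm_multiplier_gt_1[OF D_sides_nonreal(1)] left_chain_eventually_big]
  unfolding increasing_def left_chain_sel .

text \<open>Past \<open>depth\<close> every new region is large, so a small left side is an old one
  that no step has replaced.\<close>

lemma small_left_run:
  assumes "norm (lf (D (p @ q))) \<le> 2" "depth \<le> length p"
  shows "q = replicate (length q) False"
  using assms(1)
proof (induction q rule: rev_induct)
  case (snoc b q)
  have "b = False"
  proof (rule ccontr)
    assume "b \<noteq> False"
    then have "lf (D (p @ q @ [b])) = ahead (D (p @ q))" by simp
    then show False using snoc.prems depth[of "p @ q"] assms(2) by (simp only:) simp
  qed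
  moreover from this have "q = replicate (length q) False" using snoc by simp
  ultimately show ?case by (metis length_append_singleton replicate_Suc replicate_append_same)
qed simp

text \<open>Each chain has its own threshold. Uniformity comes from \<open>small_left_run\<close>,
  which leaves only the finitely many chains that start at level \<open>depth\<close>.\<close>

lemma small_left_inc:
  "\<exists>M. \<forall>p. M \<le> length p \<longrightarrow> norm (lf (D p)) \<le> 2 \<longrightarrow> increasing (D p)"
proof -
  have "\<exists>K. \<forall>n\<ge>K. increasing (D (p @ replicate n False))" for p
    using left_chain_eventually_inc[of p] by (simp only: eventually_sequentially)
  then obtain K where K: "\<And>p n. K p \<le> n \<Longrightarrow> increasing (D (p @ replicate n False))" by metis
  define M where "M = Max (K ` {p. length p = depth})"
  have M: "K p \<le> M" if "length p = depth" for p
    unfolding M_def using that finite_bool_lists by (intro Max_ge) auto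
  show ?thesis
  proof (intro exI allI impI)
    fix p assume len: "depth + M \<le> length p" and small: "norm (lf (D p)) \<le> 2"
    define p0 q where "p0 = take depth p" and "q = drop depth p"
    have p: "p = p0 @ q" and p0: "length p0 = depth" and q: "M \<le> length q"
      using len by (simp_all add: p0_def q_def)
    have "q = replicate (length q) False"
      using small p p0 by (intro small_left_run[of p0]) auto
    then show "increasing (D p)" using K[of p0 "length q"] M[OF p0] q p by simp
  qed
qed

lemma small_side_inc:
  "\<exists>M. \<forall>p. M \<le> length p \<longrightarrow> norm (lf (D p)) \<le> 2 \<or> norm (rt (D p)) \<le> 2 \<longrightarrow> increasing (D p)"
proof -
  interpret m: bq_tree \<mu> "mirror s0" by (rule bq_tree_mirror)
  obtain M1 where M1: "\<And>p. M1 \<le> length p \<Longrightarrow> norm (lf (D p)) \<le> 2 \<Longrightarrow> increasing (D p)"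
    using small_left_inc by blast
  obtain M2 where M2: "\<And>p. M2 \<le> length p \<Longrightarrow> norm (lf (m.D p)) \<le> 2 \<Longrightarrow> increasing (m.D p)"
    using m.small_left_inc by blast
  have "increasing (D p)" if "M2 \<le> length p" "norm (rt (D p)) \<le> 2" for p
    using M2[of "map Not p"] that by (simp add: mirror_descend)
  with M1 show ?thesis by (intro exI[of _ "max M1 M2"]) auto
qed

text \<open>Let x be the side kept, y the other one and w the region ahead. Growth at the first edge
  gives |x| |y| <= 2 |w|, and decrease at the second gives |x| |w| <= 2 |y|; together |x|^2 <=
  4.\<close>

lemma inc_child:
  assumes "increasing (D p)" "depth \<le> length p" "\<not> increasing (D (p @ [b]))"
  shows "norm (lf (D (p @ [b]))) \<le> 2 \<or> norm (rt (D (p @ [b]))) \<le> 2"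
proof -
  have key: "norm x \<le> 2" if w: "2 < norm w" and "norm (x * w - y) < norm y" "norm x * norm y \<le> 2 * norm w"
    for x y w :: complex
  proof -
    have "norm x * norm w \<le> 2 * norm y"
      using norm_triangle_ineq[of "x * w - y" y] that(2) by (simp add: norm_mult)
    then have "norm x * (norm x * norm w) \<le> norm x * (2 * norm y)" by (rule mult_left_mono) simp
    also have "\<dots> \<le> 4 * norm w" using that(3) by simp
    finally have "(norm x)\<^sup>2 * norm w \<le> 4 * norm w" by (simp add: power2_eq_square mult.assoc)
    then have "(norm x)\<^sup>2 * norm w \<le> 2\<^sup>2 * norm w" by simp
    then have "(norm x)\<^sup>2 \<le> 2\<^sup>2" by (rule mult_right_le_imp_le) (use w in linarith)
    then show ?thesis by (rule power2_le_imp_le) simp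
  qed
  define x y w where "x = lf (D p)" and "y = rt (D p)" and "w = ahead (D p)"
  have w: "2 < norm w" using depth[OF assms(2)] by (simp add: w_def)
  have xy: "norm x * norm y \<le> 2 * norm w"
    using increasing_imp_norm_ahead[OF assms(1)] by (simp add: x_def y_def w_def)
  show ?thesis
  proof (cases b)
    case True
    have "norm (y * w - x) < norm x"
      using assms(3) True by (simp add: increasing_def edge_step_def x_def y_def w_def ahead_def[of "(a, b, c)" for a b c] mult.commute)
    then have "norm y \<le> 2" using key[of w y x] w xy by (simp add: mult.commute)
    then show ?thesis using True by (simp add: edge_step_def y_def)
  next
    case False
    have "norm (x * w - y) < norm y"
      using assms(3) False by (simp add: increasing_def edge_step_def x_def y_def w_def ahead_def[of "(a, b, c)" for a b c])
    then have "norm x \<le> 2" using key[of w x y] w xy by simp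
    then show ?thesis using False by (simp add: edge_step_def x_def)
  qed
qed

text \<open>Koenig's lemma. Past level \<open>M\<close> a failure passes up to the parent, so
  infinitely many failures produce a ray made of failures only; its sides exceed 2 by
  \<open>small_side_inc\<close>, and \<open>no_descending_ray\<close> contradicts \<mu> \<noteq>
  4.\<close>

lemma eventually_inc: "\<exists>M. \<forall>p. M \<le> length p \<longrightarrow> increasing (D p)"
proof -
  obtain M0 where M0: "\<And>p. M0 \<le> length p \<Longrightarrow> norm (lf (D p)) \<le> 2 \<or> norm (rt (D p)) \<le> 2 \<Longrightarrow> increasing (D p)"
    using small_side_inc by blast
  define M where "M = max M0 depth"
  have parent: "\<not> increasing (D p)" if "\<not> increasing (D (p @ [b]))" "M \<le> length p" for p b
    using inc_child[of p b] M0[of "p @ [b]"] that unfolding M_def by auto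
  have ancestor: "\<not> increasing (D p)" if "\<not> increasing (D (p @ q))" "M \<le> length p" for p q
    using that
  proof (induction q rule: rev_induct)
    case (snoc b q)
    then show ?case using parent[of "p @ q" b] by simp
  qed simp
  define bad where "bad p = infinite {q. \<not> increasing (D (p @ q))}" for p
  have bad_step: "\<exists>b. bad (p @ [b])" if "bad p" for p
  proof (rule ccontr)
    assume "\<not> ?thesis"
    then have fin: "finite {q. \<not> increasing (D (p @ b # q))}" for b by (simp add: bad_def)
    have "{q. \<not> increasing (D (p @ q))} \<subseteq>
      insert [] (\<Union>b. Cons b ` {q. \<not> increasing (D (p @ b # q))})"
    proof
      fix q assume "q \<in> {q. \<not> increasing (D (p @ q))}"
      then show "q \<in> insert [] (\<Union>b. Cons b ` {q. \<not> increasing (D (p @ b # q))})" by (cases q) auto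
    qed
    then have "finite {q. \<not> increasing (D (p @ q))}"
      by (rule finite_subset) (use fin in simp)
    then show False using that by (simp add: bad_def)
  qed
  have "\<not> bad []"
  proof
    assume "bad []"
    then have "\<exists>f. \<forall>n. (bad (f n) \<and> length (f n) = n) \<and> (\<exists>b. f (Suc n) = f n @ [b])"
      by (intro dependent_nat_choice) (use bad_step in \<open>force+\<close>)
    then obtain f where f: "\<And>n. bad (f n)" "\<And>n. length (f n) = n" "\<And>n. \<exists>b. f (Suc n) = f n @ [b]"
      by blast
    then obtain b where b: "\<And>n. f (Suc n) = f n @ [b n]" by metis
    have ninc: "\<not> increasing (D (f (M + n)))" for n
    proof -
      have "{q. \<not> increasing (D (f (M + n) @ q))} \<noteq> {}"
        using f(1)[of "M + n"] unfolding bad_def by (metis finite.emptyI)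
      then show ?thesis using ancestor[of "f (M + n)"] f(2) by auto
    qed
    have "\<mu> = 4"
    proof (rule no_descending_ray[of "\<lambda>n. D (f (M + n))" "\<lambda>n. b (M + n)"])
      fix n
      show "D (f (M + Suc n)) = edge_step (b (M + n)) (D (f (M + n)))" using b[of "M + n"] by simp
      show "markoff \<mu> (D (f (M + n)))" by (rule markoff_descend[OF markoff0])
      show "norm (ahead (D (f (M + n)))) < norm (bk (D (f (M + n))))"
        using ninc[of n] by (simp add: increasing_def)
      have "M0 \<le> length (f (M + n))" by (simp add: f(2) M_def)
      with M0[of "f (M + n)"] ninc[of n]
      show "2 < norm (lf (D (f (M + n))))" "2 < norm (rt (D (f (M + n))))" by force+
    qed
    then show False using mu by contradiction
  qed
  then have "finite {p. \<not> increasing (D p)}" by (simp add: bad_def)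
  then have "length p \<le> Max (insert 0 (length ` {p. \<not> increasing (D p)}))" if "\<not> increasing (D p)" for p
    using that by (intro Max_ge) auto
  then show ?thesis by (metis not_less_eq_eq)
qed

end

section \<open>Summability\<close>

lemma summable_on_comparison_real:
  fixes f g :: "'a \<Rightarrow> real"
  assumes "g summable_on A" "\<And>x. x \<in> A \<Longrightarrow> f x \<le> g x" "\<And>x. x \<in> A \<Longrightarrow> 0 \<le> f x"
  shows "f summable_on A"
proof (rule nonneg_bdd_above_summable_on)
  have "sum f F \<le> infsum g A" if "F \<subseteq> A" "finite F" for F
  proof -
    have "sum f F \<le> sum g F" using that assms by (intro sum_mono) auto
    also have "\<dots> \<le> infsum g A"
      using that assms order_trans by (intro finite_sum_le_infsum) blast+
    finally show ?thesis .
  qed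
  then show "bdd_above (sum f ` {F. F \<subseteq> A \<and> finite F})" by (auto intro!: bdd_aboveI)
qed (use assms in auto)

lemma geometric_product_summable_on:
  fixes r t :: real
  assumes "0 \<le> r" "r < 1" "0 \<le> t" "t < 1"
  shows "(\<lambda>(m, n). r ^ m * t ^ n) summable_on (UNIV :: (nat \<times> nat) set)"
proof -
  have geo: "(\<lambda>n. x ^ n) summable_on (UNIV :: nat set)" if "0 \<le> x" "x < 1" for x :: real
    using that by (intro summable_nonneg_imp_summable_on summable_geometric) auto
  have eq: "infsum (\<lambda>n. norm (r ^ m * t ^ n)) UNIV = r ^ m * infsum (\<lambda>n. t ^ n) UNIV" for m
    using assms by (subst infsum_cmult_right'[symmetric]) (simp add: abs_mult power_abs)
  note abs = summable_on_iff_abs_summable_on_real[THEN iffD1]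
  have "(\<lambda>x. norm ((\<lambda>(m, n). r ^ m * t ^ n) x)) summable_on (Sigma (UNIV :: nat set) (\<lambda>_. UNIV :: nat set))"
    unfolding Infinite_Sum.abs_summable_on_Sigma_iff prod.case eq
    using abs[OF summable_on_cmult_right[OF geo[OF assms(3,4)]]]
      abs[OF summable_on_cmult_left[OF geo[OF assms(1,2)]]] by blast
  then show ?thesis
    using summable_on_iff_abs_summable_on_real[THEN iffD2] by (simp only: UNIV_Times_UNIV)
qed

lemma summable_on_imp_finite_ge:
  fixes f :: "'a \<Rightarrow> real"
  assumes "f summable_on UNIV" "\<And>x. 0 \<le> f x" "0 < \<epsilon>"
  shows "finite {x. \<epsilon> \<le> f x}"
proof -
  obtain C :: nat where C: "infsum f UNIV / \<epsilon> \<le> real C" using real_arch_simple by blast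
  have "card G \<le> C" if "G \<subseteq> {x. \<epsilon> \<le> f x}" "finite G" for G
  proof -
    have "real (card G) * \<epsilon> = (\<Sum>x\<in>G. \<epsilon>)" by simp
    also have "\<dots> \<le> sum f G" using that by (intro sum_mono) auto
    also have "\<dots> \<le> infsum f UNIV" using that assms by (intro finite_sum_le_infsum) auto
    finally have "real (card G) \<le> infsum f UNIV / \<epsilon>" using assms(3) by (simp add: le_divide_eq)
    then show ?thesis using C by linarith
  qed
  then show ?thesis using finite_if_finite_subsets_card_bdd[of "{x. \<epsilon> \<le> f x}" C] by blast
qed

text \<open>Balls about the root are cofinal among the finite sets of paths; this turns an unordered
  sum into the limit of its ball sums.\<close>

lemma filterlim_short_lists:
  "filterlim (\<lambda>n. {p :: bool list. length p < n}) (finite_subsets_at_top UNIV) sequentially"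
  unfolding filterlim_finite_subsets_at_top
proof (intro allI impI)
  fix X :: "bool list set" assume X: "finite X \<and> X \<subseteq> UNIV"
  have "X \<subseteq> {p. length p < n}" if "Suc (Max (insert 0 (length ` X))) \<le> n" for n
  proof
    fix p assume "p \<in> X"
    then have "length p \<le> Max (insert 0 (length ` X))" using X by (intro Max_ge) auto
    then show "p \<in> {p. length p < n}" using that by simp
  qed
  then show "\<forall>\<^sub>F n in sequentially. finite {p :: bool list. length p < n} \<and>
      X \<subseteq> {p. length p < n} \<and> {p. length p < n} \<subseteq> UNIV"
    unfolding eventually_sequentially using finite_bool_lists by blast
qed

lemma level_sums_tendsto_0:
  fixes f :: "bool list \<Rightarrow> real"
  assumes "f summable_on UNIV"
  shows "(\<lambda>n. \<Sum>p | length p = n. f p) \<longlonglongrightarrow> 0"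
proof -
  have "(f has_sum infsum f UNIV) UNIV" using assms by simp
  then have lim: "(\<lambda>n. \<Sum>p | length p < n. f p) \<longlonglongrightarrow> infsum f UNIV"
    unfolding has_sum_def by (rule filterlim_compose[OF _ filterlim_short_lists])
  have "{p :: bool list. length p < Suc n} = {p. length p < n} \<union> {p. length p = n}" for n by auto
  then have "(\<Sum>p | length p < Suc n. f p) = (\<Sum>p | length p < n. f p) + (\<Sum>p | length p = n. f p)" for n
    by (simp only:) (subst sum.union_disjoint, auto simp: finite_bool_lists)
  then have "(\<Sum>p | length p = n. f p) = (\<Sum>p | length p < Suc n. f p) - (\<Sum>p | length p < n. f p)" for n
    by simp
  then show ?thesis using tendsto_diff[OF LIMSEQ_Suc[OF lim] lim] by simp
qed

lemma norm_prod_minus1_le_exp: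
  fixes f :: "'a \<Rightarrow> complex"
  assumes "finite A"
  shows "norm ((\<Prod>x\<in>A. f x) - 1) \<le> exp (\<Sum>x\<in>A. norm (f x - 1)) - 1"
  using assms
proof (induction A rule: finite_induct)
  case (insert x A)
  define P S where "P = (\<Prod>x\<in>A. f x)" and "S = (\<Sum>x\<in>A. norm (f x - 1))"
  have PS: "norm (P - 1) \<le> exp S - 1" using insert.IH by (simp add: P_def S_def)
  have "norm (f x * P - 1) = norm (f x * (P - 1) + (f x - 1))" by (simp add: algebra_simps)
  also have "\<dots> \<le> norm (f x) * norm (P - 1) + norm (f x - 1)"
    by (metis norm_mult norm_triangle_ineq)
  also have "\<dots> \<le> (1 + norm (f x - 1)) * (exp S - 1) + norm (f x - 1)"
  proof -
    have "norm (f x) \<le> 1 + norm (f x - 1)" using norm_triangle_ineq[of 1 "f x - 1"] by simp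
    then show ?thesis using PS by (intro add_right_mono mult_mono) auto
  qed
  also have "\<dots> = (1 + norm (f x - 1)) * exp S - 1" by (simp add: algebra_simps)
  also have "\<dots> \<le> exp (norm (f x - 1)) * exp S - 1"
    using exp_ge_add_one_self by (intro diff_right_mono mult_right_mono) auto
  finally show ?case using insert.hyps by (simp add: P_def S_def exp_add)
qed simp

section \<open>Convergence of the sum of inverse squares over a half-tree\<close>

definition tree_summable :: "edge \<Rightarrow> bool" where
  "tree_summable s \<longleftrightarrow> (\<lambda>p. inverse ((norm (ahead (descend p s)))\<^sup>2)) summable_on UNIV"

lemma tree_summable_children:
  assumes "tree_summable (edge_step False s)" "tree_summable (edge_step True s)"
  shows "tree_summable s"
proof -
  let ?f = "\<lambda>p. inverse ((norm (ahead (descend p s)))\<^sup>2)"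
  have U: "UNIV = {[]} \<union> (range (Cons False) \<union> range (Cons True))"
  proof -
    have "p \<in> {[]} \<union> (range (Cons False) \<union> range (Cons True))" for p :: "bool list"
      by (cases p) (auto simp: image_iff)
    then show ?thesis by blast
  qed
  have "?f summable_on range (Cons b)" for b
    using assms unfolding tree_summable_def
    by (subst summable_on_reindex) (cases b; simp add: comp_def)+
  then have "?f summable_on ({[]} \<union> (range (Cons False) \<union> range (Cons True)))"
    by (intro summable_on_Un_disjoint) auto
  then show ?thesis unfolding tree_summable_def by (subst U)
qed

lemma tree_summable_descend:
  assumes "\<And>p. length p = n \<Longrightarrow> tree_summable (descend p s)"
  shows "tree_summable s"
  using assms
proof (induction n arbitrary: s)
  case 0
  then show ?case using "0"[of "[]"] by simp
next
  case (Suc n)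
  have children: "tree_summable (edge_step b s)" for b
  proof (rule Suc.IH)
    fix p :: "bool list" assume "length p = n"
    then show "tree_summable (descend p (edge_step b s))" using Suc.prems[of "b # p"] by simp
  qed
  show ?case by (rule tree_summable_children[OF children children])
qed

text \<open>As \<open>coef\<close> is injective, the sum is dominated by a double geometric series
  over pairs (m, n).\<close>

lemma tree_summable_weights:
  fixes \<alpha> \<beta> :: real
  assumes "0 < \<alpha>" "0 < \<beta>"
    and le: "\<And>q. 2 * exp (\<alpha> * fst (coef q) + \<beta> * snd (coef q)) \<le> norm (ahead (descend q s))"
  shows "tree_summable s"
proof -
  let ?g = "\<lambda>(m, n). exp (- 2 * \<alpha>) ^ m * exp (- 2 * \<beta>) ^ n"
  have "?g summable_on range coef"
    using assms by (intro summable_on_subset_banach[OF geometric_product_summable_on]) auto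
  then have "(?g \<circ> coef) summable_on UNIV" by (subst (asm) summable_on_reindex[OF inj_coef])
  then show ?thesis unfolding tree_summable_def
  proof (rule summable_on_comparison_real)
    fix q :: "bool list"
    define t where "t = \<alpha> * fst (coef q) + \<beta> * snd (coef q)"
    have "exp t \<le> 2 * exp t" by simp
    also have "\<dots> \<le> norm (ahead (descend q s))" using le[of q] by (simp add: t_def)
    finally have "inverse ((norm (ahead (descend q s)))\<^sup>2) \<le> inverse ((exp t)\<^sup>2)"
      by (intro le_imp_inverse_le power_mono) auto
    also have "\<dots> = exp (- 2 * t)" by (simp add: exp_minus flip: exp_double)
    also have "\<dots> = (?g \<circ> coef) q"
      by (simp add: t_def case_prod_beta exp_of_nat_mult[symmetric] exp_add[symmetric] algebra_simps)
    finally show "inverse ((norm (ahead (descend q s)))\<^sup>2) \<le> (?g \<circ> coef) q" .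
  qed simp
qed

text \<open>On an increasing edge |x| |y| <= 2 |w|. With moduli bounded below by
  \<open>2 * exp\<close> of an exponent, the exponents therefore add, exactly as homology classes do
  in \<open>coef\<close>.\<close>

lemma fibonacci_growth:
  fixes \<alpha> \<beta> :: real
  assumes "\<And>q. increasing (descend q s)" "0 \<le> \<alpha>" "0 \<le> \<beta>"
    "2 * exp \<alpha> \<le> norm (lf s)" "2 * exp \<beta> \<le> norm (rt s)"
  shows "2 * exp (\<alpha> * fst (coef q) + \<beta> * snd (coef q)) \<le> norm (ahead (descend q s))"
  using assms
proof (induction q arbitrary: s \<alpha> \<beta>)
  case Nil
  have "(2 * exp \<alpha>) * (2 * exp \<beta>) \<le> norm (lf s) * norm (rt s)"
    using Nil by (intro mult_mono) auto
  also have "\<dots> \<le> 2 * norm (ahead s)" using Nil(1)[of "[]"] by (intro increasing_imp_norm_ahead) simp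
  finally show ?case by (simp add: exp_add)
next
  case (Cons b q)
  have "(2 * exp \<alpha>) * (2 * exp \<beta>) \<le> norm (lf s) * norm (rt s)"
    using Cons.prems by (intro mult_mono) auto
  also have "\<dots> \<le> 2 * norm (ahead s)" using Cons.prems(1)[of "[]"] by (intro increasing_imp_norm_ahead) simp
  finally have w: "2 * exp (\<alpha> + \<beta>) \<le> norm (ahead s)" by (simp add: exp_add)
  have i: "increasing (descend q (edge_step b s))" for q using Cons.prems(1)[of "b # q"] by simp
  obtain m n where c: "coef q = (m, n)" by (metis surj_pair)
  show ?case
  proof (cases b)
    case True
    have "2 * exp ((\<alpha> + \<beta>) * fst (coef q) + \<beta> * snd (coef q)) \<le> norm (ahead (descend q (edge_step b s)))"
      using Cons.prems w True by (intro Cons.IH[OF i]) auto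
    then show ?thesis using True by (simp add: c algebra_simps)
  next
    case False
    have "2 * exp (\<alpha> * fst (coef q) + (\<alpha> + \<beta>) * snd (coef q)) \<le> norm (ahead (descend q (edge_step b s)))"
      using Cons.prems w False by (intro Cons.IH[OF i]) auto
    then show ?thesis using False by (simp add: c algebra_simps)
  qed
qed

lemma tree_summable_mirror: "tree_summable (mirror s) = tree_summable s"
proof -
  have b: "bij_betw (map Not :: bool list \<Rightarrow> bool list) UNIV UNIV"
    by (rule bij_betw_byWitness[where f' = "map Not"]) (auto simp: comp_def)
  have "inverse ((norm (ahead (descend p s)))\<^sup>2) = inverse ((norm (ahead (descend (map Not p) (mirror s))))\<^sup>2)" for p
    by (simp add: mirror_descend)
  then show ?thesis unfolding tree_summable_def
    using summable_on_reindex_bij_betw[OF b, of "\<lambda>p. inverse ((norm (ahead (descend p (mirror s))))\<^sup>2)"]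
    by simp
qed

text \<open>If \<open>x\<^sup>2 = \<mu>\<close>, the Markoff equation factors as (y - z/l) (z - y/l)
  = 0 with l + 1/l = x.\<close>

lemma multiplier_root:
  assumes "markoff \<mu> (x, y, z)" "x\<^sup>2 = \<mu>"
  shows "y = inverse (multiplier x) * z \<or> z = inverse (multiplier x) * y"
proof -
  define l i where "l = multiplier x" and "i = inverse l"
  have "l * i = 1" "l + i = x" by (simp_all add: l_def i_def multiplier_sum)
  moreover have "x\<^sup>2 + y\<^sup>2 + z\<^sup>2 - x * y * z = \<mu>" using assms(1) by (simp add: markoff_def)
  ultimately have "(y - i * z) * (z - i * y) * l = 0" using assms(2) by algebra
  then show ?thesis by (auto simp: l_def i_def)
qed

context bq_tree begin

text \<open>The left region may have modulus at most 2, so \<open>fibonacci_growth\<close> cannot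
  start from it. It receives as weight the rate \<delta> at which its neighbours grow; once the path
  turns away, both sides are such neighbours and hence large.\<close>

lemma tree_summable_small_left:
  assumes increasing: "\<And>q. increasing (D (p @ q))" and depth': "depth \<le> length p" and big: "2 < norm (rt (D p))"
  shows "tree_summable (D p)"
proof -
  define y where "y n = left_chain p (Suc n)" for n
  have ysel: "rt (D (p @ replicate n False)) = y n" "ahead (D (p @ replicate n False)) = y (Suc n)" for n
    by (simp_all only: left_chain_sel y_def)
  have ybig: "2 < norm (y n)" for n
    using left_chain_big[of p "n - 1"] depth' big left_chain_sel(2)[of p 0]
    by (cases n) (simp_all add: y_def)
  have rec: "y (Suc (Suc n)) =
      (multiplier (lf (D p)) + inverse (multiplier (lf (D p)))) * y (Suc n) - y n" for n
    unfolding y_def by (rule left_chain_rec)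
  obtain \<delta> where \<delta>: "0 < \<delta>" "\<And>n. 2 * exp (\<delta> * real (Suc n)) \<le> norm (y n)"
    using recurrence_exponential_growth[of y, OF rec norm_multiplier_gt_1[OF D_sides_nonreal(1)] ybig]
    by blast
  \<comment> \<open>Generalised over the number \<open>k\<close> of steps already made along the
    chain: the right side then has class v + k u, hence weight
    \<open>\<delta> * real (Suc k)\<close>.\<close>
  have "2 * exp (\<delta> * fst (coef q) + \<delta> * real (Suc k) * snd (coef q)) \<le>
      norm (ahead (D (p @ replicate k False @ q)))" for q k
  proof (induction q arbitrary: k)
    case Nil
    then show ?case using \<delta>(2)[of "Suc k"] ysel(2)[of k] by (simp add: algebra_simps)
  next
    case (Cons b q)
    obtain m n where c: "coef q = (m, n)" by (metis surj_pair)
    show ?case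
    proof (cases b)
      case True
      let ?s = "D (p @ replicate k False @ [True])"
      have s: "lf ?s = y (Suc k)" "rt ?s = y k"
        using ysel[of k] by simp_all
      have "increasing (descend q' ?s)" for q' using increasing[of "replicate k False @ [True] @ q'"] by simp
      then have "2 * exp ((\<delta> * real (Suc (Suc k))) * fst (coef q) + (\<delta> * real (Suc k)) * snd (coef q))
          \<le> norm (ahead (descend q ?s))"
        using \<delta>(1) \<delta>(2)[of "Suc k"] \<delta>(2)[of k] s by (intro fibonacci_growth) simp_all
      then show ?thesis using True by (simp add: c algebra_simps)
    next
      case False
      have "p @ replicate k False @ b # q = p @ replicate (Suc k) False @ q"
        using False by (simp add: replicate_app_Cons_same)
      then show ?thesis using Cons.IH[of "Suc k"] False by (simp only:) (simp add: c algebra_simps)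
    qed
  qed
  from this[where k=0] show ?thesis
    using \<delta>(1) by (intro tree_summable_weights[of \<delta> \<delta>]) simp_all
qed

lemma tree_summable: "tree_summable s0"
proof -
  interpret m: bq_tree \<mu> "mirror s0" by (rule bq_tree_mirror)
  obtain M0 where M0: "\<And>p. M0 \<le> length p \<Longrightarrow> increasing (D p)" using eventually_inc by blast
  \<comment> \<open>The successor gives every path of length \<open>M\<close> a last step made past
    \<open>depth\<close>. The region added by that step is large, so at most one side is
    small.\<close>
  define M where "M = Suc (max M0 (max depth m.depth))"
  have "tree_summable (D p)" if len: "length p = M" for p
  proof -
    have i: "increasing (D (p @ q))" for q using len by (intro M0) (simp add: M_def)
    have lendepth: "depth \<le> length p" "m.depth \<le> length (map Not p)" using len by (simp_all add: M_def)
    obtain p' b where p: "p = p' @ [b]" using len by (metis M_def Zero_not_Suc length_0_conv rev_exhaust)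
    have "2 < norm (ahead (D p'))" using len p by (intro depth) (simp add: M_def)
    then have new: "2 < norm (if b then lf (D p) else rt (D p))" using p by simp
    consider "2 < norm (lf (D p))" "2 < norm (rt (D p))" | "\<not> 2 < norm (lf (D p))" | "\<not> 2 < norm (rt (D p))"
      by blast
    then show ?thesis
    proof cases
      case 1
      let ?\<alpha> = "ln (norm (lf (D p)) / 2)" and ?\<beta> = "ln (norm (rt (D p)) / 2)"
      have pos: "0 < ?\<alpha>" "0 < ?\<beta>" using 1 by (auto intro!: ln_gt_zero)
      have e: "2 * exp ?\<alpha> \<le> norm (lf (D p))" "2 * exp ?\<beta> \<le> norm (rt (D p))"
        using 1 by (subst exp_ln; linarith)+
      show ?thesis
        using pos e i by (intro tree_summable_weights[OF pos] fibonacci_growth) simp_all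
    next
      case 2
      then have "2 < norm (rt (D p))" using new by (cases b) simp_all
      then show ?thesis by (intro tree_summable_small_left i lendepth)
    next
      case 3
      then have "2 < norm (lf (D p))" using new by (cases b) simp_all
      then have "tree_summable (m.D (map Not p))"
      proof (intro m.tree_summable_small_left lendepth)
        fix q show "increasing (m.D (map Not p @ q))"
          using i[of "map Not q"] mirror_descend[of "p @ map Not q" s0] by (simp add: comp_def)
      qed (simp add: mirror_descend)
      then show ?thesis by (simp add: mirror_descend tree_summable_mirror)
    qed
  qed
  then show ?thesis by (rule tree_summable_descend)
qed

lemma finite_bounded: "finite {p. norm (ahead (D p)) \<le> K}"
proof (cases "0 < K")
  case True
  have "finite {p. inverse (K\<^sup>2) \<le> inverse ((norm (ahead (D p)))\<^sup>2)}"
    using tree_summable True by (intro summable_on_imp_finite_ge) (auto simp: tree_summable_def)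
  moreover have "inverse (K\<^sup>2) \<le> inverse ((norm (ahead (D p)))\<^sup>2)" if "norm (ahead (D p)) \<le> K" for p
  proof -
    have "ahead (D p) \<noteq> 0" using ahead_nonreal[of p] by (auto simp: image_iff)
    then show ?thesis using that by (intro le_imp_inverse_le power_mono) auto
  qed
  ultimately show ?thesis by (metis (mono_tags, lifting) finite_subset mem_Collect_eq subsetI)
next
  case False
  have "norm (ahead (D p)) \<le> K \<Longrightarrow> ahead (D p) = 0" for p using False by (smt (verit) norm_le_zero_iff)
  moreover have "ahead (D p) \<noteq> 0" for p using ahead_nonreal[of p] by (auto simp: image_iff)
  ultimately have "{p. norm (ahead (D p)) \<le> K} = {}" by blast
  then show ?thesis by simp
qed

text \<open>By \<open>multiplier_root\<close> the neighbours of the region ahead would lack their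
  growing mode in one of the two directions around it; each of the two child edges excludes one
  direction.\<close>

lemma ahead_sq_neq: "(ahead (D p))\<^sup>2 \<noteq> \<mu>"
proof
  interpret m: bq_tree \<mu> "mirror s0" by (rule bq_tree_mirror)
  define x y w where "x = lf (D p)" and "y = rt (D p)" and "w = ahead (D p)"
  assume "(ahead (D p))\<^sup>2 = \<mu>"
  moreover have "markoff \<mu> (w, y, x)"
    using markoff_step[OF markoff_descend[OF markoff0], of True p] by (simp add: edge_step_def x_def y_def w_def)
  ultimately have "y = inverse (multiplier w) * x \<or> x = inverse (multiplier w) * y"
    by (intro multiplier_root) (simp_all add: w_def)
  moreover have "y \<noteq> inverse (multiplier w) * x"
    using rt_neq_bk[of "p @ [True]"] by (simp add: x_def y_def w_def)
  moreover have "x \<noteq> inverse (multiplier w) * y"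
    using m.rt_neq_bk[of "map Not (p @ [False])"] unfolding mirror_descend by (simp add: x_def y_def w_def)
  ultimately show False by blast
qed

end

section \<open>The limit of the gap products\<close>

definition gap_num :: "complex \<Rightarrow> complex \<Rightarrow> complex" where
  "gap_num e v = multiplier v + e * inverse (multiplier v)"

text \<open>\<open>e\<close> and \<open>inverse e\<close> belong to the same \<mu>, and the product
  expands to l^2 + 1/l^2 + e + 1/e. It turns the quotient of the two factors, which is the
  exponential of the gap function, into a square over \<open>v\<^sup>2 - \<mu>\<close>.\<close>

lemma gap_num_mult:
  assumes "e \<noteq> 0" "\<mu> = 2 - e - inverse e"
  shows "gap_num e v * gap_num (inverse e) v = v\<^sup>2 - \<mu>"
proof -
  define l i f where "l = multiplier v" and "i = inverse l" and "f = inverse e"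
  have "l * i = 1" "e * f = 1" "l + i = v" "\<mu> = 2 - e - f"
    using assms by (simp_all add: l_def i_def f_def multiplier_sum)
  then have "(l + e * i) * (l + f * i) = v\<^sup>2 - \<mu>" by algebra
  then show ?thesis by (simp add: gap_num_def l_def i_def f_def)
qed

lemma norm_inverse_multiplier_le: "norm (inverse (multiplier v)) \<le> 1"
  using norm_multiplier_ge_1[of v] by (simp add: norm_inverse inverse_le_1_iff)

lemma norm_inverse_multiplier_le': "norm (inverse (multiplier v)) * norm v \<le> 2"
proof -
  have "norm (inverse (multiplier v)) * norm v \<le> norm (inverse (multiplier v)) * (2 * norm (multiplier v))"
    using norm_le_multiplier by (intro mult_left_mono) auto
  also have "\<dots> = 2" by (simp add: norm_inverse)
  finally show ?thesis .
qed

lemma norm_gap_num_ge: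
  assumes "4 * norm e \<le> norm v"
  shows "norm v / 4 \<le> norm (gap_num e v)"
proof -
  have "norm (e * inverse (multiplier v)) \<le> norm e * 1"
    unfolding norm_mult using norm_inverse_multiplier_le by (intro mult_left_mono) auto
  moreover have "norm (multiplier v) \<le> norm (gap_num e v) + norm (e * inverse (multiplier v))"
    unfolding gap_num_def by (metis norm_triangle_ineq4 add_diff_cancel_right')
  ultimately show ?thesis using norm_le_multiplier[of v] assms by linarith
qed

lemma norm_multiplier_diff_ge:
  assumes "4 \<le> norm v"
  shows "norm v / 4 \<le> norm (multiplier v) - inverse (norm (multiplier v))"
proof -
  have "inverse (norm (multiplier v)) \<le> 1"
    using norm_multiplier_ge_1[of v] by (simp add: inverse_le_1_iff)
  then show ?thesis using norm_le_multiplier[of v] assms by linarith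
qed

text \<open>Large values are covered by \<open>c0\<close>, and the finitely many others by the least
  of their quotients \<open>f v / norm v\<close>.\<close>

lemma uniform_linear_bound:
  fixes f :: "complex \<Rightarrow> real"
  assumes "finite {v \<in> V. norm v \<le> K}" "\<And>v. v \<in> V \<Longrightarrow> 0 < f v" "\<And>v. v \<in> V \<Longrightarrow> v \<noteq> 0"
    and "0 < c0" "\<And>v. v \<in> V \<Longrightarrow> K \<le> norm v \<Longrightarrow> c0 * norm v \<le> f v"
  shows "\<exists>c>0. \<forall>v\<in>V. c * norm v \<le> f v"
proof -
  define c where "c = Min (insert c0 ((\<lambda>v. f v / norm v) ` {v \<in> V. norm v \<le> K}))"
  have "c > 0" unfolding c_def using assms by (subst Min_gr_iff) auto
  moreover have "c * norm v \<le> f v" if v: "v \<in> V" for v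
  proof (cases "norm v \<le> K")
    case True
    then have "c \<le> f v / norm v" unfolding c_def using v assms(1) by (intro Min_le) auto
    then show ?thesis using assms(3)[OF v] by (simp add: le_divide_eq)
  next
    case False
    have "c \<le> c0" unfolding c_def using assms(1) by (intro Min_le) auto
    then have "c * norm v \<le> c0 * norm v" by (intro mult_right_mono) auto
    then show ?thesis using assms(5)[OF v] False by simp
  qed
  ultimately show ?thesis by blast
qed

text \<open>The two roots of \<open>t\<^sup>2 - x y t + y\<^sup>2\<close> are \<open>y/l\<close> and \<open>y l\<close>. On an increasing edge the value
  behind is far from the larger of them, hence close to the smaller one.\<close>

lemma increasing_edge_estimate:
  assumes mk: "markoff \<mu> s" and increasing: "increasing s" and c: "0 < c" "c \<le> norm (lf s)" "c \<le> norm (rt s)"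
    and diff: "c * norm (lf s) \<le> norm (multiplier (lf s)) - inverse (norm (multiplier (lf s)))"
  shows "norm (bk s - rt s * inverse (multiplier (lf s))) \<le>
    2 * (norm \<mu> / c\<^sup>2 + 1) / c * (norm (lf s) / norm (rt s))"
proof -
  define x y z w l i where "x = lf s" and "y = rt s" and "z = bk s" and "w = ahead s"
    and "l = multiplier x" and "i = inverse l"
  have li: "l * i = 1" "l + i = x" by (simp_all add: l_def i_def multiplier_sum)
  have zw: "z + w = (l + i) * y" by (simp add: li x_def y_def z_def w_def ahead_def)
  have eq: "x\<^sup>2 + y\<^sup>2 + z\<^sup>2 - x * y * z = \<mu>" using mk by (simp add: markoff_def x_def y_def z_def)
  have "(z - y * i) * (z - y * l) = z\<^sup>2 - (l + i) * (y * z) + (l * i) * y\<^sup>2"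
    by (simp add: power2_eq_square algebra_simps)
  also have "\<dots> = z\<^sup>2 - x * (y * z) + 1 * y\<^sup>2" by (simp only: li)
  also have "\<dots> = \<mu> - x\<^sup>2" using eq by (simp add: algebra_simps)
  finally have prod: "(z - y * i) * (z - y * l) = \<mu> - x\<^sup>2" .
  \<comment> \<open>Here w = y/l - (z - y l). If z were close to the larger root y l, then w would
    be close to the smaller one and shorter than z, against |z| <= |w|; two triangle inequalities
    make this quantitative.\<close>
  have far: "c * norm x * norm y \<le> 2 * norm (z - y * l)"
  proof -
    have "norm l * norm y \<le> norm z + norm (z - y * l)"
      using norm_triangle_ineq4[of z "z - y * l"] by (simp add: norm_mult mult.commute)
    moreover have "w = y * i - (z - y * l)" using zw by (simp add: algebra_simps)
    then have "norm w \<le> inverse (norm l) * norm y + norm (z - y * l)"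
      using norm_triangle_ineq4[of "y * i" "z - y * l"] by (simp add: norm_mult i_def norm_inverse mult.commute)
    moreover have "norm z \<le> norm w" using increasing by (simp add: increasing_def z_def w_def)
    ultimately have "(norm l - inverse (norm l)) * norm y \<le> 2 * norm (z - y * l)"
      by (simp add: algebra_simps)
    moreover have "c * norm x * norm y \<le> (norm l - inverse (norm l)) * norm y"
      using diff by (intro mult_right_mono) (simp_all add: l_def x_def)
    ultimately show ?thesis by linarith
  qed
  have x0: "0 < norm x" "0 < norm y"
    unfolding x_def y_def using less_le_trans[OF c(1,2)] less_le_trans[OF c(1,3)] by blast+
  have "1 \<le> (norm x)\<^sup>2 / c\<^sup>2"
    using c by (simp add: x_def)
  then have "norm \<mu> * 1 \<le> norm \<mu> * ((norm x)\<^sup>2 / c\<^sup>2)" by (rule mult_left_mono) simp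
  then have num: "norm (\<mu> - x\<^sup>2) \<le> (norm \<mu> / c\<^sup>2 + 1) * (norm x)\<^sup>2"
    using norm_triangle_ineq4[of \<mu> "x\<^sup>2"] by (simp add: norm_power algebra_simps)
  have "norm (z - y * i) * (c * norm x * norm y) \<le> norm (z - y * i) * (2 * norm (z - y * l))"
    using far by (rule mult_left_mono) simp
  also have "\<dots> = 2 * norm (\<mu> - x\<^sup>2)" unfolding prod[symmetric] by (simp add: norm_mult)
  also have "\<dots> \<le> 2 * ((norm \<mu> / c\<^sup>2 + 1) * (norm x)\<^sup>2)" using num by simp
  finally have "norm (z - y * i) \<le> 2 * ((norm \<mu> / c\<^sup>2 + 1) * (norm x)\<^sup>2) / (c * norm x * norm y)"
    using x0 c by (simp add: le_divide_eq)
  also have "\<dots> = 2 * (norm \<mu> / c\<^sup>2 + 1) / c * (norm x / norm y)"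
    using x0 by (simp add: power2_eq_square)
  finally show ?thesis by (simp add: x_def y_def z_def l_def i_def)
qed

section \<open>Boundary factors and their distance from 1\<close>

definition edge_ratio :: "complex \<Rightarrow> edge \<Rightarrow> complex" where
  "edge_ratio e s = edge_num (e - 1) s / (gap_num e (lf s) * gap_num e (rt s))"

lemma edge_ratio_mirror [simp]: "edge_ratio e (mirror s) = edge_ratio e s"
  by (simp add: edge_ratio_def edge_num_def mult.commute)

text \<open>With k = e - 1, the three summands bound the errors z - y/l, x/l' and k/(l l') of
  \<open>edge_ratio_estimate\<close>, each relative to |x| / |y|; the final division by
  \<open>c\<^sup>2\<close> comes from the denominator.\<close>

definition ratio_const :: "real \<Rightarrow> complex \<Rightarrow> complex \<Rightarrow> real" where
  "ratio_const c \<mu> e =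
    norm (e - 1) * (2 * (norm \<mu> / c\<^sup>2 + 1) / c + 2 + 4 * norm (e - 1) / c\<^sup>2) / c\<^sup>2"

text \<open>The gap numerators are x + k/l and y + k/l' with k = e - 1, so numerator minus
  denominator is k (z - y/l - x/l' - k/(l l')). Each term is O(|x| / |y|), and the denominator is at
  least \<open>c\<^sup>2\<close> |x| |y|. The bound is in terms of the right side, the newest region
  after a step \<open>False\<close>; \<open>mirror\<close> gives the other case.\<close>

lemma edge_ratio_estimate:
  assumes mk: "markoff \<mu> s" and increasing: "increasing s" and c: "0 < c" "c \<le> norm (lf s)" "c \<le> norm (rt s)"
    and diff: "c * norm (lf s) \<le> norm (multiplier (lf s)) - inverse (norm (multiplier (lf s)))"
    and gap: "c * norm (lf s) \<le> norm (gap_num e (lf s))" "c * norm (rt s) \<le> norm (gap_num e (rt s))"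
  shows "norm (edge_ratio e s - 1) \<le> ratio_const c \<mu> e * inverse ((norm (rt s))\<^sup>2)"
proof -
  define x y z k where "x = lf s" and "y = rt s" and "z = bk s" and "k = e - 1"
  define i j where "i = inverse (multiplier x)" and "j = inverse (multiplier y)"
  define X Y where "X = norm x" and "Y = norm y"
  have XY: "0 < X" "0 < Y" "c \<le> X"
    unfolding X_def Y_def x_def y_def using less_le_trans[OF c(1,2)] less_le_trans[OF c(1,3)] c(2) by blast+
  have gx: "gap_num e x = x + k * i"
    using multiplier_sum[of x] by (simp add: gap_num_def i_def k_def algebra_simps)
  have gy: "gap_num e y = y + k * j"
    using multiplier_sum[of y] by (simp add: gap_num_def j_def k_def algebra_simps)
  have g0: "gap_num e x \<noteq> 0" "gap_num e y \<noteq> 0"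
    using gap c XY by (auto simp: x_def y_def X_def Y_def mult_le_0_iff)
  have N: "edge_ratio e s - 1 = k * (z - y * i - x * j - k * i * j) / (gap_num e x * gap_num e y)"
  proof -
    have "edge_num k s - gap_num e x * gap_num e y = k * (z - y * i - x * j - k * i * j)"
      unfolding gx gy by (simp add: edge_num_def x_def y_def z_def algebra_simps)
    then show ?thesis using g0
      by (simp add: edge_ratio_def k_def[symmetric] x_def[symmetric] y_def[symmetric] divide_simps)
  qed
  have t1: "norm (z - y * i) \<le> 2 * (norm \<mu> / c\<^sup>2 + 1) / c * (X / Y)"
    using increasing_edge_estimate[OF mk increasing c diff] by (simp add: x_def y_def z_def i_def X_def Y_def)
  have jY: "norm j \<le> 2 / Y" using norm_inverse_multiplier_le'[of y] XY
    by (simp add: j_def Y_def le_divide_eq)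
  have iX: "norm i \<le> 2 / X" using norm_inverse_multiplier_le'[of x] XY
    by (simp add: i_def X_def le_divide_eq)
  have t2: "norm (x * j) \<le> 2 * (X / Y)"
    unfolding norm_mult using mult_left_mono[OF jY, of "norm x"] by (simp add: X_def mult.commute)
  have t3: "norm (k * i * j) \<le> 4 * norm k / c\<^sup>2 * (X / Y)"
  proof -
    have "norm (k * i * j) \<le> norm k * (2 / X) * (2 / Y)"
      unfolding norm_mult using iX jY XY by (intro mult_mono) auto
    also have "\<dots> = 4 * norm k * (1 / X\<^sup>2) * (X / Y)" using XY by (simp add: power2_eq_square)
    also have "\<dots> \<le> 4 * norm k * (1 / c\<^sup>2) * (X / Y)"
      using XY c by (intro mult_right_mono mult_left_mono divide_left_mono power_mono) auto
    finally show ?thesis by simp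
  qed
  define A where "A = 2 * (norm \<mu> / c\<^sup>2 + 1) / c + 2 + 4 * norm k / c\<^sup>2"
  have "norm (z - y * i - x * j - k * i * j) \<le> norm (z - y * i) + norm (x * j) + norm (k * i * j)"
    by (meson norm_triangle_ineq4 order_trans add_right_mono)
  also have "\<dots> \<le> A * (X / Y)" using t1 t2 t3 unfolding A_def distrib_right by linarith
  finally have num: "norm (k * (z - y * i - x * j - k * i * j)) \<le> norm k * (A * (X / Y))"
    unfolding norm_mult by (rule mult_left_mono) simp
  have den: "(c * X) * (c * Y) \<le> norm (gap_num e x * gap_num e y)"
    unfolding norm_mult using gap XY c
    by (intro mult_mono) (simp_all add: X_def Y_def x_def y_def)
  have "norm (edge_ratio e s - 1) \<le> norm k * (A * (X / Y)) / ((c * X) * (c * Y))"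
    unfolding N norm_divide using XY c by (intro frac_le num den) (auto simp: A_def)
  also have "\<dots> = norm k * A / c\<^sup>2 * inverse (Y\<^sup>2)" using XY c by (simp add: power2_eq_square field_simps)
  finally show ?thesis by (simp add: ratio_const_def A_def k_def Y_def y_def)
qed

lemma sum_lists_Suc_snoc:
  fixes f :: "bool list \<Rightarrow> real"
  shows "(\<Sum>p | length p = Suc n. f p) =
    (\<Sum>p | length p = n. f (p @ [False])) + (\<Sum>p | length p = n. f (p @ [True]))"
proof -
  have U: "{p :: bool list. length p = Suc n} =
      (\<lambda>p. p @ [False]) ` {p. length p = n} \<union> (\<lambda>p. p @ [True]) ` {p. length p = n}"
  proof (intro equalityI subsetI)
    fix p :: "bool list" assume "p \<in> {p. length p = Suc n}"
    then obtain q b where "p = q @ [b]" "length q = n"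
      by (cases p rule: rev_cases) auto
    then show "p \<in> (\<lambda>p. p @ [False]) ` {p. length p = n} \<union> (\<lambda>p. p @ [True]) ` {p. length p = n}"
      by (cases b) auto
  qed auto
  show ?thesis unfolding U
    by (subst sum.union_disjoint) (auto simp: finite_bool_lists sum.reindex inj_on_def)
qed

context bq_tree begin

definition regions :: "complex set" where
  "regions = {lf s0, rt s0} \<union> range (\<lambda>p. ahead (D p))"

lemma regions_props:
  "ahead (D p) \<in> regions" "lf (D p) \<in> regions" "rt (D p) \<in> regions"
  "v \<in> regions \<Longrightarrow> v \<notin> complex_of_real ` {-2..2}" "v \<in> regions \<Longrightarrow> v \<noteq> 0"
  "finite {v \<in> regions. norm v \<le> K}"
proof -
  show "ahead (D p) \<in> regions" "lf (D p) \<in> regions" "rt (D p) \<in> regions"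
    using D_sides[of p] unfolding regions_def by blast+
  show r: "v \<notin> complex_of_real ` {-2..2}" if "v \<in> regions" for v
    using that unfolding regions_def
  proof (elim UnE rangeE insertE emptyE)
  qed (use sides_nonreal ahead_nonreal in \<open>simp_all only: not_False_eq_True\<close>)
  show "v \<noteq> 0" if "v \<in> regions" for v
  proof
    assume "v = 0"
    then have "v = complex_of_real 0" "(0::real) \<in> {-2..2}" by auto
    then have "v \<in> complex_of_real ` {-2..2}" by (rule image_eqI)
    with r[OF that] show False by contradiction
  qed
  have "{v \<in> regions. norm v \<le> K} \<subseteq>
      {lf s0, rt s0} \<union> (\<lambda>p. ahead (D p)) ` {p. norm (ahead (D p)) \<le> K}"
    unfolding regions_def by blast
  then show "finite {v \<in> regions. norm v \<le> K}"
    by (rule finite_subset) (simp add: finite_bounded)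
qed

context
  fixes e :: complex
  assumes e0: "e \<noteq> 0" and mu_e: "\<mu> = 2 - e - inverse e"
    and sides_sq: "(lf s0)\<^sup>2 \<noteq> \<mu>" "(rt s0)\<^sup>2 \<noteq> \<mu>"
begin

lemma regions_sq: "v \<in> regions \<Longrightarrow> v\<^sup>2 \<noteq> \<mu>"
  unfolding regions_def using sides_sq ahead_sq_neq by blast

lemma gap_num_nonzero:
  assumes "v \<in> regions"
  shows "gap_num e v \<noteq> 0" "gap_num (inverse e) v \<noteq> 0"
  using gap_num_mult[OF e0 mu_e, of v] regions_sq[OF assms] by auto

lemma regions_const:
  "\<exists>c>0. \<forall>v\<in>regions. c \<le> norm v \<and>
    c * norm v \<le> norm (multiplier v) - inverse (norm (multiplier v)) \<and>
    c * norm v \<le> norm (gap_num e v) \<and> c * norm v \<le> norm (gap_num (inverse e) v)"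
proof -
  have "\<exists>c>0. \<forall>v\<in>regions. c * norm v \<le> (norm v)\<^sup>2"
    by (rule uniform_linear_bound[of _ 1 _ 1])
      (use regions_props(5,6) in \<open>auto simp: power2_eq_square intro: mult_right_mono\<close>)
  then obtain c1 where c1: "0 < c1" "\<And>v. v \<in> regions \<Longrightarrow> c1 * norm v \<le> (norm v)\<^sup>2" by blast
  have c1': "c1 \<le> norm v" if "v \<in> regions" for v
    using c1(2)[OF that] regions_props(5)[OF that] by (simp add: power2_eq_square)
  have "\<exists>c>0. \<forall>v\<in>regions. c * norm v \<le> norm (multiplier v) - inverse (norm (multiplier v))"
  proof (rule uniform_linear_bound[of _ 4 _ "1/4"])
    show "0 < norm (multiplier v) - inverse (norm (multiplier v))" if "v \<in> regions" for v
    proof -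
      have "1 < norm (multiplier v)" by (rule norm_multiplier_gt_1[OF regions_props(4)[OF that]])
      moreover from this have "inverse (norm (multiplier v)) < 1" by (simp add: inverse_less_1_iff)
      ultimately show ?thesis by linarith
    qed
  qed (use regions_props(5,6) norm_multiplier_diff_ge in auto)
  then obtain c2 where c2: "0 < c2" "\<And>v. v \<in> regions \<Longrightarrow>
      c2 * norm v \<le> norm (multiplier v) - inverse (norm (multiplier v))" by blast
  have "\<exists>c>0. \<forall>v\<in>regions. c * norm v \<le> norm (gap_num f v)" if "f = e \<or> f = inverse e" for f
    by (rule uniform_linear_bound[of _ "4 * norm f" _ "1/4"])
      (use regions_props(5,6) norm_gap_num_ge[of f] gap_num_nonzero that in auto)
  then obtain c3 c4 where c3: "0 < c3" "\<And>v. v \<in> regions \<Longrightarrow> c3 * norm v \<le> norm (gap_num e v)"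
    and c4: "0 < c4" "\<And>v. v \<in> regions \<Longrightarrow> c4 * norm v \<le> norm (gap_num (inverse e) v)"
    by metis
  define c where "c = min (min c1 c2) (min c3 c4)"
  have le: "c \<le> c1" "c \<le> c2" "c \<le> c3" "c \<le> c4" by (auto simp: c_def)
  have "c \<le> norm v \<and> c * norm v \<le> norm (multiplier v) - inverse (norm (multiplier v)) \<and>
    c * norm v \<le> norm (gap_num e v) \<and> c * norm v \<le> norm (gap_num (inverse e) v)" if "v \<in> regions" for v
    using c1'[OF that] c2(2)[OF that] c3(2)[OF that] c4(2)[OF that] le
      mult_right_mono[OF le(2), of "norm v"] mult_right_mono[OF le(3), of "norm v"]
      mult_right_mono[OF le(4), of "norm v"] by (auto intro: order_trans)
  moreover have "0 < c" using c1(1) c2(1) c3(1) c4(1) by (simp add: c_def)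
  ultimately show ?thesis by blast
qed

lemma prod_edge_ratio_tendsto_1: "(\<lambda>n. \<Prod>p | length p = n. edge_ratio e (D p)) \<longlonglongrightarrow> 1"
proof -
  obtain c where c0: "0 < c" and c: "\<And>v. v \<in> regions \<Longrightarrow> c \<le> norm v"
    "\<And>v. v \<in> regions \<Longrightarrow> c * norm v \<le> norm (multiplier v) - inverse (norm (multiplier v))"
    "\<And>v. v \<in> regions \<Longrightarrow> c * norm v \<le> norm (gap_num e v)"
    using regions_const by blast
  obtain M where M: "\<And>p. M \<le> length p \<Longrightarrow> increasing (D p)" using eventually_inc by blast
  define C where "C = ratio_const c \<mu> e"
  have right: "norm (edge_ratio e (D p) - 1) \<le> C * inverse ((norm (rt (D p)))\<^sup>2)" if "M \<le> length p" for p
    unfolding C_def using c regions_props(2,3)[of p]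
    by (intro edge_ratio_estimate markoff_descend markoff0 M[OF that] c0) auto
  have left: "norm (edge_ratio e (D p) - 1) \<le> C * inverse ((norm (lf (D p)))\<^sup>2)" if "M \<le> length p" for p
  proof -
    have mk: "markoff \<mu> (mirror (D p))"
      using markoff_descend[OF markoff0, of p] by (simp add: markoff_def mult.commute add.commute)
    show ?thesis
      using edge_ratio_estimate[OF mk _ c0, of e] M[OF that] c regions_props(2,3)[of p]
      by (simp add: C_def)
  qed
  \<comment> \<open>Each edge of level n + 1 is charged to the region ahead of its parent, which is
    its right side after \<open>False\<close> and its left side after \<open>True\<close>. Every
    region is charged twice, hence the factor 2.\<close>
  have bound: "(\<Sum>p | length p = Suc n. norm (edge_ratio e (D p) - 1)) \<le>
      2 * C * (\<Sum>p | length p = n. inverse ((norm (ahead (D p)))\<^sup>2))" if "M \<le> n" for n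
  proof -
    have "(\<Sum>p | length p = n. norm (edge_ratio e (D (p @ [b])) - 1)) \<le>
        (\<Sum>p | length p = n. C * inverse ((norm (ahead (D p)))\<^sup>2))" for b
    proof (rule sum_mono)
      fix p :: "bool list" assume "p \<in> {p. length p = n}"
      then have "M \<le> length (p @ [b])" using that by simp
      then show "norm (edge_ratio e (D (p @ [b])) - 1) \<le> C * inverse ((norm (ahead (D p)))\<^sup>2)"
        using left[of "p @ [b]"] right[of "p @ [b]"] by (cases b) simp_all
    qed
    from this[of False] this[of True] show ?thesis
      unfolding sum_lists_Suc_snoc sum_distrib_left[symmetric] by linarith
  qed
  have lim0: "(\<lambda>n. 2 * C * (\<Sum>p | length p = n. inverse ((norm (ahead (D p)))\<^sup>2))) \<longlonglongrightarrow> 2 * C * 0"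
    using tree_summable unfolding tree_summable_def by (intro tendsto_mult tendsto_const level_sums_tendsto_0)
  have "(\<lambda>n. \<Sum>p | length p = Suc n. norm (edge_ratio e (D p) - 1)) \<longlonglongrightarrow> 0"
  proof (rule tendsto_sandwich[OF _ _ tendsto_const])
    show "\<forall>\<^sub>F n in sequentially. (\<Sum>p | length p = Suc n. norm (edge_ratio e (D p) - 1)) \<le>
        2 * C * (\<Sum>p | length p = n. inverse ((norm (ahead (D p)))\<^sup>2))"
      using bound unfolding eventually_sequentially by blast
    show "(\<lambda>n. 2 * C * (\<Sum>p | length p = n. inverse ((norm (ahead (D p)))\<^sup>2))) \<longlonglongrightarrow> 0"
      using lim0 by simp
    show "\<forall>\<^sub>F n in sequentially. 0 \<le> (\<Sum>p | length p = Suc n. norm (edge_ratio e (D p) - 1))"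
      by (intro always_eventually allI sum_nonneg) simp
  qed
  then have s0: "(\<lambda>n. \<Sum>p | length p = n. norm (edge_ratio e (D p) - 1)) \<longlonglongrightarrow> 0"
    by (rule LIMSEQ_imp_Suc)
  have "(\<lambda>n. exp (\<Sum>p | length p = n. norm (edge_ratio e (D p) - 1)) - 1) \<longlonglongrightarrow> exp 0 - 1"
    by (intro tendsto_intros s0)
  then have e0: "(\<lambda>n. exp (\<Sum>p | length p = n. norm (edge_ratio e (D p) - 1)) - 1) \<longlonglongrightarrow> 0" by simp
  have "(\<lambda>n. (\<Prod>p | length p = n. edge_ratio e (D p)) - 1) \<longlonglongrightarrow> 0"
    by (rule Lim_null_comparison[OF _ e0])
      (intro always_eventually allI norm_prod_minus1_le_exp finite_bool_lists)
  then show ?thesis by (simp add: LIM_zero_iff)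
qed

text \<open>The quotient minus 1 is (e - 1/e) / l divided by \<open>gap_num (inverse e) v\<close>,
  which is O(|v|^-2). Near 1 the principal logarithm has the same order, and only finitely many
  regions are not near.\<close>

lemma summable_Ln_gap:
  "(\<lambda>p. norm (Ln (gap_num e (ahead (D p)) / gap_num (inverse e) (ahead (D p))))) summable_on UNIV"
proof -
  obtain c where c0: "0 < c" and c: "\<And>v. v \<in> regions \<Longrightarrow> c * norm v \<le> norm (gap_num (inverse e) v)"
    using regions_const by blast
  define C where "C = 2 * norm (e - inverse e) / c"
  \<comment> \<open>For |v| > \<open>K\<close> this makes C / |v|^2 at most 1/4, well inside the
    disc of radius 1/2 on which \<open>norm_Ln_le\<close> applies.\<close>
  define K where "K = 1 + 4 * C"
  have C0: "0 \<le> C" using c0 by (simp add: C_def)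
  have close: "norm (gap_num e v / gap_num (inverse e) v - 1) \<le> C * inverse ((norm v)\<^sup>2)"
    if v: "v \<in> regions" for v
  proof -
    have v0: "0 < norm v" using regions_props(5)[OF v] by simp
    have "gap_num e v / gap_num (inverse e) v - 1 =
        (e - inverse e) * inverse (multiplier v) / gap_num (inverse e) v"
    proof -
      have "gap_num e v / gap_num (inverse e) v - 1 = (gap_num e v - gap_num (inverse e) v) / gap_num (inverse e) v"
        using gap_num_nonzero(2)[OF v] by (simp add: diff_divide_distrib)
      also have "gap_num e v - gap_num (inverse e) v = (e - inverse e) * inverse (multiplier v)"
        by (simp add: gap_num_def left_diff_distrib)
      finally show ?thesis .
    qed
    then have "norm (gap_num e v / gap_num (inverse e) v - 1) =
        norm (e - inverse e) * norm (inverse (multiplier v)) / norm (gap_num (inverse e) v)"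
      by (simp add: norm_divide norm_mult)
    also have "\<dots> \<le> norm (e - inverse e) * (2 / norm v) / (c * norm v)"
      using norm_inverse_multiplier_le'[of v] v0 c0 c[OF v]
      by (intro frac_le mult_left_mono) (auto simp: le_divide_eq)
    also have "\<dots> = C * inverse ((norm v)\<^sup>2)" by (simp add: C_def power2_eq_square divide_inverse)
    finally show ?thesis .
  qed
  have Ln: "norm (Ln (gap_num e v / gap_num (inverse e) v)) \<le> 2 * C * inverse ((norm v)\<^sup>2)"
    if v: "v \<in> regions" and big: "K < norm v" for v
  proof -
    have v1: "1 \<le> norm v" "4 * C \<le> norm v" using big C0 by (auto simp: K_def)
    then have "4 * C * 1 \<le> norm v * norm v" using C0 by (intro mult_mono) auto
    moreover have "0 < (norm v)\<^sup>2" using v1(1) by (intro zero_less_power) linarith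
    ultimately have "C * inverse ((norm v)\<^sup>2) \<le> 1/4"
      by (simp add: power2_eq_square divide_inverse[symmetric] divide_le_eq)
    then have half: "norm (gap_num e v / gap_num (inverse e) v - 1) < 1/2" using close[OF v] by linarith
    have "norm (Ln (1 + (gap_num e v / gap_num (inverse e) v - 1))) \<le>
        2 * norm (gap_num e v / gap_num (inverse e) v - 1)"
      by (rule norm_Ln_le[OF half])
    then show ?thesis using close[OF v] by simp
  qed
  let ?f = "\<lambda>p. norm (Ln (gap_num e (ahead (D p)) / gap_num (inverse e) (ahead (D p))))"
  let ?S = "{p. norm (ahead (D p)) \<le> K}"
  have "(\<lambda>p. inverse ((norm (ahead (D p)))\<^sup>2)) summable_on (- ?S)"
    by (rule summable_on_subset_banach[OF tree_summable[unfolded tree_summable_def] subset_UNIV])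
  then have "(\<lambda>p. 2 * C * inverse ((norm (ahead (D p)))\<^sup>2)) summable_on (- ?S)"
    by (rule summable_on_cmult_right)
  then have "?f summable_on (- ?S)"
  proof (rule summable_on_comparison_real)
    fix p assume "p \<in> - ?S"
    then have "K < norm (ahead (D p))" by simp
    then show "?f p \<le> 2 * C * inverse ((norm (ahead (D p)))\<^sup>2)" by (rule Ln[OF regions_props(1)])
  qed (rule norm_ge_zero)
  then have "?f summable_on (?S \<union> - ?S)"
    by (rule summable_on_Un_disjoint[OF summable_on_finite[OF finite_bounded] _ Compl_disjoint])
  then show ?thesis by (simp only: Compl_partition)
qed

end

end

theorem gap_product_tendsto:
  assumes t1: "bq_tree \<mu> (x, y, z)" and t2: "bq_tree \<mu> (x, y, x * y - z)"
    and e0: "e \<noteq> 0" and mu_e: "\<mu> = 2 - e - inverse e"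
  defines "G \<equiv> \<lambda>v. gap_num e v / gap_num (inverse e) v"
  shows "x\<^sup>2 \<noteq> \<mu>" "y\<^sup>2 \<noteq> \<mu>"
    and "(\<lambda>n. G x * G y * ((\<Prod>p | length p < n. G (ahead (descend p (x, y, z)))) *
      (\<Prod>p | length p < n. G (ahead (descend p (x, y, x * y - z)))))) \<longlonglongrightarrow> e"
proof -
  interpret t1: bq_tree \<mu> "(x, y, z)" by (rule t1)
  interpret t2: bq_tree \<mu> "(x, y, x * y - z)" by (rule t2)
  \<comment> \<open>The neighbours of a root side run into both half-trees and can decay in neither
    direction, whereas \<open>x\<^sup>2 = \<mu>\<close> forces decay in one of them.\<close>
  have no_root: "x\<^sup>2 \<noteq> \<mu>" if "bq_tree \<mu> (x, y, z)" "bq_tree \<mu> (x, y, x * y - z)" for x y z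
  proof
    interpret u1: bq_tree \<mu> "(x, y, z)" by (rule that(1))
    interpret u2: bq_tree \<mu> "(x, y, x * y - z)" by (rule that(2))
    define l i where "l = multiplier x" and "i = inverse l"
    have li: "l * i = 1" "l + i = x" by (simp_all add: l_def i_def multiplier_sum)
    assume "x\<^sup>2 = \<mu>"
    then have "y = i * z \<or> z = i * y"
      using multiplier_root[OF u1.markoff0] by (simp add: l_def i_def)
    moreover have "y \<noteq> i * z" using u1.rt_neq_bk[of "[]"] by (simp add: l_def i_def)
    ultimately have "z = i * y" by blast
    then have "y = i * (x * y - z)" using li by algebra
    then show False using u2.rt_neq_bk[of "[]"] by (simp add: l_def i_def)
  qed
  show x: "x\<^sup>2 \<noteq> \<mu>" by (rule no_root[OF t1 t2])
  show y: "y\<^sup>2 \<noteq> \<mu>"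
    using no_root[of y x z] t1.bq_tree_mirror t2.bq_tree_mirror by (simp add: mirror_def mult.commute)
  define \<kappa> where "\<kappa> = e - 1"
  have \<kappa>: "\<kappa>\<^sup>2 = - ((1 + \<kappa>) * \<mu>)" using e0 by (simp add: \<kappa>_def mu_e power2_eq_square algebra_simps)
  let ?s1 = "(x, y, z)" and ?s2 = "(x, y, x * y - z)"
  define a where "a = gap_num e"
  have Gsq: "G v = (a v)\<^sup>2 / (v\<^sup>2 - \<mu>)" if "v\<^sup>2 \<noteq> \<mu>" for v
  proof -
    have "a v \<noteq> 0" using gap_num_mult[OF e0 mu_e, of v] that by (auto simp: a_def)
    then have "G v = (a v * a v) / (a v * gap_num (inverse e) v)" by (simp add: G_def a_def)
    then show ?thesis using gap_num_mult[OF e0 mu_e, of v] by (simp add: a_def power2_eq_square)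
  qed
  define R1 R2 where "R1 n = (\<Prod>p | length p = n. edge_ratio e (t1.D p))"
    and "R2 n = (\<Prod>p | length p = n. edge_ratio e (t2.D p))" for n
  have lim: "(\<lambda>n. e / (R1 n * R2 n)) \<longlonglongrightarrow> e / (1 * 1)"
    unfolding R1_def R2_def
    by (intro tendsto_divide tendsto_mult tendsto_const t1.prod_edge_ratio_tendsto_1
        t2.prod_edge_ratio_tendsto_1 e0 mu_e)
      (simp_all add: x y)
  have eq: "G x * G y * ((\<Prod>p | length p < n. G (ahead (t1.D p))) * (\<Prod>p | length p < n. G (ahead (t2.D p))))
      = e / (R1 n * R2 n)" for n
  proof -
    define A where "A = a x * a y"
    define A1 A2 B1 B2 where "A1 = (\<Prod>p | length p < n. (a (ahead (t1.D p)))\<^sup>2)"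
      and "A2 = (\<Prod>p | length p < n. (a (ahead (t2.D p)))\<^sup>2)"
      and "B1 = (\<Prod>p | length p < n. (ahead (t1.D p))\<^sup>2 - \<mu>)"
      and "B2 = (\<Prod>p | length p < n. (ahead (t2.D p))\<^sup>2 - \<mu>)"
    have R1: "R1 n = edge_num \<kappa> ?s1 * B1 / (A * A1)"
      unfolding R1_def edge_ratio_def prod_dividef prod_edge_sides \<kappa>_def[symmetric]
        prod_edge_num[OF \<kappa> t1.markoff0] by (simp add: A_def A1_def B1_def a_def)
    have R2: "R2 n = edge_num \<kappa> ?s2 * B2 / (A * A2)"
      unfolding R2_def edge_ratio_def prod_dividef prod_edge_sides \<kappa>_def[symmetric]
        prod_edge_num[OF \<kappa> t2.markoff0] by (simp add: A_def A2_def B2_def a_def)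
    have "(\<Prod>p | length p < n. G (ahead (t1.D p))) = A1 / B1" "(\<Prod>p | length p < n. G (ahead (t2.D p))) = A2 / B2"
      using t1.ahead_sq_neq t2.ahead_sq_neq
      by (simp_all add: Gsq A1_def A2_def B1_def B2_def prod_dividef)
    moreover have "G x * G y = A\<^sup>2 / ((x\<^sup>2 - \<mu>) * (y\<^sup>2 - \<mu>))"
      using x y by (simp add: Gsq A_def power_mult_distrib)
    moreover have "edge_num \<kappa> ?s1 * edge_num \<kappa> ?s2 = e * ((x\<^sup>2 - \<mu>) * (y\<^sup>2 - \<mu>))"
      using edge_num_flip[OF \<kappa> t1.markoff0] by (simp add: \<kappa>_def)
    then have "R1 n * R2 n = e * ((x\<^sup>2 - \<mu>) * (y\<^sup>2 - \<mu>)) * (B1 * B2) / (A\<^sup>2 * (A1 * A2))"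
      unfolding R1 R2 by (simp add: power2_eq_square mult_ac)
    ultimately show ?thesis using e0 by simp
  qed
  show "(\<lambda>n. G x * G y * ((\<Prod>p | length p < n. G (ahead (t1.D p))) *
      (\<Prod>p | length p < n. G (ahead (t2.D p))))) \<longlonglongrightarrow> e"
    unfolding eq using lim by simp
qed

section \<open>Words and free bases\<close>

definition inv_letter :: "'g \<times> bool \<Rightarrow> 'g \<times> bool" where
  "inv_letter l = (fst l, \<not> snd l)"

definition inv_word :: "('g \<times> bool) list \<Rightarrow> ('g \<times> bool) list" where
  "inv_word w = rev (map inv_letter w)"

lemma inv_letter_simps [simp]:
  "fst (inv_letter l) = fst l" "snd (inv_letter l) = (\<not> snd l)" "inv_letter (inv_letter l) = l"
  "inv_letter l \<noteq> l" "l \<noteq> inv_letter l"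
  by (auto simp: inv_letter_def prod_eq_iff)

lemma inv_word_simps [simp]:
  "inv_word [] = []" "inv_word (u @ v) = inv_word v @ inv_word u" "length (inv_word u) = length u"
  "fst ` set (inv_word u) = fst ` set u" "inv_word (inv_word u) = u"
  by (simp_all add: inv_word_def image_image rev_map comp_def)

lemma inv_word_eq_Nil [simp]: "inv_word u = [] \<longleftrightarrow> u = []"
  by (simp add: inv_word_def)

lemma fst_apfst_image: "fst ` set (map (apfst f) w) = f ` fst ` set w"
  by (simp add: image_image)

lemma reduced_iff: "reduced w \<longleftrightarrow> successively (\<lambda>l k. k \<noteq> inv_letter l) w"
  unfolding reduced_def by (rule arg_cong[where f="\<lambda>P. successively P w"])
    (auto simp: fun_eq_iff prod_eq_iff)

lemma reduced_inv_word [simp]: "reduced (inv_word w) = reduced w"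
  unfolding reduced_iff inv_word_def
  by (auto simp: successively_rev successively_map intro!: arg_cong[where f="\<lambda>P. successively P w"])

lemma reduced_append:
  "reduced (u @ v) \<longleftrightarrow> reduced u \<and> reduced v \<and> (u = [] \<or> v = [] \<or> hd v \<noteq> inv_letter (last u))"
  by (auto simp: reduced_iff successively_append_iff)

lemma not_reduced_split:
  assumes "\<not> reduced w"
  obtains u l v where "w = u @ [l, inv_letter l] @ v"
  using assms
proof (induction w arbitrary: thesis)
  case Nil
  then show ?case by (simp add: reduced_def)
next
  case (Cons l w)
  show ?case
  proof (cases "reduced w")
    case True
    then obtain v where "w = inv_letter l # v"
      using Cons.prems(2) by (cases w) (auto simp: reduced_iff)
    then show ?thesis using Cons.prems(1)[of "[]" l v] by simp
  next
    case False
    then obtain u k v where "w = u @ [k, inv_letter k] @ v" using Cons.IH by blast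
    then show ?thesis using Cons.prems(1)[of "l # u" k v] by simp
  qed
qed

fun lcp :: "'a list \<Rightarrow> 'a list \<Rightarrow> nat" where
  "lcp (x # xs) (y # ys) = (if x = y then Suc (lcp xs ys) else 0)"
| "lcp _ _ = 0"

lemma lcp_commute: "lcp u v = lcp v u"
  by (induction u v rule: lcp.induct) auto

lemma lcp_le: "lcp u v \<le> length u" "lcp u v \<le> length v"
  by (induction u v rule: lcp.induct) auto

lemma lcp_ultrametric: "min (lcp u v) (lcp v w) \<le> lcp u w"
proof (induction u w arbitrary: v rule: lcp.induct)
  case (1 x xs y ys)
  then show ?case by (cases v) auto
qed (case_tac v; simp)+

lemma take_lcp: "k \<le> lcp u v \<Longrightarrow> take k u = take k v"
proof (induction u v arbitrary: k rule: lcp.induct)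
  case (1 x xs y ys)
  then show ?case by (cases k) (auto split: if_splits)
qed auto

lemma lcp_split:
  obtains u' v' where "u = take (lcp u v) u @ u'" "v = take (lcp u v) u @ v'"
    "u' = [] \<or> v' = [] \<or> hd u' \<noteq> hd v'"
proof (induction u v arbitrary: thesis rule: lcp.induct)
  case (1 x xs y ys)
  show ?case
  proof (cases "x = y")
    case True
    from "1.IH"[OF True] obtain u' v' where "xs = take (lcp xs ys) xs @ u'"
      "ys = take (lcp xs ys) xs @ v'" "u' = [] \<or> v' = [] \<or> hd u' \<noteq> hd v'" by blast
    then show ?thesis using True by (intro "1.prems"[of u' v']) auto
  next
    case False
    then show ?thesis by (intro "1.prems"[of "x # xs" "y # ys"]) auto
  qed
qed auto

section \<open>Evaluation of words in a group\<close>

context group begin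

lemma word_val_Nil [simp]: "word_val G [] = \<one>"
  by (simp add: word_val_def)

lemma word_val_Cons [simp]: "word_val G (l # w) = letter_val G l \<otimes> word_val G w"
  by (simp add: word_val_def)

lemma letter_val_closed: "fst l \<in> carrier G \<Longrightarrow> letter_val G l \<in> carrier G"
  by (simp add: letter_val_def)

lemma word_val_closed: "fst ` set w \<subseteq> carrier G \<Longrightarrow> word_val G w \<in> carrier G"
  by (induction w) (auto simp: letter_val_closed)

lemma word_val_append:
  "fst ` set u \<subseteq> carrier G \<Longrightarrow> fst ` set v \<subseteq> carrier G \<Longrightarrow>
    word_val G (u @ v) = word_val G u \<otimes> word_val G v"
  by (induction u) (auto simp: letter_val_closed word_val_closed m_assoc)

lemma letter_val_inv: "fst l \<in> carrier G \<Longrightarrow> letter_val G (inv_letter l) = inv (letter_val G l)"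
  by (simp add: letter_val_def)

lemma word_val_inv: "fst ` set u \<subseteq> carrier G \<Longrightarrow> word_val G (inv_word u) = inv (word_val G u)"
proof (induction u)
  case (Cons l u)
  have "word_val G (inv_word u @ [inv_letter l]) = word_val G (inv_word u) \<otimes> word_val G [inv_letter l]"
    using Cons.prems by (intro word_val_append) auto
  then show ?case using Cons
    by (simp add: inv_word_def letter_val_inv inv_mult_group letter_val_closed word_val_closed)
qed simp

lemma word_val_cancel:
  assumes "fst ` set (u @ [l, inv_letter l] @ v) \<subseteq> carrier G"
  shows "word_val G (u @ [l, inv_letter l] @ v) = word_val G (u @ v)"
proof -
  have c: "letter_val G l \<in> carrier G" "word_val G v \<in> carrier G"
    using assms by (auto intro: letter_val_closed word_val_closed)
  have "word_val G ([l, inv_letter l] @ v) = letter_val G l \<otimes> (inv (letter_val G l) \<otimes> word_val G v)"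
    using assms by (simp add: letter_val_inv)
  also have "\<dots> = word_val G v" using c by (simp add: m_assoc[symmetric])
  finally have e: "word_val G ([l, inv_letter l] @ v) = word_val G v" .
  have "word_val G (u @ [l, inv_letter l] @ v) = word_val G u \<otimes> word_val G ([l, inv_letter l] @ v)"
    using assms by (intro word_val_append) auto
  also have "\<dots> = word_val G (u @ v)" unfolding e using assms by (subst word_val_append) auto
  finally show ?thesis .
qed

lemma generate_word:
  assumes "x \<in> generate G B" "B \<subseteq> carrier G"
  shows "\<exists>w. fst ` set w \<subseteq> B \<and> word_val G w = x"
  using assms(1)
proof induction
  case one
  show ?case by (rule exI[of _ "[]"]) simp
next
  case (incl h)
  then show ?case using assms(2) by (intro exI[of _ "[(h, True)]"]) (auto simp: letter_val_def)
next
  case (inv h)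
  then have "h \<in> carrier G" using assms(2) by blast
  then show ?case using inv by (intro exI[of _ "[(h, False)]"]) (auto simp: letter_val_def)
next
  case (eng h1 h2)
  then obtain u v where "fst ` set u \<subseteq> B" "word_val G u = h1" "fst ` set v \<subseteq> B" "word_val G v = h2"
    by blast
  then show ?case using assms(2) by (intro exI[of _ "u @ v"]) (auto simp: word_val_append)
qed

lemma reduce_word:
  assumes "fst ` set w \<subseteq> carrier G"
  shows "\<exists>w'. reduced w' \<and> fst ` set w' \<subseteq> fst ` set w \<and> length w' \<le> length w \<and>
    word_val G w' = word_val G w"
  using assms
proof (induction "length w" arbitrary: w rule: less_induct)
  case less
  show ?case
  proof (cases "reduced w")
    case False
    then obtain u l v where w: "w = u @ [l, inv_letter l] @ v" by (rule not_reduced_split)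
    have sub: "fst ` set (u @ v) \<subseteq> fst ` set w" unfolding w by auto
    have "length (u @ v) < length w" by (simp add: w)
    from less(1)[OF this order_trans[OF sub less(2)]]
    obtain w' where "reduced w'" "fst ` set w' \<subseteq> fst ` set (u @ v)" "length w' \<le> length (u @ v)"
      "word_val G w' = word_val G (u @ v)" by blast
    then show ?thesis using word_val_cancel[of u l v] less(2) w
      by (intro exI[of _ w']) auto
  qed auto
qed

end

text \<open>By freeness a nonempty trivial word is not reduced, so it contains a cancelling pair.
  Deleting the pair changes neither of the two values, and the length drops.\<close>

lemma free_basis_word_trivial:
  assumes G: "group G" and H: "group H" and B: "free_basis G B" and f: "f \<in> B \<rightarrow> carrier H"
    and "fst ` set w \<subseteq> B" "word_val G w = \<one>\<^bsub>G\<^esub>"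
  shows "word_val H (map (apfst f) w) = \<one>\<^bsub>H\<^esub>"
  using assms(5,6)
proof (induction "length w" arbitrary: w rule: less_induct)
  case less
  interpret G: group G by fact
  interpret H: group H by fact
  show ?case
  proof (cases "w = []")
    case False
    then have "\<not> reduced w" using B less(2,3) by (auto simp: free_basis_def)
    then obtain u l v where w: "w = u @ [l, inv_letter l] @ v" by (rule not_reduced_split)
    have BG: "B \<subseteq> carrier G" using B by (simp add: free_basis_def)
    have uv: "fst ` set (u @ v) \<subseteq> B" using less(2) unfolding w by auto
    have "word_val G (u @ v) = \<one>\<^bsub>G\<^esub>"
    proof -
      have "fst ` set (u @ [l, inv_letter l] @ v) \<subseteq> carrier G" using less(2) BG unfolding w by blast
      then show ?thesis using G.word_val_cancel[of u l v] less(3) unfolding w by simp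
    qed
    then have IH: "word_val H (map (apfst f) (u @ v)) = \<one>\<^bsub>H\<^esub>"
      using less(1)[of "u @ v"] uv by (simp add: w)
    have "apfst f (inv_letter l) = inv_letter (apfst f l)" by (simp add: inv_letter_def prod_eq_iff)
    then have "map (apfst f) w = map (apfst f) u @ [apfst f l, inv_letter (apfst f l)] @ map (apfst f) v"
      by (simp add: w)
    moreover have "fst ` set (map (apfst f) w) \<subseteq> carrier H"
      using less(2) f unfolding fst_apfst_image by auto
    ultimately show ?thesis using H.word_val_cancel IH by simp
  qed (simp add: H.word_val_Nil)
qed

text \<open>Universal property of a free basis: evaluate in \<open>H\<close> any word that
  represents \<open>g\<close>. The choice of the word is immaterial by \<open>F_eq\<close>, since
  two words for \<open>g\<close> differ by a trivial one.\<close>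

lemma free_basis_hom:
  assumes G: "group G" and H: "group H" and B: "free_basis G B" and f: "f \<in> B \<rightarrow> carrier H"
  obtains \<phi> where "\<phi> \<in> hom G H" "\<And>b. b \<in> B \<Longrightarrow> \<phi> b = f b"
proof -
  interpret G: group G by fact
  interpret H: group H by fact
  have BG: "B \<subseteq> carrier G" using B by (simp add: free_basis_def)
  define word where "word g = (SOME w. fst ` set w \<subseteq> B \<and> word_val G w = g)" for g
  have word: "fst ` set (word g) \<subseteq> B" "word_val G (word g) = g" if "g \<in> carrier G" for g
  proof -
    have "g \<in> generate G B" using B that by (simp add: free_basis_def)
    from someI_ex[OF G.generate_word[OF this BG]]
    show "fst ` set (word g) \<subseteq> B" "word_val G (word g) = g" unfolding word_def by blast+
  qed
  define F where "F w = word_val H (map (apfst f) w)" for w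
  have Fc: "fst ` set (map (apfst f) w) \<subseteq> carrier H" if "fst ` set w \<subseteq> B" for w
    using that f unfolding fst_apfst_image by auto
  have F_closed: "F w \<in> carrier H" if "fst ` set w \<subseteq> B" for w
    unfolding F_def by (rule H.word_val_closed[OF Fc[OF that]])
  have F_append: "F (u @ v) = F u \<otimes>\<^bsub>H\<^esub> F v" if "fst ` set u \<subseteq> B" "fst ` set v \<subseteq> B" for u v
    unfolding F_def map_append by (rule H.word_val_append[OF Fc[OF that(1)] Fc[OF that(2)]])
  have F_inv: "F (inv_word v) = inv\<^bsub>H\<^esub> F v" if "fst ` set v \<subseteq> B" for v
  proof -
    have "map (apfst f) (inv_word v) = inv_word (map (apfst f) v)"
      by (auto simp: inv_word_def rev_map inv_letter_def prod_eq_iff)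
    then show ?thesis unfolding F_def using H.word_val_inv[OF Fc[OF that]] by simp
  qed
  have F_eq: "F u = F v" if uv: "fst ` set u \<subseteq> B" "fst ` set v \<subseteq> B" "word_val G u = word_val G v" for u v
  proof -
    have "word_val G (u @ inv_word v) = word_val G u \<otimes>\<^bsub>G\<^esub> inv\<^bsub>G\<^esub> word_val G v"
      using uv BG by (subst G.word_val_append) (auto simp: G.word_val_inv)
    also have "\<dots> = \<one>\<^bsub>G\<^esub>" using uv BG G.word_val_closed[of v] by auto
    finally have "F (u @ inv_word v) = \<one>\<^bsub>H\<^esub>"
      unfolding F_def using uv
      by (intro free_basis_word_trivial[OF G H B f]) (simp_all add: image_Un)
    then have "F u \<otimes>\<^bsub>H\<^esub> inv\<^bsub>H\<^esub> F v = \<one>\<^bsub>H\<^esub>" using uv by (simp add: F_append F_inv)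
    then show ?thesis using F_closed uv by (metis H.inv_equality H.inv_inv H.inv_closed)
  qed
  show ?thesis
  proof
    show "(\<lambda>g. F (word g)) \<in> hom G H"
    proof (rule homI)
      fix x y assume xy: "x \<in> carrier G" "y \<in> carrier G"
      have "F (word (x \<otimes>\<^bsub>G\<^esub> y)) = F (word x @ word y)"
      proof (rule F_eq)
        have "fst ` set (word x) \<subseteq> carrier G" "fst ` set (word y) \<subseteq> carrier G"
          using word(1)[OF xy(1)] word(1)[OF xy(2)] BG by blast+
        then show "word_val G (word (x \<otimes>\<^bsub>G\<^esub> y)) = word_val G (word x @ word y)"
          using xy by (simp add: G.word_val_append word(2))
      qed (use xy word(1) in \<open>simp_all add: image_Un\<close>)
      also have "\<dots> = F (word x) \<otimes>\<^bsub>H\<^esub> F (word y)" using xy word by (intro F_append)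
      finally show "F (word (x \<otimes>\<^bsub>G\<^esub> y)) = F (word x) \<otimes>\<^bsub>H\<^esub> F (word y)" .
    qed (use F_closed word in blast)
    show "F (word b) = f b" if "b \<in> B" for b
    proof -
      have bG: "b \<in> carrier G" "f b \<in> carrier H" using that BG f by auto
      have "F (word b) = F [(b, True)]"
        using that word[OF bG(1)] bG by (intro F_eq) (auto simp: G.word_val_Cons G.word_val_Nil letter_val_def)
      also have "\<dots> = f b" using bG by (simp add: F_def H.word_val_Cons H.word_val_Nil letter_val_def)
      finally show ?thesis .
    qed
  qed
qed

text \<open>After removal of the longest common prefix, the inverse of one remainder followed by the
  other is reduced and trivial, so both remainders are empty.\<close>

lemma reduced_word_unique:
  assumes G: "group G" and B: "free_basis G B" and "reduced u" "reduced v"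
    "fst ` set u \<subseteq> B" "fst ` set v \<subseteq> B" "word_val G u = word_val G v"
  shows "u = v"
proof (rule ccontr)
  interpret group G by fact
  assume ne: "u \<noteq> v"
  have BG: "B \<subseteq> carrier G" using B by (simp add: free_basis_def)
  define p where "p = take (lcp u v) u"
  obtain u' v' where s: "u = p @ u'" "v = p @ v'" "u' = [] \<or> v' = [] \<or> hd u' \<noteq> hd v'"
    unfolding p_def by (rule lcp_split)
  let ?w = "inv_word u' @ v'"
  have "last (inv_word u') = inv_letter (hd u')" if "u' \<noteq> []"
    using that by (simp add: inv_word_def last_rev hd_map)
  moreover have "reduced (inv_word u')" "reduced v'" using s(1,2) assms(3,4) by (simp_all add: reduced_append)
  ultimately have "reduced ?w" using s(3) by (auto simp: reduced_append)
  moreover have "?w \<noteq> []" using s ne by auto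
  moreover have sub: "fst ` set u' \<subseteq> B" "fst ` set v' \<subseteq> B" "fst ` set p \<subseteq> B" using s assms(5,6) by auto
  moreover have "word_val G ?w = \<one>\<^bsub>G\<^esub>"
  proof -
    have sG: "fst ` set u' \<subseteq> carrier G" "fst ` set v' \<subseteq> carrier G" "fst ` set p \<subseteq> carrier G"
      using sub BG by auto
    have "word_val G p \<otimes>\<^bsub>G\<^esub> word_val G u' = word_val G p \<otimes>\<^bsub>G\<^esub> word_val G v'"
      using assms(7) s sG by (simp add: word_val_append)
    then have "word_val G u' = word_val G v'" using sG word_val_closed by simp
    then show ?thesis using sG word_val_closed[OF sG(2)] by (simp add: word_val_append word_val_inv)
  qed
  ultimately show False using B unfolding free_basis_def by (metis Un_subset_iff image_Un inv_word_simps(4) set_append)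
qed

section \<open>Abelianization and cancellation\<close>

definition int_plane :: "(int \<times> int) monoid" where
  "int_plane = \<lparr>carrier = UNIV, mult = (+), one = 0\<rparr>"

lemma group_int_plane: "group int_plane"
proof (rule groupI)
  fix x :: "int \<times> int"
  show "\<exists>y\<in>carrier int_plane. y \<otimes>\<^bsub>int_plane\<^esub> x = \<one>\<^bsub>int_plane\<^esub>"
    by (rule bexI[of _ "- x"]) (simp_all add: int_plane_def)
qed (simp_all add: int_plane_def add.assoc)

section \<open>Conjugation and generating sets\<close>

context group begin

definition conj :: "'a \<Rightarrow> 'a \<Rightarrow> 'a" where
  "conj c x = c \<otimes> x \<otimes> inv c"

lemma cancel_simps:
  "x \<in> carrier G \<Longrightarrow> y \<in> carrier G \<Longrightarrow> x \<otimes> (inv x \<otimes> y) = y"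
  "x \<in> carrier G \<Longrightarrow> y \<in> carrier G \<Longrightarrow> inv x \<otimes> (x \<otimes> y) = y"
  by (simp_all add: m_assoc[symmetric])

lemmas word_simps = conj_def m_assoc inv_mult_group cancel_simps

lemma conj_closed [simp]: "c \<in> carrier G \<Longrightarrow> x \<in> carrier G \<Longrightarrow> conj c x \<in> carrier G"
  by (simp add: conj_def)

lemma conj_mult: "c \<in> carrier G \<Longrightarrow> x \<in> carrier G \<Longrightarrow> y \<in> carrier G \<Longrightarrow>
    conj c (x \<otimes> y) = conj c x \<otimes> conj c y"
  by (simp add: word_simps)

lemma conj_inv: "c \<in> carrier G \<Longrightarrow> x \<in> carrier G \<Longrightarrow> conj c (inv x) = inv (conj c x)"
  by (simp add: word_simps)

lemma conj_inv_conj: "c \<in> carrier G \<Longrightarrow> x \<in> carrier G \<Longrightarrow> conj (inv c) (conj c x) = x"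
  by (simp add: word_simps)

lemma generate_conj:
  assumes "c \<in> carrier G" "A \<subseteq> carrier G" "x \<in> generate G A"
  shows "conj c x \<in> generate G (conj c ` A)"
  using assms(3)
proof induction
  case one
  then show ?case using assms(1) by (simp add: conj_def generate.one)
next
  case (incl h)
  then show ?case by (simp add: generate.incl)
next
  case (inv h)
  then have "conj c (inv h) = inv (conj c h)" using assms by (intro conj_inv) auto
  then show ?case using inv by (simp add: generate.inv)
next
  case (eng h k)
  have "h \<in> carrier G" "k \<in> carrier G" using eng generate_in_carrier[OF assms(2)] by auto
  then show ?case using eng by (simp add: conj_mult assms(1) generate.eng)
qed

lemma generates_mono:
  assumes "generate G A = carrier G" "A \<subseteq> generate G B" "B \<subseteq> carrier G"
  shows "generate G B = carrier G"
proof -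
  have "generate G A \<subseteq> generate G B"
    by (rule generate_subgroup_incl[OF assms(2) generate_is_subgroup[OF assms(3)]])
  then show ?thesis using assms generate_incl[OF assms(3)] by blast
qed

lemma generates_conj:
  assumes "c \<in> carrier G" "A \<subseteq> carrier G" "generate G A = carrier G"
  shows "generate G (conj c ` A) = carrier G"
proof
  show "generate G (conj c ` A) \<subseteq> carrier G" using assms by (intro generate_incl) auto
  show "carrier G \<subseteq> generate G (conj c ` A)"
  proof
    fix g assume g: "g \<in> carrier G"
    have "conj c (conj (inv c) g) \<in> generate G (conj c ` A)"
      using assms g by (intro generate_conj) auto
    moreover have "conj c (conj (inv c) g) = g" using assms(1) g by (simp add: word_simps)
    ultimately show "g \<in> generate G (conj c ` A)" by simp
  qed
qed

end

definition basis_step :: "('g, 'm) monoid_scheme \<Rightarrow> bool \<Rightarrow> 'g \<times> 'g \<Rightarrow> 'g \<times> 'g" where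
  "basis_step G d p = (if d then (fst p \<otimes>\<^bsub>G\<^esub> snd p, snd p) else (fst p, fst p \<otimes>\<^bsub>G\<^esub> snd p))"

lemma basis_step_simps [simp]:
  "fst (basis_step G True p) = fst p \<otimes>\<^bsub>G\<^esub> snd p" "snd (basis_step G True p) = snd p"
  "fst (basis_step G False p) = fst p" "snd (basis_step G False p) = fst p \<otimes>\<^bsub>G\<^esub> snd p"
  by (simp_all add: basis_step_def)

section \<open>Homology classes and word length relative to a fixed basis\<close>

locale rank_two_basis = group G for G (structure) +
  fixes a b
  assumes gens: "free_generators G a b"
begin

lemma basis: "free_basis G {a, b}" and ab_neq: "a \<noteq> b"
  and a_closed [simp]: "a \<in> carrier G" and b_closed [simp]: "b \<in> carrier G"
  and ab_generate: "generate G {a, b} = carrier G"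
  using gens by (auto simp: free_generators_def free_basis_def)

definition abel :: "'a \<Rightarrow> int \<times> int" where
  "abel = (SOME \<phi>. \<phi> \<in> hom G int_plane \<and> \<phi> a = (1, 0) \<and> \<phi> b = (0, 1))"

lemma abel_props: "abel \<in> hom G int_plane" "abel a = (1, 0)" "abel b = (0, 1)"
proof -
  define f where "f x = (if x = a then (1, 0) else (0, 1) :: int \<times> int)" for x
  have "f \<in> {a, b} \<rightarrow> carrier int_plane" by (simp add: int_plane_def)
  from free_basis_hom[OF is_group group_int_plane basis this]
  obtain \<phi> where "\<phi> \<in> hom G int_plane" "\<And>x. x \<in> {a, b} \<Longrightarrow> \<phi> x = f x" by blast
  then have "\<phi> \<in> hom G int_plane \<and> \<phi> a = (1, 0) \<and> \<phi> b = (0, 1)" using ab_neq by (simp add: f_def)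
  from someI[of "\<lambda>\<phi>. \<phi> \<in> hom G int_plane \<and> \<phi> a = (1, 0) \<and> \<phi> b = (0, 1)", OF this]
  show "abel \<in> hom G int_plane" "abel a = (1, 0)" "abel b = (0, 1)" unfolding abel_def by blast+
qed

lemma abel_mult [simp]: "x \<in> carrier G \<Longrightarrow> y \<in> carrier G \<Longrightarrow> abel (x \<otimes> y) = abel x + abel y"
  using hom_mult[OF abel_props(1)] by (simp add: int_plane_def)

lemma abel_one [simp]: "abel \<one> = 0"
  using abel_mult[of \<one> \<one>] by simp

lemma abel_inv [simp]: "x \<in> carrier G \<Longrightarrow> abel (inv x) = - abel x"
  using abel_mult[of "inv x" x] by (simp add: eq_neg_iff_add_eq_0)

lemma abel_conj [simp]: "c \<in> carrier G \<Longrightarrow> x \<in> carrier G \<Longrightarrow> abel (conj c x) = abel x"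
  by (simp add: conj_def)

definition pair_det :: "'a \<Rightarrow> 'a \<Rightarrow> int" where
  "pair_det u v = fst (abel u) * snd (abel v) - snd (abel u) * fst (abel v)"

text \<open>Generation makes (1, 0) and (0, 1) integer combinations of the two images, so the
  determinant divides 1.\<close>

lemma pair_det_nonzero:
  assumes "u \<in> carrier G" "v \<in> carrier G" "generate G {u, v} = carrier G"
  shows "pair_det u v \<noteq> 0"
proof -
  have comb: "\<exists>m n. fst (abel x) = m * fst (abel u) + n * fst (abel v) \<and>
      snd (abel x) = m * snd (abel u) + n * snd (abel v)" if "x \<in> generate G {u, v}" for x
    using that
  proof induction
    case one
    show ?case by (intro exI[of _ 0]) simp
  next
    case (incl h)
    then consider "h = u" | "h = v" by blast
    then show ?case
    proof cases
      case 1 then show ?thesis by (intro exI[of _ 1] exI[of _ 0]) simp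
    next
      case 2 then show ?thesis by (intro exI[of _ 0] exI[of _ 1]) simp
    qed
  next
    case (inv h)
    then consider "h = u" | "h = v" by blast
    then show ?case
    proof cases
      case 1 then show ?thesis using assms by (intro exI[of _ "-1"] exI[of _ 0]) simp
    next
      case 2 then show ?thesis using assms by (intro exI[of _ 0] exI[of _ "-1"]) simp
    qed
  next
    case (eng h k)
    have hk: "h \<in> carrier G" "k \<in> carrier G" using eng assms by auto
    obtain m n m' n' where "fst (abel h) = m * fst (abel u) + n * fst (abel v)"
      "snd (abel h) = m * snd (abel u) + n * snd (abel v)"
      "fst (abel k) = m' * fst (abel u) + n' * fst (abel v)"
      "snd (abel k) = m' * snd (abel u) + n' * snd (abel v)"
      using eng by blast
    then show ?case using hk by (intro exI[of _ "m + m'"] exI[of _ "n + n'"]) (simp add: algebra_simps)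
  qed
  obtain m n p q where "m * fst (abel u) + n * fst (abel v) = 1" "m * snd (abel u) + n * snd (abel v) = 0"
    "p * fst (abel u) + q * fst (abel v) = 0" "p * snd (abel u) + q * snd (abel v) = 1"
    using comb[of a] comb[of b] assms(3) abel_props by auto
  then have "(m * q - n * p) * pair_det u v = 1" unfolding pair_det_def by algebra
  then show ?thesis by auto
qed

lemma subset_carrier: "X \<subseteq> {a, b} \<Longrightarrow> X \<subseteq> carrier G"
  using a_closed b_closed by blast

definition nf :: "'a \<Rightarrow> ('a \<times> bool) list" where
  "nf g = (SOME w. reduced w \<and> fst ` set w \<subseteq> {a, b} \<and> word_val G w = g)"

lemma nf:
  assumes "g \<in> carrier G"
  shows "reduced (nf g)" "fst ` set (nf g) \<subseteq> {a, b}" "word_val G (nf g) = g"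
proof -
  have "g \<in> generate G {a, b}" using assms ab_generate by simp
  then obtain w where w: "fst ` set w \<subseteq> {a, b}" "word_val G w = g"
    using generate_word[of g "{a, b}"] by auto
  then have "fst ` set w \<subseteq> carrier G" by (intro subset_carrier)
  then have "\<exists>w. reduced w \<and> fst ` set w \<subseteq> {a, b} \<and> word_val G w = g"
    using reduce_word[of w] w by blast
  from someI_ex[OF this] show "reduced (nf g)" "fst ` set (nf g) \<subseteq> {a, b}" "word_val G (nf g) = g"
    unfolding nf_def by blast+
qed

lemma nf_letters_closed: "g \<in> carrier G \<Longrightarrow> fst ` set (nf g) \<subseteq> carrier G"
  using nf(2) by (rule subset_carrier)

lemma nf_word_val:
  assumes "reduced w" "fst ` set w \<subseteq> {a, b}"
  shows "nf (word_val G w) = w"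
proof -
  have "word_val G w \<in> carrier G" using assms(2) by (intro word_val_closed subset_carrier)
  note n = nf[OF this]
  show ?thesis by (rule reduced_word_unique[OF is_group basis n(1) assms(1) n(2) assms(2) n(3)])
qed

lemma nf_inv:
  assumes "g \<in> carrier G"
  shows "nf (inv g) = inv_word (nf g)"
proof -
  have "nf (word_val G (inv_word (nf g))) = inv_word (nf g)"
    using nf[OF assms] by (intro nf_word_val) simp_all
  then show ?thesis
    using word_val_inv[OF nf_letters_closed[OF assms]] nf(3)[OF assms] by simp
qed

abbreviation len :: "'a \<Rightarrow> nat" where "len g \<equiv> length (nf g)"

text \<open>\<open>cp (inv g) h\<close> counts the letters of \<open>g\<close> that cancel against
  \<open>h\<close> in the product \<open>g \<otimes> h\<close>; in the Cayley tree \<open>cp\<close>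
  is the Gromov product at the identity.\<close>

definition cp :: "'a \<Rightarrow> 'a \<Rightarrow> nat" where "cp g h = lcp (nf g) (nf h)"

lemma len_inv [simp]: "g \<in> carrier G \<Longrightarrow> len (inv g) = len g"
  by (simp add: nf_inv)

lemma len_word_val_le:
  assumes "fst ` set w \<subseteq> {a, b}"
  shows "len (word_val G w) \<le> length w"
proof -
  have "fst ` set w \<subseteq> carrier G" using assms by (rule subset_carrier)
  from reduce_word[OF this] obtain w' where "reduced w'" "fst ` set w' \<subseteq> {a, b}"
    "length w' \<le> length w" "word_val G w' = word_val G w" using assms by blast
  then show ?thesis using nf_word_val[of w'] by simp
qed

lemma len_eq_0: "g \<in> carrier G \<Longrightarrow> len g = 0 \<longleftrightarrow> g = \<one>"
  using nf(3)[of g] nf_word_val[of "[]"] by (auto simp: reduced_def)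

lemma cp_commute: "cp g h = cp h g"
  by (simp add: cp_def lcp_commute)

lemma cp_le: "cp g h \<le> len g" "cp g h \<le> len h"
  by (simp_all add: cp_def lcp_le)

lemma cp_ultrametric: "min (cp g h) (cp h k) \<le> cp g k"
  by (simp add: cp_def lcp_ultrametric)

text \<open>Once the common prefix is stripped, nothing further cancels in
  \<open>inv g \<otimes> h\<close>.\<close>

lemma len_inv_mult:
  assumes "g \<in> carrier G" "h \<in> carrier G"
  shows "len (inv g \<otimes> h) + 2 * cp g h = len g + len h"
proof -
  define p where "p = take (cp g h) (nf g)"
  obtain u v where s: "nf g = p @ u" "nf h = p @ v" "u = [] \<or> v = [] \<or> hd u \<noteq> hd v"
    unfolding p_def cp_def by (rule lcp_split)
  have lp: "length p = cp g h" unfolding p_def using cp_le(1)[of g h] by simp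
  have "last (inv_word u) = inv_letter (hd u)" if "u \<noteq> []"
    using that by (simp add: inv_word_def last_rev hd_map)
  moreover have "reduced (inv_word u)" "reduced v"
    using nf(1)[OF assms(1)] nf(1)[OF assms(2)] s(1,2) by (simp_all add: reduced_append)
  ultimately have red: "reduced (inv_word u @ v)" using s(3) by (auto simp: reduced_append)
  have sub: "fst ` set p \<subseteq> carrier G" "fst ` set u \<subseteq> carrier G" "fst ` set v \<subseteq> carrier G"
    using nf_letters_closed[OF assms(1)] nf_letters_closed[OF assms(2)] s by (auto simp: image_Un)
  have "g = word_val G p \<otimes> word_val G u" "h = word_val G p \<otimes> word_val G v"
    using nf(3)[OF assms(1)] nf(3)[OF assms(2)] s sub by (simp_all add: word_val_append)
  then have "inv g \<otimes> h = inv (word_val G u) \<otimes> word_val G v"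
    using sub word_val_closed by (simp add: word_simps)
  also have "\<dots> = word_val G (inv_word u @ v)" using sub by (simp add: word_val_append word_val_inv)
  finally have "nf (inv g \<otimes> h) = inv_word u @ v"
    using red nf(2)[OF assms(1)] nf(2)[OF assms(2)] s
    by (simp only:) (intro nf_word_val, auto simp: image_Un)
  then show ?thesis using s lp by simp
qed

lemma len_mult:
  assumes "g \<in> carrier G" "h \<in> carrier G"
  shows "len (g \<otimes> h) + 2 * cp (inv g) h = len g + len h"
  using len_inv_mult[of "inv g" h] assms by simp

text \<open>If a reduced word and its inverse agreed on their first halves, then either the middle
  letter would be its own inverse (odd length) or the two middle letters would cancel (even
  length).\<close>

lemma cp_self_inv:
  assumes "g \<in> carrier G" "g \<noteq> \<one>"
  shows "2 * cp (inv g) g < len g"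
proof (rule ccontr)
  define w n where "w = nf g" and "n = length w"
  have n: "0 < n" using len_eq_0[OF assms(1)] assms(2) by (simp add: n_def w_def)
  assume "\<not> ?thesis"
  with assms(1) have c: "n \<le> 2 * lcp (inv_word w) w" by (simp add: cp_def nf_inv w_def n_def)
  have sym: "w ! i = inv_letter (w ! (n - 1 - i))" if "i < lcp (inv_word w) w" for i
  proof -
    have i: "i < n" using that lcp_le(2)[of "inv_word w" w] by (simp add: n_def)
    have "take (Suc i) (inv_word w) = take (Suc i) w" using that by (intro take_lcp) simp
    then have "inv_word w ! i = w ! i" by (metis lessI nth_take)
    then show ?thesis using i by (simp add: inv_word_def rev_nth n_def)
  qed
  show False
  proof (cases "even n")
    case True
    then obtain m where m: "n = 2 * m" by blast
    then have "w ! (m - 1) = inv_letter (w ! m)" using sym[of "m - 1"] c n by simp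
    moreover have "w ! m \<noteq> inv_letter (w ! (m - 1))"
      using nf(1)[OF assms(1)] n m unfolding reduced_iff successively_conv_nth w_def[symmetric]
      by (auto simp: n_def[symmetric] dest!: spec[of _ "m - 1"])
    ultimately show False by simp
  next
    case False
    then obtain m where m: "n = 2 * m + 1" using oddE by blast
    then show False using sym[of m] c by simp
  qed
qed

text \<open>Under Nielsen's conditions some part of every factor survives, so a product is at least
  as long as its number of factors. The induction must carry along that the cancellation with a
  preceding \<open>s\<close> depends on the first factor alone.\<close>

lemma nielsen_length:
  assumes S: "S \<subseteq> carrier G" "\<one> \<notin> S"
    and N1: "\<And>s t. s \<in> S \<Longrightarrow> t \<in> S \<Longrightarrow> s \<otimes> t \<noteq> \<one> \<Longrightarrow> 2 * cp (inv s) t \<le> len t"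
    and N2: "\<And>s t r. s \<in> S \<Longrightarrow> t \<in> S \<Longrightarrow> r \<in> S \<Longrightarrow> s \<otimes> t \<noteq> \<one> \<Longrightarrow> t \<otimes> r \<noteq> \<one> \<Longrightarrow>
      cp (inv s) t + cp (inv t) r < len t"
    and "set (t # ts) \<subseteq> S" "successively (\<lambda>s t. s \<otimes> t \<noteq> \<one>) (t # ts)" "s \<in> S" "s \<otimes> t \<noteq> \<one>"
  shows "cp (inv s) (foldr (\<otimes>) (t # ts) \<one>) = cp (inv s) t \<and>
    length (t # ts) + cp (inv s) t \<le> len (foldr (\<otimes>) (t # ts) \<one>)"
  using assms(5-8)
proof (induction ts arbitrary: s t)
  case Nil
  then have t: "t \<in> carrier G" "t \<noteq> \<one>" using S by auto
  then have "1 \<le> len t" using len_eq_0[of t] by (cases "len t") auto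
  then show ?case using N1[of s t] Nil t by auto
next
  case (Cons r ts)
  define w where "w = foldr (\<otimes>) (r # ts) \<one>"
  have IH: "cp (inv t) w = cp (inv t) r" "length (r # ts) + cp (inv t) r \<le> len w"
    using Cons.IH[of r t] Cons.prems by (simp_all add: w_def)
  have closed: "s \<in> carrier G" "t \<in> carrier G" using Cons.prems S by auto
  have "set xs \<subseteq> S \<Longrightarrow> foldr (\<otimes>) xs \<one> \<in> carrier G" for xs using S by (induction xs) auto
  from this[of "r # ts"] have w: "w \<in> carrier G" unfolding w_def using Cons.prems(1) by simp
  have n2: "cp (inv s) t + cp (inv t) r < len t" using Cons.prems by (intro N2) auto
  have l1: "len (t \<otimes> w) + 2 * cp (inv t) w = len t + len w" using closed w by (rule_tac len_mult)
  have "inv t \<otimes> (t \<otimes> w) = w" using closed w by (simp add: word_simps)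
  then have l2: "len w + 2 * cp t (t \<otimes> w) = len t + len (t \<otimes> w)"
    using len_inv_mult[of t "t \<otimes> w"] closed w by simp
  \<comment> \<open>The part of \<open>t\<close> surviving in \<open>t \<otimes> w\<close> is longer
    than what \<open>s\<close> cancels, so the ultrametric inequality becomes an equality.\<close>
  have "cp (inv s) t < cp t (t \<otimes> w)" using n2 l1 l2 IH by linarith
  then have "cp (inv s) (t \<otimes> w) = cp (inv s) t"
    using cp_ultrametric[of "inv s" t "t \<otimes> w"] cp_ultrametric[of "inv s" "t \<otimes> w" t]
      cp_commute[of t "t \<otimes> w"] by (auto simp: min_def split: if_splits)
  moreover have "length (t # r # ts) + cp (inv s) t \<le> len (t \<otimes> w)"
    using n2 l1 IH by simp
  ultimately show ?case by (simp add: w_def)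
qed

end

section \<open>Nielsen reduction\<close>

context rank_two_basis begin

text \<open>The regions on the two sides of the root edge are reached from the bases \<open>(a, b)\<close> and
  \<open>(a, b\<inverse>)\<close>.\<close>

abbreviation tree_pair :: "bool \<Rightarrow> bool list \<Rightarrow> 'a \<times> 'a" where
  "tree_pair d p \<equiv> fold (basis_step G) p (a, if d then b else inv b)"

definition mediant :: "bool \<Rightarrow> bool list \<Rightarrow> 'a" where
  "mediant d p = fst (tree_pair d p) \<otimes> snd (tree_pair d p)"

lemma tree_pair_closed [simp]: "fst (tree_pair d p) \<in> carrier G" "snd (tree_pair d p) \<in> carrier G"
proof (induction p rule: rev_induct)
  case (snoc x p)
  { case 1 then show ?case using snoc by (cases x) auto }
  { case 2 then show ?case using snoc by (cases x) auto }
qed auto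

lemma mediant_closed [simp]: "mediant d p \<in> carrier G"
  by (simp add: mediant_def)

text \<open>Besides the tree pairs themselves, the clauses allow exactly operations that leave the
  unordered pair of curve classes, and so the underlying edge, in place. Conjugation must be by a
  common element.\<close>

inductive edge_pair :: "'a \<Rightarrow> 'a \<Rightarrow> bool" where
  tree: "edge_pair (fst (tree_pair d p)) (snd (tree_pair d p))"
| swap: "edge_pair u v \<Longrightarrow> edge_pair v u"
| inv: "edge_pair u v \<Longrightarrow> edge_pair (inv u) v"
| conj: "c \<in> carrier G \<Longrightarrow> edge_pair u v \<Longrightarrow> edge_pair (conj c u) (conj c v)"

lemma edge_pair_closed: "edge_pair u v \<Longrightarrow> u \<in> carrier G \<and> v \<in> carrier G"
  by (induction rule: edge_pair.induct) auto

lemma edge_pair_inv2: "edge_pair u v \<Longrightarrow> edge_pair u (inv v)"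
  by (blast intro: edge_pair.intros)

lemma edge_pair_inv_iff: "u \<in> carrier G \<Longrightarrow> edge_pair (inv u) v \<longleftrightarrow> edge_pair u v"
  by (metis edge_pair.inv inv_inv)

lemma edge_pair_inv2_iff: "v \<in> carrier G \<Longrightarrow> edge_pair u (inv v) \<longleftrightarrow> edge_pair u v"
  by (metis edge_pair_inv2 inv_inv)

lemma edge_pair_conj_iff:
  assumes "c \<in> carrier G" "u \<in> carrier G" "v \<in> carrier G"
  shows "edge_pair (conj c u) (conj c v) \<longleftrightarrow> edge_pair u v"
proof
  assume "edge_pair (conj c u) (conj c v)"
  then have "edge_pair (conj (inv c) (conj c u)) (conj (inv c) (conj c v))"
    using assms(1) by (intro edge_pair.conj[of "inv c"]) simp
  then show "edge_pair u v" by (simp only: conj_inv_conj[OF assms(1,2)] conj_inv_conj[OF assms(1,3)])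
qed (rule edge_pair.conj[OF assms(1)])

lemma edge_pair_child:
  "edge_pair (fst (tree_pair d p)) (mediant d p)" "edge_pair (snd (tree_pair d p)) (mediant d p)"
proof -
  show "edge_pair (fst (tree_pair d p)) (mediant d p)"
    using edge_pair.tree[where d=d and p="p @ [False]"] by (simp add: mediant_def)
  have "edge_pair (mediant d p) (snd (tree_pair d p))"
    using edge_pair.tree[where d=d and p="p @ [True]"] by (simp add: mediant_def)
  then show "edge_pair (snd (tree_pair d p)) (mediant d p)" by (rule edge_pair.swap)
qed

text \<open>\<open>r \<otimes> inv s\<close> represents the region behind the edge. At the root it
  lies in the tree of the other sign; further down it is the element dropped by the last step, up to
  inversion and conjugation.\<close>

lemma tree_pair_parent:
  fixes d p
  defines "r \<equiv> fst (tree_pair d p)" and "s \<equiv> snd (tree_pair d p)"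
  shows "edge_pair r (r \<otimes> inv s) \<and> edge_pair s (r \<otimes> inv s)"
proof (cases p rule: rev_cases)
  case Nil
  have "edge_pair a (mediant (\<not> d) [])" "edge_pair (if \<not> d then b else inv b) (mediant (\<not> d) [])"
    using edge_pair_child[where d="\<not> d" and p="[]"] by simp_all
  then show ?thesis
    using edge_pair_inv_iff[of b] unfolding r_def s_def Nil mediant_def by (cases d) simp_all
next
  case (snoc q x)
  define r' s' where "r' = fst (tree_pair d q)" and "s' = snd (tree_pair d q)"
  have c: "r' \<in> carrier G" "s' \<in> carrier G" by (simp_all add: r'_def s'_def)
  have e: "edge_pair r' s'" unfolding r'_def s'_def by (rule edge_pair.tree)
  have m: "edge_pair r' (r' \<otimes> s')" "edge_pair s' (r' \<otimes> s')"
    using edge_pair_child[where d=d and p=q] by (simp_all add: r'_def s'_def mediant_def)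
  show ?thesis
  proof (cases x)
    case True
    then have "r = r' \<otimes> s'" "s = s'" unfolding r_def s_def r'_def s'_def snoc by simp_all
    then show ?thesis using c e m by (simp add: word_simps) (blast intro: edge_pair.swap)
  next
    case False
    then have rs: "r = r'" "s = r' \<otimes> s'" unfolding r_def s_def r'_def s'_def snoc by simp_all
    have "edge_pair (conj r' r') (conj r' (inv s'))"
      using c e by (intro edge_pair.conj edge_pair_inv2)
    moreover have "edge_pair (conj (r' \<otimes> s') (r' \<otimes> s')) (conj (r' \<otimes> s') (inv s'))"
      using c m by (intro edge_pair.conj edge_pair_inv2) (auto intro: edge_pair.swap)
    ultimately show ?thesis using rs c by (simp add: word_simps)
  qed
qed

text \<open>Invariance under Nielsen moves: \<open>u \<otimes> v\<close> and
  \<open>u \<otimes> inv v\<close> represent the regions at the two ends of the edge. Swapping,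
  inverting and conjugating only permute these two, up to inversion and conjugation, so the tree
  pairs are the essential case.\<close>

lemma edge_pair_moves:
  assumes "edge_pair u v"
  shows "edge_pair u (u \<otimes> v) \<and> edge_pair u (u \<otimes> inv v) \<and> edge_pair v (u \<otimes> v) \<and> edge_pair v (u \<otimes> inv v)"
  using assms
proof induction
  case (tree d p)
  show ?case using edge_pair_child[where d=d and p=p] tree_pair_parent[where d=d and p=p] by (simp add: mediant_def)
next
  case (swap u v)
  have c: "u \<in> carrier G" "v \<in> carrier G" using edge_pair_closed[OF swap(1)] by auto
  have "edge_pair (conj v v) (conj v (u \<otimes> v))" "edge_pair (conj (inv u) u) (conj (inv u) (u \<otimes> v))"
    "edge_pair v (inv (u \<otimes> inv v))" "edge_pair u (inv (u \<otimes> inv v))"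
    using c swap.IH by (auto intro!: edge_pair.conj edge_pair_inv2)
  then show ?case using c by (simp add: word_simps)
next
  case (inv u v)
  have c: "u \<in> carrier G" "v \<in> carrier G" using edge_pair_closed[OF inv(1)] by auto
  have "edge_pair (conj (inv u) (inv u)) (conj (inv u) (inv (u \<otimes> inv v)))"
    "edge_pair (conj (inv v) v) (conj (inv v) (inv (u \<otimes> inv v)))"
    "edge_pair (conj v v) (conj v (inv (u \<otimes> v)))"
    using c inv.IH by (auto intro!: edge_pair.conj edge_pair_inv2 edge_pair.inv)
  then have "edge_pair (inv u) (inv u \<otimes> v)"
    "edge_pair v (inv u \<otimes> v)" "edge_pair v (inv u \<otimes> inv v)"
    using c by (simp_all add: word_simps)
  moreover have "edge_pair (inv u) (inv u \<otimes> inv v)"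
  proof -
    have "edge_pair (conj (inv u) u) (conj (inv u) (u \<otimes> v))" using c inv.IH by (auto intro!: edge_pair.conj)
    then have "edge_pair u (v \<otimes> u)" using c by (simp add: word_simps)
    then have "edge_pair (inv u) (inv (v \<otimes> u))" by (intro edge_pair.inv edge_pair_inv2)
    then show ?thesis using c by (simp add: word_simps)
  qed
  ultimately show ?case by simp
next
  case (conj c u v)
  have cl: "u \<in> carrier G" "v \<in> carrier G" using edge_pair_closed[OF conj(2)] by auto
  have "edge_pair (conj c u) (conj c (u \<otimes> v))" "edge_pair (conj c u) (conj c (u \<otimes> inv v))"
    "edge_pair (conj c v) (conj c (u \<otimes> v))" "edge_pair (conj c v) (conj c (u \<otimes> inv v))"
    using conj by (auto intro!: edge_pair.conj)
  then show ?case using cl conj(1) by (simp add: conj_mult conj_inv)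
qed

text \<open>The opposite Nielsen move; it brings the conclusion back from a shortened pair.\<close>

lemma edge_pair_undo:
  assumes "u \<in> carrier G" "v \<in> carrier G"
  shows "edge_pair u (u \<otimes> v) \<Longrightarrow> edge_pair u v" "edge_pair (u \<otimes> v) v \<Longrightarrow> edge_pair u v"
proof -
  assume "edge_pair u (u \<otimes> v)"
  then have "edge_pair (inv u) (inv u \<otimes> (u \<otimes> v))"
    by (rule edge_pair_moves[OF edge_pair.inv, THEN conjunct1])
  then have "edge_pair (inv u) v" by (simp only: cancel_simps(2)[OF assms])
  then show "edge_pair u v" by (simp only: edge_pair_inv_iff[OF assms(1)])
next
  assume "edge_pair (u \<otimes> v) v"
  then have "edge_pair v ((u \<otimes> v) \<otimes> inv v)"
    by (rule edge_pair_moves[THEN conjunct2, THEN conjunct2, THEN conjunct2])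
  moreover have "(u \<otimes> v) \<otimes> inv v = u" using assms by (simp add: m_assoc)
  ultimately show "edge_pair u v" by (simp only: edge_pair.swap)
qed

lemma basis_edge_pair:
  assumes "a \<in> {u, inv u, v, inv v}" "b \<in> {u, inv u, v, inv v}" "u \<in> carrier G" "v \<in> carrier G"
  shows "edge_pair u v"
proof -
  have e: "edge_pair a b" using edge_pair.tree[where d=True and p="[]"] by simp
  have "a \<noteq> inv b"
  proof
    assume "a = inv b"
    then have "abel a = - abel b" by (metis abel_inv b_closed)
    then show False by (simp add: abel_props)
  qed
  moreover from this have "b \<noteq> inv a" by auto
  ultimately have "(a \<in> {u, inv u} \<and> b \<in> {v, inv v}) \<or> (a \<in> {v, inv v} \<and> b \<in> {u, inv u})"
    using assms ab_neq by auto
  moreover have "edge_pair u v" if "edge_pair x y" "x \<in> {u, inv u}" "y \<in> {v, inv v}" for x y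
    using that assms(3,4) by (auto simp: edge_pair_inv_iff edge_pair_inv2_iff)
  ultimately show ?thesis using e edge_pair.swap[OF e] by blast
qed

section \<open>Nielsen's theorem for generating pairs\<close>

definition gen_pair :: "'a \<Rightarrow> 'a \<Rightarrow> bool" where
  "gen_pair u v \<longleftrightarrow> u \<in> carrier G \<and> v \<in> carrier G \<and> generate G {u, v} = carrier G"

lemma generate_pair_memb:
  assumes "u \<in> carrier G" "v \<in> carrier G"
  shows "u \<in> generate G {u, v}" "v \<in> generate G {u, v}" "inv u \<in> generate G {u, v}" "inv v \<in> generate G {u, v}"
  by (auto intro: generate.intros)

lemma gen_pair_mult:
  assumes "gen_pair u v"
  shows "gen_pair u (u \<otimes> v)" "gen_pair (u \<otimes> v) v"
proof -
  have c: "u \<in> carrier G" "v \<in> carrier G" and g: "generate G {u, v} = carrier G"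
    using assms by (auto simp: gen_pair_def)
  have "inv u \<otimes> (u \<otimes> v) \<in> generate G {u, u \<otimes> v}" "u \<in> generate G {u, u \<otimes> v}"
    by (auto intro: generate.intros)
  then have "{u, v} \<subseteq> generate G {u, u \<otimes> v}" using c by (simp add: word_simps)
  then show "gen_pair u (u \<otimes> v)" using generates_mono[OF g] c by (simp add: gen_pair_def)
  have "(u \<otimes> v) \<otimes> inv v \<in> generate G {u \<otimes> v, v}" "v \<in> generate G {u \<otimes> v, v}"
    by (auto intro: generate.intros)
  then have "{u, v} \<subseteq> generate G {u \<otimes> v, v}" using c by (simp add: word_simps)
  then show "gen_pair (u \<otimes> v) v" using generates_mono[OF g] c by (simp add: gen_pair_def)
qed

lemma gen_pair_variant:
  assumes "gen_pair u v" "s \<in> {u, inv u} \<and> t \<in> {v, inv v} \<or> s \<in> {v, inv v} \<and> t \<in> {u, inv u}"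
  shows "gen_pair s t" "len s + len t = len u + len v" "edge_pair s t \<Longrightarrow> edge_pair u v"
proof -
  have c: "u \<in> carrier G" "v \<in> carrier G" and g: "generate G {u, v} = carrier G"
    using assms by (auto simp: gen_pair_def)
  have st: "s \<in> carrier G" "t \<in> carrier G" using assms(2) c by auto
  have "u \<in> generate G {s, t} \<and> v \<in> generate G {s, t}"
    using assms(2) c generate_pair_memb[OF st] inv_inv by auto
  then show "gen_pair s t" using generates_mono[OF g] st by (simp add: gen_pair_def)
  show "len s + len t = len u + len v" using assms(2) c by auto
  have "edge_pair s t \<Longrightarrow> edge_pair u v \<or> edge_pair v u"
    using assms(2) c by (auto simp: edge_pair_inv_iff edge_pair_inv2_iff)
  then show "edge_pair s t \<Longrightarrow> edge_pair u v" by (blast intro: edge_pair.swap)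
qed

lemma gen_pair_conj:
  assumes "gen_pair u v" "c \<in> carrier G"
  shows "gen_pair (conj c u) (conj c v)"
  using assms generates_conj[of c "{u, v}"] by (simp add: gen_pair_def)

lemma gen_pair_abel:
  assumes "gen_pair u v" "m \<noteq> 0 \<or> n \<noteq> 0"
  shows "m * fst (abel u) + n * fst (abel v) \<noteq> 0 \<or> m * snd (abel u) + n * snd (abel v) \<noteq> 0"
proof (rule ccontr)
  assume "\<not> ?thesis"
  then have e: "m * fst (abel u) + n * fst (abel v) = 0" "m * snd (abel u) + n * snd (abel v) = 0" by auto
  then have "m * pair_det u v = 0" "n * pair_det u v = 0" unfolding pair_det_def by algebra+
  moreover have "pair_det u v \<noteq> 0" using pair_det_nonzero assms(1) by (simp add: gen_pair_def)
  ultimately show False using assms(2) by simp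
qed

text \<open>With m half the length of t, the hypotheses force reduced forms t = X Y^-1 and s = Y M
  X^-1 with X and Y of length m. Conjugation by X^-1 turns t into Y^-1 X, of length at most 2 m, and
  t s into M, which is 2 m shorter than s; the total is at most the length of s alone.\<close>

lemma half_cancelled_shorter:
  assumes cl: "s \<in> carrier G" "t \<in> carrier G" and "t \<noteq> \<one>"
    and half: "2 * cp (inv s) t = len t" "2 * cp (inv t) s = len t" and "len t \<le> len s"
  shows "\<exists>x\<in>carrier G. len (conj (inv x) t) + len (conj (inv x) (t \<otimes> s)) < len s + len t"
proof -
  define m where "m = cp (inv s) t"
  have "len t \<noteq> 0" by (simp only: len_eq_0[OF cl(2)] assms(3) not_False_eq_True)
  then have m: "len t = 2 * m" "0 < m" using half(1) unfolding m_def by linarith+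
  have s2m: "2 * m \<le> len s" using assms(6) m by simp
  define X Y where "X = take m (nf t)" and "Y = take m (nf (inv t))"
  have XY: "nf t = X @ inv_word Y"
  proof -
    have "take m (rev (map inv_letter (nf t))) = rev (drop m (map inv_letter (nf t)))"
      using m(1) by (simp add: take_rev)
    then show ?thesis
      using cl by (simp add: X_def Y_def nf_inv inv_word_def rev_map drop_map comp_def)
  qed
  have lXY: "length X = m" "length Y = m" using m cl by (simp_all add: X_def Y_def)
  have "take m (nf (inv s)) = X" unfolding X_def by (rule take_lcp) (simp add: m_def cp_def)
  then obtain Z where Z: "nf (inv s) = X @ Z" by (metis append_take_drop_id)
  have sX: "nf s = inv_word Z @ inv_word X"
    using Z cl nf_inv[of "inv s"] by simp
  have "take m (nf s) = Y"
    using take_lcp[of m "nf (inv t)" "nf s"] half m by (simp add: cp_def Y_def)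
  moreover have lZ: "m \<le> length (inv_word Z)" using sX s2m lXY by (metis add_le_imp_le_right length_append mult_2 inv_word_simps(3))
  ultimately have "take m (inv_word Z) = Y" using sX by simp
  then obtain M where M: "inv_word Z = Y @ M" by (metis append_take_drop_id)
  have ns: "nf s = Y @ M @ inv_word X" using sX M by simp
  define x y where "x = word_val G X" and "y = word_val G Y"
  have subs: "fst ` set X \<subseteq> {a, b}" "fst ` set Y \<subseteq> {a, b}" "fst ` set M \<subseteq> {a, b}"
    using nf(2)[OF cl(2)] nf(2)[OF cl(1)] unfolding XY ns by (auto simp: image_Un)
  note subG = subs[THEN subset_carrier]
  have xy: "x \<in> carrier G" "y \<in> carrier G" "word_val G M \<in> carrier G"
    using subG by (auto simp: x_def y_def intro: word_val_closed)
  have te: "t = x \<otimes> inv y"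
    using nf(3)[OF cl(2)] subG unfolding XY by (simp add: word_val_append word_val_inv x_def y_def)
  have se: "s = y \<otimes> word_val G M \<otimes> inv x"
    using nf(3)[OF cl(1)] subG xy unfolding ns
    by (simp add: word_val_append word_val_inv x_def y_def image_Un m_assoc)
  have c1: "conj (inv x) t = word_val G (inv_word Y @ X)"
    using xy subG by (simp add: te word_simps word_val_append word_val_inv) (simp add: x_def y_def)
  have c2: "conj (inv x) (t \<otimes> s) = word_val G M"
    using xy by (simp add: te se word_simps)
  have "len (conj (inv x) t) \<le> length (inv_word Y @ X)"
    unfolding c1 using subs by (intro len_word_val_le) (simp add: image_Un)
  moreover have "len (conj (inv x) (t \<otimes> s)) \<le> length M"
    unfolding c2 using subs by (intro len_word_val_le)
  moreover have "len s = 2 * m + length M" unfolding ns using lXY by simp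
  ultimately have "len (conj (inv x) t) + len (conj (inv x) (t \<otimes> s)) < len s + len t"
    using m lXY by simp
  then show ?thesis using xy(1) by blast
qed

text \<open>The two generators are linearly independent in homology, and repeating one letter
  doubles a nonzero class.\<close>

lemma gen_pair_letters:
  assumes uv: "gen_pair u v" and fl: "fst l \<in> {u, v}" "fst k \<in> {u, v}" and lk: "k \<noteq> inv_letter l"
  shows "letter_val G l \<otimes> letter_val G k \<noteq> \<one>"
proof
  assume one: "letter_val G l \<otimes> letter_val G k = \<one>"
  have "{u, v} \<subseteq> carrier G" using uv by (simp add: gen_pair_def)
  then have c: "fst l \<in> carrier G" "fst k \<in> carrier G" using fl by blast+
  define i j :: int where "i = (if snd l then 1 else -1)" and "j = (if snd k then 1 else -1)"
  have nz: "i \<noteq> 0" "j \<noteq> 0" by (simp_all add: i_def j_def)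
  have "abel (letter_val G l \<otimes> letter_val G k) = abel (letter_val G l) + abel (letter_val G k)"
    using c by (intro abel_mult letter_val_closed)
  then have z: "abel (letter_val G l) + abel (letter_val G k) = 0" unfolding one by simp
  have zero: "i * fst (abel (fst l)) + j * fst (abel (fst k)) = 0" "i * snd (abel (fst l)) + j * snd (abel (fst k)) = 0"
    using arg_cong[OF z, of fst] arg_cong[OF z, of snd] c
    by (cases "snd l"; cases "snd k"; simp add: letter_val_def i_def j_def)+
  consider "fst l = u" "fst k = v" | "fst l = v" "fst k = u" | "fst l = fst k" using fl by (metis insertE emptyE)
  then show False
  proof cases
    case 1
    then show False using gen_pair_abel[OF uv, of i j] zero nz by simp
  next
    case 2
    then show False using gen_pair_abel[OF uv, of j i] zero nz by (simp add: add.commute)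
  next
    case 3
    then have "snd k = snd l" using lk by (simp add: inv_letter_def prod_eq_iff)
    then have "i * fst (abel (fst l)) = 0" "i * snd (abel (fst l)) = 0"
      using zero unfolding 3 i_def j_def by simp_all
    then have 0: "fst (abel (fst l)) = 0" "snd (abel (fst l)) = 0" using nz by simp_all
    from fl(1) consider "fst l = u" | "fst l = v" by blast
    then show False
    proof cases
      case 1 then show False using gen_pair_abel[OF uv, of 1 0] 0 by simp
    next
      case 2 then show False using gen_pair_abel[OF uv, of 0 1] 0 by simp
    qed
  qed
qed

text \<open>If a product of letters loses more than half of a letter, a Nielsen move shortens the pair.
  If it cancels a letter \<open>t\<close> from both sides, then the neighbours of \<open>t\<close> are equal, say to \<open>s\<close>, and
  the pair \<open>(t, t s)\<close> becomes shorter after conjugation by half of \<open>t\<close>.\<close>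

lemma gen_pair_edge_pair:
  assumes "gen_pair u v"
  shows "edge_pair u v"
  using assms
proof (induction "len u + len v" arbitrary: u v rule: less_induct)
  case less
  have c: "u \<in> carrier G" "v \<in> carrier G" and g: "generate G {u, v} = carrier G"
    using less(2) by (auto simp: gen_pair_def)
  define S where "S = {u, inv u, v, inv v}"
  have SG: "S \<subseteq> carrier G" using c by (auto simp: S_def)
  have ab_u: "abel u \<noteq> 0" using gen_pair_abel[OF less(2), of 1 0] by auto
  have ab_v: "abel v \<noteq> 0" using gen_pair_abel[OF less(2), of 0 1] by auto
  have S_abel: "abel s \<noteq> 0" if "s \<in> S" for s using that ab_u ab_v c by (auto simp: S_def)
  then have one: "\<one> \<notin> S" by fastforce
  have kinds: "t = s \<or> t = inv s \<or> (s \<in> {u, inv u} \<and> t \<in> {v, inv v} \<or> s \<in> {v, inv v} \<and> t \<in> {u, inv u})"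
    if "s \<in> S" "t \<in> S" for s t using that c by (auto simp: S_def)
  show ?case
  proof (rule ccontr)
    assume no: "\<not> edge_pair u v"
    \<comment> \<open>A Nielsen move that shortened the pair would give an edge by induction and
      hence, undone, for the pair itself. So \<open>s \<otimes> t\<close> is no shorter than either
      factor, and \<open>len_mult\<close> turns this into the two half-length bounds.\<close>
    have N1: "2 * cp (inv s) t \<le> len s \<and> 2 * cp (inv s) t \<le> len t"
      if st: "s \<in> S" "t \<in> S" "s \<otimes> t \<noteq> \<one>" for s t
    proof -
      have cl: "s \<in> carrier G" "t \<in> carrier G" using st SG by auto
      from kinds[OF st(1,2)] consider "t = s" | "t = inv s"
        | (k) "s \<in> {u, inv u} \<and> t \<in> {v, inv v} \<or> s \<in> {v, inv v} \<and> t \<in> {u, inv u}"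
        by blast
      then show ?thesis
      proof cases
        case 1
        moreover have "s \<noteq> \<one>" using st(1) one by blast
        ultimately show ?thesis using cp_self_inv[OF cl(1)] by simp
      next
        case 2
        then show ?thesis using st(3) cl by simp
      next
        case k
        note V = gen_pair_variant[OF less(2) k]
        have "\<not> len (s \<otimes> t) < len t"
          using less(1)[of s "s \<otimes> t"] gen_pair_mult[OF V(1)] V(2,3) edge_pair_undo[OF cl] no by auto
        moreover have "\<not> len (s \<otimes> t) < len s"
          using less(1)[of "s \<otimes> t" t] gen_pair_mult[OF V(1)] V(2,3) edge_pair_undo[OF cl] no by auto
        ultimately show ?thesis using len_mult[OF cl] by linarith
      qed
    qed
    have N2: "cp (inv s) t + cp (inv t) r < len t"
      if str: "s \<in> S" "t \<in> S" "r \<in> S" "s \<otimes> t \<noteq> \<one>" "t \<otimes> r \<noteq> \<one>" for s t r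
    proof (rule ccontr)
      assume "\<not> ?thesis"
      then have half: "2 * cp (inv s) t = len t" "2 * cp (inv t) r = len t"
        using N1[OF str(1,2,4)] N1[OF str(2,3,5)] by linarith+
      have cl: "s \<in> carrier G" "t \<in> carrier G" "r \<in> carrier G" using str SG by auto
      have t1: "t \<noteq> \<one>" using str(2) one by blast
      note self = cp_self_inv[OF cl(2) t1]
      define m where "m = cp (inv s) t"
      have m: "len t = 2 * m" "0 < m" using half(1) self by (simp_all add: m_def)
      have "t \<noteq> s" "t \<noteq> inv s" using self half(1) str(4) cl by auto
      then have k: "s \<in> {u, inv u} \<and> t \<in> {v, inv v} \<or> s \<in> {v, inv v} \<and> t \<in> {u, inv u}"
        using kinds[OF str(1,2)] by blast
      have "r \<noteq> t" "r \<noteq> inv t" using self half(2) str(5) cl by auto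
      have same: "x = z \<or> x = inv z" if "x \<in> {y, inv y}" "z \<in> {y, inv y}" "y \<in> carrier G" for x y z
        using that by auto
      from k have "r = s \<or> r = inv s"
      proof (elim disjE conjE)
        assume st: "s \<in> {u, inv u}" "t \<in> {v, inv v}"
        then have "r \<notin> {v, inv v}" using same[of r v t] c \<open>r \<noteq> t\<close> \<open>r \<noteq> inv t\<close> by blast
        then have "r \<in> {u, inv u}" using str(3) unfolding S_def by blast
        then show ?thesis using same[of r u s] st c by blast
      next
        assume st: "s \<in> {v, inv v}" "t \<in> {u, inv u}"
        then have "r \<notin> {u, inv u}" using same[of r u t] c \<open>r \<noteq> t\<close> \<open>r \<noteq> inv t\<close> by blast
        then have "r \<in> {v, inv v}" using str(3) unfolding S_def by blast
        then show ?thesis using same[of r v s] st c by blast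
      qed
      \<comment> \<open>Otherwise \<open>t\<close> and its inverse would both share half their
        length with \<open>inv s\<close>, hence with each other, against
        \<open>cp_self_inv\<close>.\<close>
      moreover have "r \<noteq> inv s"
      proof
        assume "r = inv s"
        then have "cp (inv t) (inv s) = m" "cp (inv s) t = m" using half by (simp_all add: m_def)
        then have "m \<le> cp (inv t) t" using cp_ultrametric[of "inv t" "inv s" t] by simp
        then show False using self m by simp
      qed
      ultimately have rs: "r = s" by blast
      have s2m: "2 * m \<le> len s" using N1[OF str(1,2,4)] by (simp add: m_def)
      have "len t \<le> len s" using N1[OF str(1,2,4)] half by simp
      then obtain x where x: "x \<in> carrier G"
        and "len (conj (inv x) t) + len (conj (inv x) (t \<otimes> s)) < len s + len t"
        using half_cancelled_shorter[OF cl(1,2) t1] half rs by blast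
      then have shorter: "len (conj (inv x) t) + len (conj (inv x) (t \<otimes> s)) < len u + len v"
        using gen_pair_variant(2)[OF less(2) k] by simp
      have k': "t \<in> {u, inv u} \<and> s \<in> {v, inv v} \<or> t \<in> {v, inv v} \<and> s \<in> {u, inv u}" using k by blast
      note V = gen_pair_variant[OF less(2) k']
      have "gen_pair (conj (inv x) t) (conj (inv x) (t \<otimes> s))"
        using gen_pair_mult(1)[OF V(1)] x by (intro gen_pair_conj) auto
      from less(1)[OF shorter this] have "edge_pair t (t \<otimes> s)"
        using x cl by (subst (asm) edge_pair_conj_iff) auto
      then show False using edge_pair_undo(1)[OF cl(2,1)] V(3) no by blast
    qed
    \<comment> \<open>Basis elements have length 1, and with both Nielsen conditions in force a
      product of length 1 has just one factor. So \<open>a\<close> and \<open>b\<close> are among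
      the generators and their inverses.\<close>
    have letter: "x \<in> S" if x: "x \<in> carrier G" "len x = 1" for x
    proof -
      obtain w0 where w0: "fst ` set w0 \<subseteq> {u, v}" "word_val G w0 = x"
        using generate_word[of x "{u, v}"] x c g by auto
      have "fst ` set w0 \<subseteq> carrier G" using w0 c by blast
      from reduce_word[OF this] obtain w where w: "reduced w" "fst ` set w \<subseteq> {u, v}" "word_val G w = x"
        using w0 by blast
      define ts where "ts = map (letter_val G) w"
      have letS: "letter_val G l \<in> S" if "l \<in> set w" for l
      proof -
        have "fst l \<in> {u, v}" using that w(2) by blast
        then show ?thesis unfolding letter_val_def S_def by (elim insertE emptyE) simp_all
      qed
      have tsS: "set ts \<subseteq> S" using letS by (auto simp: ts_def)
      have prod: "foldr (\<otimes>) ts \<one> = x"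
        unfolding w(3)[symmetric] word_val_def ts_def by (simp add: foldr_map comp_def)
      have step: "letter_val G l \<otimes> letter_val G k \<noteq> \<one>"
        if "l \<in> set w" "k \<in> set w" "k \<noteq> inv_letter l" for l k
        by (rule gen_pair_letters[OF less(2) _ _ that(3)]) (use that w(2) in blast)+
      have succ: "successively (\<lambda>s t. s \<otimes> t \<noteq> \<one>) ts"
        unfolding ts_def successively_map
        using w(1) step unfolding reduced_iff successively_conv_nth by simp
      have "ts \<noteq> []" using prod x len_eq_0[of \<one>] by auto
      then obtain t ts' where ts: "ts = t # ts'" by (cases ts) auto
      have tS: "t \<in> S" "t \<in> carrier G" using tsS ts SG by auto
      \<comment> \<open>\<open>nielsen_length\<close> needs some preceding factor that does not
        cancel the first one outright; \<open>t\<close> itself serves.\<close>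
      have "t \<otimes> t \<noteq> \<one>"
      proof
        assume "t \<otimes> t = \<one>"
        then have "abel t + abel t = 0" using abel_mult[OF tS(2) tS(2)] by simp
        then show False using S_abel[OF tS(1)] by (simp add: prod_eq_iff)
      qed
      then have "length (t # ts') + cp (inv t) t \<le> len x"
        using nielsen_length[OF SG one, of t ts' t] N1 N2 tsS succ tS prod unfolding ts by blast
      then have "ts' = []" using x by simp
      then show ?thesis using prod tS ts by simp
    qed
    have "len a = 1" "len b = 1"
      using nf_word_val[of "[(a, True)]"] nf_word_val[of "[(b, True)]"] by (simp_all add: letter_val_def reduced_def)
    then have "edge_pair u v" using letter[of a] letter[of b] c unfolding S_def by (intro basis_edge_pair) simp_all
    then show False using no by contradiction
  qed
qed

end

section \<open>Curve classes and their traces\<close>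

text \<open>Cayley-Hamilton: for determinant 1 the inverse is (trace B) I - B, which is
  \<open>B'\<close> in the proof.\<close>

lemma trace_mult_inverse_SL2:
  fixes A B C :: "complex^2^2"
  assumes "det B = 1" "C ** B = mat 1"
  shows "trace (A ** B) + trace (A ** C) = trace A * trace B"
proof -
  define B' :: "complex^2^2" where
    "B' = (\<chi> i j. if i = j then trace B - B$i$j else - B$i$j)"
  have "B ** B' = mat 1"
    using assms(1)
    by (simp add: B'_def matrix_matrix_mult_def mat_def vec_eq_iff forall_2 sum_2 trace_def
        det_2 algebra_simps)
  then have "C = B'"
    using assms(2) by (metis matrix_mul_assoc matrix_mul_lid matrix_mul_rid)
  then show ?thesis
    by (simp add: B'_def matrix_matrix_mult_def trace_def sum_2 algebra_simps)
qed

context group begin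

lemma word_val_hom:
  assumes H: "group H" and h: "h \<in> hom G H" and "fst ` set w \<subseteq> carrier G"
  shows "word_val H (map (apfst h) w) = h (word_val G w)"
proof -
  interpret H: group H by fact
  interpret gh: group_hom G H h
    using h by (simp add: group_hom_def group_hom_axioms_def H is_group)
  show ?thesis using assms(3)
  proof (induction w)
    case (Cons l w)
    have "letter_val H (apfst h l) = h (letter_val G l)" using Cons.prems by (simp add: letter_val_def)
    then show ?case using Cons by (simp add: H.word_val_Cons letter_val_closed word_val_closed)
  qed (simp add: H.word_val_Nil)
qed

text \<open>A nontrivial relation between \<open>u'\<close> and \<open>v'\<close> would be carried
  by \<open>h\<close> to one between \<open>u\<close> and \<open>v\<close>; as \<open>h\<close> is
  injective on the two letters, reduced words stay reduced.\<close>

lemma free_generators_retract: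
  assumes fg: "free_generators G u v" and c: "u' \<in> carrier G" "v' \<in> carrier G"
    and gen: "generate G {u', v'} = carrier G"
    and h: "h \<in> hom G G" "h u' = u" "h v' = v"
  shows "free_generators G u' v'"
proof -
  have ne: "u \<noteq> v" "u' \<noteq> v'" using fg h by (auto simp: free_generators_def)
  have B: "word_val G w \<noteq> \<one>" if "w \<noteq> []" "fst ` set w \<subseteq> {u, v}" "reduced w" for w
    using fg that by (simp add: free_generators_def free_basis_def)
  have "word_val G w \<noteq> \<one>" if w: "w \<noteq> []" "fst ` set w \<subseteq> {u', v'}" "reduced w" for w
  proof
    assume "word_val G w = \<one>"
    have "fst ` set w \<subseteq> carrier G" using w(2) c by blast
    then have "word_val G (map (apfst h) w) = h \<one>"
      using word_val_hom[OF is_group h(1)] \<open>word_val G w = \<one>\<close> by simp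
    also have "h \<one> = \<one>"
      using h(1) is_group by (intro hom_one)
    finally have "word_val G (map (apfst h) w) = \<one>" .
    moreover have "fst ` set (map (apfst h) w) \<subseteq> {u, v}"
    proof -
      have "h ` {u', v'} = {u, v}" using h(2,3) by simp
      then show ?thesis using image_mono[OF w(2), of h] unfolding fst_apfst_image by simp
    qed
    moreover have "reduced (map (apfst h) w)"
    proof -
      have "h x \<noteq> h y" if "x \<in> {u', v'}" "y \<in> {u', v'}" "x \<noteq> y" for x y
        using that h(2,3) ne by (elim insertE emptyE) simp_all
      moreover have "fst l \<in> {u', v'}" if "l \<in> set w" for l using that w(2) by blast
      ultimately have inj: "h (fst l) = h (fst k) \<longleftrightarrow> fst l = fst k" if "l \<in> set w" "k \<in> set w" for l k
        using that by metis
      show ?thesis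
        using w(3) unfolding reduced_def successively_map
        by (rule successively_mono) (simp add: inj)
    qed
    ultimately show False using B[of "map (apfst h) w"] w(1) by simp
  qed
  then show ?thesis using c gen ne(2) by (simp add: free_generators_def free_basis_def)
qed

text \<open>For the last three moves, the homomorphism required by
  \<open>free_generators_retract\<close> is the inverse Nielsen automorphism, obtained from the
  universal property.\<close>

lemma free_generators_moves:
  assumes fg: "free_generators G u v"
  shows "free_generators G v u" "free_generators G u (inv v)"
    "free_generators G u (u \<otimes> v)" "free_generators G (u \<otimes> v) v"
proof -
  have c: "u \<in> carrier G" "v \<in> carrier G" and g: "generate G {u, v} = carrier G" and ne: "u \<noteq> v"
    and B: "free_basis G {u, v}"
    using fg by (auto simp: free_generators_def free_basis_def)
  have hom: "\<exists>h. h \<in> hom G G \<and> h u = x \<and> h v = y" if xy: "x \<in> carrier G" "y \<in> carrier G" for x y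
  proof -
    have "(\<lambda>z. if z = u then x else y) \<in> {u, v} \<rightarrow> carrier G" using xy by simp
    from free_basis_hom[OF is_group is_group B this]
    obtain h where "h \<in> hom G G" "\<And>z. z \<in> {u, v} \<Longrightarrow> h z = (if z = u then x else y)" by blast
    then show ?thesis using ne by (intro exI[of _ h]) auto
  qed
  have gen: "generate G {u', v'} = carrier G"
    if "u' \<in> carrier G" "v' \<in> carrier G" "u \<in> generate G {u', v'}" "v \<in> generate G {u', v'}" for u' v'
    using generates_mono[OF g] that by simp
  show "free_generators G v u" using B ne by (simp add: free_generators_def insert_commute)
  obtain h where h: "h \<in> hom G G" "h u = u" "h v = inv v" using hom[of u "inv v"] c by auto
  have "inv (inv v) \<in> generate G {u, inv v}" "u \<in> generate G {u, inv v}"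
    by (auto intro: generate.intros)
  then have "generate G {u, inv v} = carrier G" using c by (intro gen) auto
  moreover have "h (inv v) = v" using h c
    by (metis group_hom.hom_inv group_hom.intro group_hom_axioms.intro inv_inv is_group)
  ultimately show "free_generators G u (inv v)"
    using h c by (intro free_generators_retract[OF fg, where h=h]) auto
  obtain k where k: "k \<in> hom G G" "k u = u" "k v = inv u \<otimes> v" using hom[of u "inv u \<otimes> v"] c by auto
  have "inv u \<otimes> (u \<otimes> v) \<in> generate G {u, u \<otimes> v}" "u \<in> generate G {u, u \<otimes> v}"
    by (auto intro: generate.intros)
  then have "generate G {u, u \<otimes> v} = carrier G" using c by (intro gen) (simp_all add: cancel_simps)
  moreover have "k (u \<otimes> v) = v" using hom_mult[OF k(1)] k c by (simp add: cancel_simps)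
  ultimately show "free_generators G u (u \<otimes> v)"
    using k c by (intro free_generators_retract[OF fg, where h=k]) auto
  obtain l where l: "l \<in> hom G G" "l u = u \<otimes> inv v" "l v = v" using hom[of "u \<otimes> inv v" v] c by auto
  have "(u \<otimes> v) \<otimes> inv v \<in> generate G {u \<otimes> v, v}" "v \<in> generate G {u \<otimes> v, v}"
    by (auto intro: generate.intros)
  then have "generate G {u \<otimes> v, v} = carrier G" using c by (intro gen) (simp_all add: m_assoc)
  moreover have "l (u \<otimes> v) = u" using hom_mult[OF l(1)] l c by (simp add: m_assoc)
  ultimately show "free_generators G (u \<otimes> v) v"
    using l c by (intro free_generators_retract[OF fg, where h=l]) auto
qed

section \<open>Classes up to conjugation and inversion\<close>

definition curve_class :: "'a \<Rightarrow> 'a set" where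
  "curve_class g = conj_inv_rel G `` {g}"

lemma curve_class_eq_iff:
  assumes "g \<in> carrier G" "h \<in> carrier G"
  shows "curve_class g = curve_class h \<longleftrightarrow> (\<exists>x\<in>carrier G. g = conj x h \<or> g = conj x (inv h))"
  unfolding curve_class_def eq_equiv_class_iff[OF equiv_conj_inv_rel[OF is_group] assms]
  using assms by (auto simp: conj_inv_rel_def conj_def)

lemma curve_class_inv [simp]: "g \<in> carrier G \<Longrightarrow> curve_class (inv g) = curve_class g"
  by (subst curve_class_eq_iff) (auto intro!: bexI[of _ \<one>] simp: conj_def)

lemma curve_class_conj [simp]:
  "c \<in> carrier G \<Longrightarrow> g \<in> carrier G \<Longrightarrow> curve_class (conj c g) = curve_class g"
  by (subst curve_class_eq_iff) auto

lemma curve_class_self: "g \<in> carrier G \<Longrightarrow> g \<in> curve_class g"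
  unfolding curve_class_def by (rule equiv_class_self[OF equiv_conj_inv_rel[OF is_group]])

lemma curve_class_in_quotient: "g \<in> carrier G \<Longrightarrow> curve_class g \<in> carrier G // conj_inv_rel G"
  unfolding curve_class_def by (rule quotientI)

lemma curve_classes_eq: "curve_classes G = {curve_class g | g h. free_generators G g h}"
proof (intro equalityI subsetI)
  fix C assume "C \<in> curve_classes G"
  then obtain g h where C: "C \<in> carrier G // conj_inv_rel G" "g \<in> C" "free_generators G g h"
    by (auto simp: curve_classes_def)
  then have "C = conj_inv_rel G `` {g}"
    by (metis Image_singleton_iff equiv_class_eq equiv_conj_inv_rel is_group quotientE)
  then show "C \<in> {curve_class g | g h. free_generators G g h}" using C(3) by (auto simp: curve_class_def)
next
  fix C assume "C \<in> {curve_class g | g h. free_generators G g h}"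
  then obtain g h where C: "C = curve_class g" "free_generators G g h" by blast
  then have "g \<in> carrier G" by (simp add: free_generators_def free_basis_def)
  then show "C \<in> curve_classes G"
    using C curve_class_self curve_class_in_quotient unfolding curve_classes_def by blast
qed

end

context rank_two_basis begin

lemma tree_pair_free: "free_generators G (fst (tree_pair d p)) (snd (tree_pair d p))"
proof (induction p rule: rev_induct)
  case Nil
  then show ?case using free_generators_moves(2)[OF gens] gens by simp
next
  case (snoc x p)
  then show ?case using free_generators_moves(3,4)[OF snoc] by (cases x) simp_all
qed

definition tree_classes :: "'a set set" where
  "tree_classes = {curve_class a, curve_class b} \<union> range (\<lambda>p. curve_class (mediant True p)) \<union>
     range (\<lambda>p. curve_class (mediant False p))"

lemma mediant_in_tree_classes: "curve_class (mediant d p) \<in> tree_classes"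
  unfolding tree_classes_def by (cases d) auto

lemma tree_pair_in_tree_classes:
  "curve_class (fst (tree_pair d p)) \<in> tree_classes \<and> curve_class (snd (tree_pair d p)) \<in> tree_classes"
proof (induction p rule: rev_induct)
  case Nil
  then show ?case by (simp add: tree_classes_def)
next
  case (snoc x p)
  then show ?case using mediant_in_tree_classes[of d p] by (cases x) (simp_all add: mediant_def)
qed

lemma edge_pair_in_tree_classes:
  "edge_pair u v \<Longrightarrow> curve_class u \<in> tree_classes \<and> curve_class v \<in> tree_classes"
proof (induction rule: edge_pair.induct)
  case (inv u v)
  then show ?case using edge_pair_closed[OF inv(1)] by simp
next
  case (conj c u v)
  then show ?case using edge_pair_closed[OF conj(2)] by simp
qed (simp_all add: tree_pair_in_tree_classes)

lemma curve_classes_eq_tree: "curve_classes G = tree_classes"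
proof (intro equalityI subsetI)
  fix C assume "C \<in> curve_classes G"
  then obtain g h where C: "C = curve_class g" "free_generators G g h" by (auto simp: curve_classes_eq)
  then have "gen_pair g h" by (simp add: gen_pair_def free_generators_def free_basis_def)
  then show "C \<in> tree_classes" using edge_pair_in_tree_classes[OF gen_pair_edge_pair] C(1) by blast
next
  fix C assume "C \<in> tree_classes"
  then consider "C = curve_class a" | "C = curve_class b" | d p where "C = curve_class (mediant d p)"
    unfolding tree_classes_def by blast
  then show "C \<in> curve_classes G"
  proof cases
    case 1 then show ?thesis using gens by (auto simp: curve_classes_eq)
  next
    case 2 then show ?thesis using free_generators_moves(1)[OF gens] by (auto simp: curve_classes_eq)
  next
    case 3
    then show ?thesis
      using free_generators_moves(4)[OF tree_pair_free[of p d], folded mediant_def]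
      unfolding curve_classes_eq by blast
  qed
qed

lemma abel_descendant:
  assumes "u \<in> carrier G" "v \<in> carrier G"
  shows "abel (fst (fold (basis_step G) p (u, v)) \<otimes> snd (fold (basis_step G) p (u, v))) =
    (int (fst (coef p)) * fst (abel u) + int (snd (coef p)) * fst (abel v),
     int (fst (coef p)) * snd (abel u) + int (snd (coef p)) * snd (abel v))"
  using assms
proof (induction p arbitrary: u v)
  case Nil
  then show ?case by (simp add: prod_eq_iff)
next
  case (Cons d p)
  obtain m n where c: "coef p = (m, n)" by (metis surj_pair)
  show ?case
  proof (cases d)
    case True
    have "basis_step G d (u, v) = (u \<otimes> v, v)" using True by (simp add: basis_step_def)
    then show ?thesis using Cons.IH[of "u \<otimes> v" v] Cons.prems True c by (simp add: algebra_simps)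
  next
    case False
    have "basis_step G d (u, v) = (u, u \<otimes> v)" using False by (simp add: basis_step_def)
    then show ?thesis using Cons.IH[of u "u \<otimes> v"] Cons.prems False c by (simp add: algebra_simps)
  qed
qed

lemma abel_mediant:
  "abel (mediant d p) = (int (fst (coef p)), (if d then 1 else -1) * int (snd (coef p)))"
  unfolding mediant_def using abel_descendant[of a "if d then b else inv b" p]
  by (cases d) (simp_all add: abel_props)

lemma curve_class_abel:
  assumes "g \<in> carrier G" "h \<in> carrier G" "curve_class g = curve_class h"
  shows "abel g = abel h \<or> abel g = - abel h"
  using assms by (auto simp: curve_class_eq_iff)

text \<open>Homology up to sign is a class invariant. The positive first coordinate fixes the sign,
  the sign of the second determines \<open>d\<close>, and injectivity of \<open>coef\<close>
  recovers the path.\<close>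

lemma curve_class_mediant_inj:
  assumes "curve_class (mediant d p) = curve_class (mediant d' p')"
  shows "d = d' \<and> p = p'"
proof -
  define m n m' n' where "m = fst (coef p)" and "n = snd (coef p)"
    and "m' = fst (coef p')" and "n' = snd (coef p')"
  have pos: "0 < m" "0 < n" "0 < m'" "0 < n'" by (simp_all add: m_def n_def m'_def n'_def coef_pos)
  define i i' :: int where "i = (if d then 1 else -1)" and "i' = (if d' then 1 else -1)"
  have "(int m, i * int n) = (int m', i' * int n') \<or> (int m, i * int n) = - (int m', i' * int n')"
    using curve_class_abel[OF mediant_closed mediant_closed assms]
    unfolding abel_mediant m_def n_def m'_def n'_def i_def i'_def .
  then have "int m = int m' \<and> i * int n = i' * int n'" using pos by auto
  then have "m = m' \<and> n = n' \<and> d = d'"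
    using pos by (cases d; cases d') (simp_all add: i_def i'_def)
  then show ?thesis
    using injD[OF inj_coef, of p p'] by (simp add: m_def n_def m'_def n'_def prod_eq_iff)
qed

text \<open>In homology \<open>a\<close> and \<open>b\<close> each have one vanishing coordinate,
  and not the same one, whereas a mediant has none.\<close>

lemma curve_class_distinct:
  "curve_class a \<noteq> curve_class b" "curve_class a \<noteq> curve_class (mediant d p)"
  "curve_class b \<noteq> curve_class (mediant d p)"
proof -
  define M N where "M = int (fst (coef p))" and "N = (if d then 1 else -1) * int (snd (coef p))"
  have pos: "M \<noteq> 0" "N \<noteq> 0" using coef_pos[of p] by (simp_all add: M_def N_def)
  show "curve_class a \<noteq> curve_class b"
    using curve_class_abel[OF a_closed b_closed] unfolding abel_props by fastforce
  show "curve_class a \<noteq> curve_class (mediant d p)"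
  proof
    assume "curve_class a = curve_class (mediant d p)"
    from curve_class_abel[OF a_closed mediant_closed this] show False
      using pos(2) unfolding abel_props abel_mediant M_def[symmetric] N_def[symmetric] by simp
  qed
  show "curve_class b \<noteq> curve_class (mediant d p)"
  proof
    assume "curve_class b = curve_class (mediant d p)"
    from curve_class_abel[OF b_closed mediant_closed this] show False
      using pos(1) unfolding abel_props abel_mediant M_def[symmetric] N_def[symmetric] by simp
  qed
qed

section \<open>Traces of a representation along the tree\<close>

context
  fixes \<rho> :: "'a \<Rightarrow> complex^2^2"
  assumes rho: "\<rho> \<in> hom G SL2C"
begin

definition tr :: "'a \<Rightarrow> complex" where "tr g = trace (\<rho> g)"

lemma rho_mult: "x \<in> carrier G \<Longrightarrow> y \<in> carrier G \<Longrightarrow> \<rho> (x \<otimes> y) = \<rho> x ** \<rho> y"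
  using hom_mult[OF rho] by (simp add: SL2C_def)

lemma tr_commute: "x \<in> carrier G \<Longrightarrow> y \<in> carrier G \<Longrightarrow> tr (x \<otimes> y) = tr (y \<otimes> x)"
  unfolding tr_def by (simp only: rho_mult trace_mul_sym[of "\<rho> x" "\<rho> y"])

lemma rho_one: "\<rho> \<one> = mat 1"
  using hom_one[OF rho is_group group_SL2C] by (simp add: SL2C_def)

lemma tr_one: "tr \<one> = 2"
  by (simp add: tr_def rho_one trace_def mat_def)

lemma tr_mult_inv:
  assumes "x \<in> carrier G" "y \<in> carrier G"
  shows "tr (x \<otimes> y) + tr (x \<otimes> inv y) = tr x * tr y"
proof -
  have "det (\<rho> y) = 1" using rho assms(2) by (auto simp: hom_def SL2C_def)
  moreover have "\<rho> (inv y) ** \<rho> y = mat 1"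
    using assms by (simp add: rho_mult[symmetric] rho_one)
  ultimately show ?thesis using trace_mult_inverse_SL2[of "\<rho> y" "\<rho> (inv y)" "\<rho> x"] assms
    by (simp add: tr_def rho_mult)
qed

lemma tr_inv: "x \<in> carrier G \<Longrightarrow> tr (inv x) = tr x"
  using tr_mult_inv[of \<one> x] by (simp add: tr_one)

lemma tr_conj: "c \<in> carrier G \<Longrightarrow> x \<in> carrier G \<Longrightarrow> tr (conj c x) = tr x"
  using tr_commute[of "c \<otimes> x" "inv c"] by (simp add: conj_def cancel_simps)

text \<open>Fricke's identity, stated with \<open>x \<otimes> inv y\<close> because that is the
  region behind the edge; it is the source of the Markoff equation with \<mu> = \<tau> + 2.\<close>

lemma tr_commutator:
  assumes x: "x \<in> carrier G" and y: "y \<in> carrier G"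
  shows "tr (x \<otimes> y \<otimes> inv x \<otimes> inv y) =
    (tr x)\<^sup>2 + (tr y)\<^sup>2 + (tr (x \<otimes> inv y))\<^sup>2 - tr x * tr y * tr (x \<otimes> inv y) - 2"
proof -
  have 1: "tr (x \<otimes> conj y (inv x)) + tr (x \<otimes> inv (conj y (inv x))) = tr x * tr x"
    using tr_mult_inv[of x "conj y (inv x)"] x y by (simp add: tr_conj tr_inv)
  have 2: "tr ((x \<otimes> y) \<otimes> (x \<otimes> inv y)) + tr ((x \<otimes> y) \<otimes> inv (x \<otimes> inv y)) = tr (x \<otimes> y) * tr (x \<otimes> inv y)"
    using x y by (intro tr_mult_inv) auto
  have 3: "tr ((x \<otimes> y) \<otimes> inv (x \<otimes> inv y)) = tr (y \<otimes> y)"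
    using tr_conj[of x "y \<otimes> y"] x y by (simp add: word_simps)
  have 4: "tr (y \<otimes> y) + 2 = tr y * tr y" using tr_mult_inv[OF y y] y by (simp add: tr_one)
  have 5: "tr (x \<otimes> y) + tr (x \<otimes> inv y) = tr x * tr y" by (rule tr_mult_inv[OF x y])
  have "tr (x \<otimes> y \<otimes> inv x \<otimes> inv y) = tr (x \<otimes> conj y (inv x))"
    "tr (x \<otimes> inv (conj y (inv x))) = tr ((x \<otimes> y) \<otimes> (x \<otimes> inv y))"
    using x y by (simp_all add: word_simps)
  with 1 2 3 4 5 show ?thesis by algebra
qed

text \<open>Taking \<open>inv (snd p)\<close> in the third entry makes the region ahead the trace of
  the product, by tr (u v) + tr (u v^-1) = tr u tr v.\<close>

definition trace_edge :: "'a \<times> 'a \<Rightarrow> edge" where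
  "trace_edge p = (tr (fst p), tr (snd p), tr (fst p \<otimes> inv (snd p)))"

lemma ahead_trace_edge:
  "u \<in> carrier G \<Longrightarrow> v \<in> carrier G \<Longrightarrow> ahead (trace_edge (u, v)) = tr (u \<otimes> v)"
  using tr_mult_inv[of u v] by (simp add: ahead_def trace_edge_def algebra_simps)

lemma trace_edge_step:
  assumes "u \<in> carrier G" "v \<in> carrier G"
  shows "trace_edge (basis_step G d (u, v)) = edge_step d (trace_edge (u, v))"
proof (cases d)
  case True
  then show ?thesis using assms ahead_trace_edge[OF assms]
    by (simp add: edge_step_def) (simp add: trace_edge_def basis_step_def m_assoc)
next
  case False
  have "tr (u \<otimes> inv (u \<otimes> v)) = tr v"
    using tr_conj[of u "inv v"] assms by (simp add: word_simps tr_inv)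
  then show ?thesis using False assms ahead_trace_edge[OF assms]
    by (simp add: edge_step_def) (simp add: trace_edge_def basis_step_def)
qed

lemma ahead_tree: "ahead (descend p (trace_edge (a, if d then b else inv b))) = tr (mediant d p)"
proof -
  have "descend p (trace_edge (a, if d then b else inv b)) = trace_edge (tree_pair d p)"
  proof (induction p rule: rev_induct)
    case (snoc x p)
    have "trace_edge (basis_step G x (fst (tree_pair d p), snd (tree_pair d p))) =
        edge_step x (trace_edge (fst (tree_pair d p), snd (tree_pair d p)))"
      by (rule trace_edge_step) simp_all
    then show ?case using snoc by simp
  qed simp
  then show ?thesis
    using ahead_trace_edge[of "fst (tree_pair d p)" "snd (tree_pair d p)"] by (simp add: mediant_def)
qed

lemma class_trace_curve_class: "g \<in> carrier G \<Longrightarrow> class_trace \<rho> (curve_class g) = tr g"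
  unfolding tr_def
  by (rule class_trace_eq[OF is_group rho curve_class_in_quotient curve_class_self])

end

end

section \<open>The identity\<close>

text \<open>Since exp (l(v)) is the square of the multiplier l, numerator and denominator of the gap
  function are l times the two gap numerators.\<close>

lemma h_fun_eq_Ln_gap:
  "h_fun \<tau> v = Ln (gap_num (exp (nu \<tau>)) v / gap_num (inverse (exp (nu \<tau>))) v)"
proof -
  define l where "l = multiplier v"
  have l0: "l \<noteq> 0" by (simp add: l_def)
  have "exp (l_fun v) = l\<^sup>2"
    unfolding l_fun_def l_def multiplier_def by (rule exp_double)
  moreover have "gap_num e v = (e + l\<^sup>2) / l" for e
    using l0 by (simp add: gap_num_def l_def[symmetric] power2_eq_square divide_inverse distrib_right mult.assoc)
  ultimately show ?thesis using l0 by (simp add: h_fun_def exp_minus)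
qed

text \<open>This is cosh \<nu> = -\<tau>/2 in terms of e = e^\<nu>. Multiplied by e it becomes the
  quadratic relation \<open>\<kappa>\<^sup>2 = - ((1 + \<kappa>) * \<mu>)\<close> for \<kappa> = e -
  1.\<close>

lemma exp_nu: "\<tau> + 2 = 2 - exp (nu \<tau>) - inverse (exp (nu \<tau>))"
proof -
  have "cosh (nu \<tau>) = - \<tau> / 2" unfolding nu_def by (rule acosh_prop)
  then have "exp (nu \<tau>) + inverse (exp (nu \<tau>)) = - \<tau>"
    unfolding cosh_def exp_minus[symmetric] scaleR_conv_of_real by simp
  then have "\<tau> = - (exp (nu \<tau>) + inverse (exp (nu \<tau>)))" by (simp only: minus_minus)
  then show ?thesis by (simp only: minus_add_distrib) simp
qed

lemma has_sum_lists_tendsto: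
  fixes f :: "bool list \<Rightarrow> complex"
  assumes "f summable_on UNIV"
  shows "(\<lambda>n. \<Sum>p | length p < n. f p) \<longlonglongrightarrow> infsum f UNIV"
  using has_sum_infsum[OF assms] unfolding has_sum_def
  by (rule filterlim_compose[OF _ filterlim_short_lists])

context rank_two_basis begin

theorem mcshane_identity:
  fixes \<rho> :: "'a \<Rightarrow> complex^2^2" and \<tau> :: complex
  assumes rho: "\<rho> \<in> hom G SL2C"
    and tau: "trace (\<rho> (a \<otimes> b \<otimes> inv a \<otimes> inv b)) = \<tau>" "\<tau> \<noteq> 2"
    and BQ: "BQ_conditions G \<rho>"
  shows "(\<lambda>C. norm (h_fun \<tau> (class_trace \<rho> C))) summable_on curve_classes G
    \<and> (\<exists>k::int. (\<Sum>\<^sub>\<infinity>C\<in>curve_classes G. h_fun \<tau> (class_trace \<rho> C))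
          = nu \<tau> + 2 * pi * \<i> * of_int k)"
proof -
  define T where "T = tr \<rho>"
  define x y z where "x = T a" and "y = T b" and "z = T (a \<otimes> inv b)"
  \<comment> \<open>The two orientations of the root edge. \<open>s False\<close> belongs to the
    pair of \<open>a\<close> and \<open>inv b\<close>, whose region behind is that of
    \<open>a \<otimes> b\<close>, with trace x y - z.\<close>
  define s where "s d = (x, y, if d then z else x * y - z)" for d
  define \<mu> where "\<mu> = \<tau> + 2"
  define e where "e = exp (nu \<tau>)"
  have e0: "e \<noteq> 0" and mu_e: "\<mu> = 2 - e - inverse e"
    unfolding \<mu>_def e_def by (simp, rule exp_nu)
  have s_edge: "trace_edge \<rho> (a, if d then b else inv b) = s d" for d
    using tr_mult_inv[OF rho a_closed b_closed] tr_inv[OF rho b_closed]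
    by (cases d) (simp_all add: trace_edge_def[OF rho] s_def x_def y_def z_def T_def algebra_simps)
  have ahead_s: "ahead (descend p (s d)) = T (mediant d p)" for d p
    using ahead_tree[OF rho, of p d] by (simp only: s_edge T_def)
  have class_tr: "class_trace \<rho> (curve_class g) = T g" if "g \<in> carrier G" for g
    unfolding T_def by (rule class_trace_curve_class[OF rho that])
  have cc: "curve_class a \<in> curve_classes G" "curve_class b \<in> curve_classes G"
    "curve_class (mediant d p) \<in> curve_classes G" for d p
    unfolding curve_classes_eq_tree using mediant_in_tree_classes by (auto simp: tree_classes_def)
  have nonreal: "T g \<notin> complex_of_real ` {-2..2}"
    if "g \<in> carrier G" "curve_class g \<in> curve_classes G" for g
    using BQ that(2) class_tr[OF that(1)] unfolding BQ_conditions_def by metis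
  have mk: "markoff \<mu> (s d)" for d
  proof -
    have "\<tau> = x\<^sup>2 + y\<^sup>2 + z\<^sup>2 - x * y * z - 2"
      using tr_commutator[OF rho a_closed b_closed] tau(1) by (simp add: x_def y_def z_def T_def tr_def[OF rho])
    then show ?thesis
      unfolding markoff_def \<mu>_def s_def by (cases d) (simp_all add: power2_eq_square algebra_simps)
  qed
  have tree: "bq_tree \<mu> (s d)" for d
  proof
    show "markoff \<mu> (s d)" by (rule mk)
    show "\<mu> \<noteq> 4" using tau(2) by (simp add: \<mu>_def)
    show "ahead (descend p (s d)) \<notin> complex_of_real ` {-2..2}" for p
      unfolding ahead_s by (rule nonreal[OF mediant_closed cc(3)])
    show "lf (s d) \<notin> complex_of_real ` {-2..2}" "rt (s d) \<notin> complex_of_real ` {-2..2}"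
      using nonreal[OF a_closed cc(1)] nonreal[OF b_closed cc(2)] by (simp_all add: s_def x_def y_def)
    \<comment> \<open>(BQ2) counts classes while the tree is indexed by paths; injectivity carries
      finiteness over.\<close>
    have "inj (\<lambda>p. curve_class (mediant d p))"
      by (rule injI) (use curve_class_mediant_inj in blast)
    moreover have "(\<lambda>p. curve_class (mediant d p)) ` {p. norm (T (mediant d p)) \<le> 2} \<subseteq>
        {C \<in> curve_classes G. norm (class_trace \<rho> C) \<le> 2}"
      using cc(3) class_tr[OF mediant_closed] by auto
    moreover have "finite {C \<in> curve_classes G. norm (class_trace \<rho> C) \<le> 2}"
      using BQ unfolding BQ_conditions_def by blast
    ultimately show "finite {p. norm (ahead (descend p (s d))) \<le> 2}"
      unfolding ahead_s by (meson finite_imageD finite_subset inj_on_subset subset_UNIV)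
  qed
  have t1: "bq_tree \<mu> (x, y, z)" and t2: "bq_tree \<mu> (x, y, x * y - z)"
    using tree[of True] tree[of False] by (simp_all add: s_def)
  define H where "H v = h_fun \<tau> v" for v
  define Gp where "Gp v = gap_num e v / gap_num (inverse e) v" for v
  have H_Ln: "H v = Ln (Gp v)" for v unfolding H_def Gp_def e_def by (rule h_fun_eq_Ln_gap)
  note sides = gap_product_tendsto(1,2)[OF t1 t2 e0 mu_e]
  have Gp_nz: "Gp v \<noteq> 0" if "v\<^sup>2 \<noteq> \<mu>" for v
    using gap_num_mult[OF e0 mu_e, of v] that by (auto simp: Gp_def)
  have ahead_sq: "(ahead (descend p (s d)))\<^sup>2 \<noteq> \<mu>" for p d
    by (rule bq_tree.ahead_sq_neq[OF tree])
  have exp_H: "exp (H v) = Gp v" if "v\<^sup>2 \<noteq> \<mu>" for v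
    unfolding H_Ln using Gp_nz[OF that] by (rule exp_Ln)
  have summ: "(\<lambda>p. norm (H (T (mediant d p)))) summable_on UNIV" for d
    unfolding ahead_s[symmetric] H_Ln Gp_def
    using sides by (intro bq_tree.summable_Ln_gap[OF tree e0 mu_e]) (simp_all add: s_def)
  define S where "S d = infsum (\<lambda>p. H (T (mediant d p))) UNIV" for d
  have summ': "(\<lambda>p. H (T (mediant d p))) summable_on UNIV" for d
    using summ[of d] by (rule abs_summable_summable)
  have lim_S: "(\<lambda>n. \<Sum>p | length p < n. H (T (mediant d p))) \<longlonglongrightarrow> S d" for d
    unfolding S_def by (rule has_sum_lists_tendsto[OF summ'])
  let ?K = "\<lambda>d p. curve_class (mediant d p)"
  let ?f = "\<lambda>C. h_fun \<tau> (class_trace \<rho> C)"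
  have inj: "inj (?K d)" for d
    by (rule injI) (use curve_class_mediant_inj in blast)
  have f_K: "?f \<circ> ?K d = (\<lambda>p. H (T (mediant d p)))" for d
    by (simp add: fun_eq_iff class_tr H_def)
  have hs_K: "(?f has_sum S d) (range (?K d))" for d
    unfolding has_sum_reindex[OF inj] f_K S_def by (rule has_sum_infsum[OF summ'])
  have disj: "{curve_class a, curve_class b} \<inter> range (?K True) = {}"
    "({curve_class a, curve_class b} \<union> range (?K True)) \<inter> range (?K False) = {}"
    using curve_class_distinct(2,3) curve_class_mediant_inj by blast+
  have "(?f has_sum (H x + H y)) {curve_class a, curve_class b}"
    using has_sum_finite[of "{curve_class a, curve_class b}" ?f] curve_class_distinct(1)
    by (simp add: class_tr H_def x_def y_def)
  from has_sum_Un_disjoint[OF has_sum_Un_disjoint[OF this hs_K disj(1)] hs_K disj(2)]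
  have total: "(?f has_sum (H x + H y + S True + S False)) (curve_classes G)"
    unfolding curve_classes_eq_tree tree_classes_def .
  have norm_K: "(\<lambda>C. norm (?f C)) summable_on range (?K d)" for d
    unfolding summable_on_reindex[OF inj] using summ[of d] by (simp add: comp_def class_tr H_def)
  have "(\<lambda>C. norm (?f C)) summable_on {curve_class a, curve_class b}" by simp
  from summable_on_Un_disjoint[OF summable_on_Un_disjoint[OF this norm_K disj(1)] norm_K disj(2)]
  have abs: "(\<lambda>C. norm (?f C)) summable_on curve_classes G"
    unfolding curve_classes_eq_tree tree_classes_def .
  \<comment> \<open>Principal logarithms need not add up to the logarithm of the product, so the
    exponentials of the ball sums are compared. The integer \<open>k\<close> of the conclusion
    arises when the limit is read back through \<open>exp\<close>.\<close>
  have "(\<lambda>n. exp (H x + H y + (\<Sum>p | length p < n. H (T (mediant True p)))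
      + (\<Sum>p | length p < n. H (T (mediant False p))))) \<longlonglongrightarrow> exp (H x + H y + S True + S False)"
    by (intro tendsto_intros lim_S)
  moreover have "exp (H x + H y + (\<Sum>p | length p < n. H (T (mediant True p)))
      + (\<Sum>p | length p < n. H (T (mediant False p)))) =
      Gp x * Gp y * ((\<Prod>p | length p < n. Gp (ahead (descend p (x, y, z)))) *
        (\<Prod>p | length p < n. Gp (ahead (descend p (x, y, x * y - z)))))" for n
  proof -
    have "exp (\<Sum>p | length p < n. H (T (mediant d p))) = (\<Prod>p | length p < n. Gp (ahead (descend p (s d))))" for d
      unfolding ahead_s[symmetric] by (simp add: exp_sum finite_bool_lists exp_H[OF ahead_sq])
    from this[of True] this[of False] show ?thesis
      by (simp add: exp_add exp_H[OF sides(1)] exp_H[OF sides(2)] s_def mult.assoc)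
  qed
  moreover have "(\<lambda>n. Gp x * Gp y * ((\<Prod>p | length p < n. Gp (ahead (descend p (x, y, z)))) *
        (\<Prod>p | length p < n. Gp (ahead (descend p (x, y, x * y - z)))))) \<longlonglongrightarrow> e"
    unfolding Gp_def by (rule gap_product_tendsto(3)[OF t1 t2 e0 mu_e])
  ultimately have "exp (H x + H y + S True + S False) = exp (nu \<tau>)"
    unfolding e_def[symmetric] using LIMSEQ_unique by fastforce
  then obtain k :: int where
    "H x + H y + S True + S False = nu \<tau> + (of_int (2 * k) * pi) * \<i>"
    unfolding exp_eq by auto
  then have "infsum ?f (curve_classes G) = nu \<tau> + 2 * pi * \<i> * of_int k"
    using infsumI[OF total] by (simp add: mult_ac)
  then show ?thesis using abs by blast
qed

end

theorem theorem2p2: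
  fixes \<Gamma> :: "('g, 'm) monoid_scheme"
    and \<tau> :: complex
    and \<rho> :: "'g \<Rightarrow> complex^2^2"
  assumes "free_group_rank_two \<Gamma>"
    and "\<tau> \<noteq> 2"
    and "tau_representation \<Gamma> \<tau> \<rho>"
    and "BQ_conditions \<Gamma> \<rho>"
  shows "(\<lambda>C. norm (h_fun \<tau> (class_trace \<rho> C))) summable_on curve_classes \<Gamma>
    \<and> (\<exists>k::int. (\<Sum>\<^sub>\<infinity>C\<in>curve_classes \<Gamma>. h_fun \<tau> (class_trace \<rho> C))
          = nu \<tau> + 2 * pi * \<i> * of_int k)"
proof -
  obtain a b where ab: "free_generators \<Gamma> a b"
    and tr: "trace (\<rho> (a \<otimes>\<^bsub>\<Gamma>\<^esub> b \<otimes>\<^bsub>\<Gamma>\<^esub> inv\<^bsub>\<Gamma>\<^esub> a \<otimes>\<^bsub>\<Gamma>\<^esub> inv\<^bsub>\<Gamma>\<^esub> b)) = \<tau>"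
    and rho: "\<rho> \<in> hom \<Gamma> SL2C"
    using assms(3) unfolding tau_representation_def by blast
  have "group \<Gamma>" using assms(1) by (simp add: free_group_rank_two_def)
  then interpret rank_two_basis \<Gamma> a b
    by (simp add: rank_two_basis_def rank_two_basis_axioms_def ab)
  show ?thesis by (rule mcshane_identity[OF rho tr assms(2,4)])
qed

end
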